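(* Let $N\ge 1$, let $\Omega\subset\mathbb{R}^N$ be a bounded domain, let $\Lambda\ge 1$, and let $$\mathcal{L}u=\sum_{i,j=1}^N a_{ij}(x)\,\partial^2_{ij}u,\qquad \frac1\Lambda I\le A(x)\le\Lambda I,$$ where $A(x)=(a_{ij}(x))$ has bounded measurable coefficients. Let $\ell\in\{0,\infty\}$ and let $f\colon\mathbb{R}\to\mathbb{R}$ be a locally Lipschitz function. Suppose that there exists a sequence $\{\alpha_n\}\subset(0,\infty)$ such that $\alpha_n\to\ell$ and $f(\alpha_n)=0$ for every $n\in\mathbb{N}$. For $s\ge 0$ define $$F_\Lambda(s)=\int_0^s f^+(t)\,\mathrm{d}t-\frac{1}{\Lambda^2}\int_0^s f^-(t)\,\mathrm{d}t,$$ and suppose that $$-\infty<L^-_\Lambda=\liminf_{s\to\ell}\frac{F_\Lambda(s)}{s^2}\le\limsup_{s\to\ell}\frac{F_\Lambda(s)}{s^2}=L^+_\Lambda<\infty.$$ Then there exists $\underline{\lambda}\in(0,\infty]$ such that no $\lambda\in[0,\underline{\lambda})$ is a bifurcation point from $\ell$ for the problem $$-\mathcal{L}u=\lambda f(u)\ \text{ in }\Omega,\qquad u=0\ \text{ on }\partial\Omega.$$ Moreover, if $L^+_\Lambda<0$ or $L^-_\Lambda=L^+_\Lambda=0$, then this holds with $\underline{\lambda}=\infty$.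
   Context: Here $f^+=\max\{f,0\}$ and $f^-=\max\{-f,0\}$. The matrix $A(x)$ is symmetric and the inequalities are in the sense of quadratic forms. The limits as $s\to\ell$ are taken as $s\to 0^+$ if $\ell=0$ and as $s\to\infty$ if $\ell=\infty$. Solutions are understood as strong solutions: $u\in W^{2,N}_{\mathrm{loc}}(\Omega)\cap C(\overline{\Omega})$, the equation holds a.e. in $\Omega$, and $u=0$ on $\partial\Omega$. A value $\tilde\lambda\ge 0$ is a bifurcation point from $\ell\in\{0,\infty\}$ for the problem if there exists a sequence of pairs $\{(\lambda_n,u_n)\}\subset(0,\infty)\times L^\infty(\Omega)$, with $u_n\ge 0$, $u_n\not\equiv 0$, and $u_n$ a solution of the problem with $\lambda=\lambda_n$, such that $\lambda_n\to\tilde\lambda$ and $\|u_n\|_{L^\infty(\Omega)}\to\ell$. *)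

theory Defs
  imports "HOL-Probability.Essential_Supremum"
begin

section \<open>Local Sobolev spaces\<close>

text \<open>Multi-indices are lists of coordinates: \<open>partials [i, j] \<phi>\<close> is
  \<open>\<partial>\<^sub>i \<partial>\<^sub>j \<phi>\<close>.\<close>

primrec partials :: "'n list \<Rightarrow> (real^'n \<Rightarrow> real) \<Rightarrow> real^'n \<Rightarrow> real" where
  "partials [] \<phi> = \<phi>"
| "partials (i # is) \<phi> = (\<lambda>x. frechet_derivative (partials is \<phi>) (at x) (axis i 1))"

text \<open>Differentiability of all iterated partial derivatives is the same as being smooth.\<close>

definition test_function :: "(real^'n) set \<Rightarrow> (real^'n \<Rightarrow> real) \<Rightarrow> bool" where
  "test_function \<Omega> \<phi> \<longleftrightarrow>
     (\<forall>is x. partials is \<phi> differentiable (at x)) \<and>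
     compact (closure {x. \<phi> x \<noteq> 0}) \<and> closure {x. \<phi> x \<noteq> 0} \<subseteq> \<Omega>"

definition Lp_loc :: "nat \<Rightarrow> (real^'n) set \<Rightarrow> (real^'n \<Rightarrow> real) set" where
  "Lp_loc p \<Omega> = {u. set_borel_measurable lebesgue \<Omega> u \<and>
     (\<forall>K. compact K \<and> K \<subseteq> \<Omega> \<longrightarrow> set_integrable lebesgue K (\<lambda>x. \<bar>u x\<bar> ^ p))}"

definition has_weak_deriv ::
  "(real^'n) set \<Rightarrow> 'n list \<Rightarrow> (real^'n \<Rightarrow> real) \<Rightarrow> (real^'n \<Rightarrow> real) \<Rightarrow> bool" where
  "has_weak_deriv \<Omega> is u g \<longleftrightarrow>
     u \<in> Lp_loc 1 \<Omega> \<and> g \<in> Lp_loc 1 \<Omega> \<and>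
     (\<forall>\<phi>. test_function \<Omega> \<phi> \<longrightarrow>
        (LINT x:\<Omega>|lebesgue. u x * partials is \<phi> x)
          = (-1) ^ length is * (LINT x:\<Omega>|lebesgue. g x * \<phi> x))"

definition Wkp_loc :: "nat \<Rightarrow> nat \<Rightarrow> (real^'n) set \<Rightarrow> (real^'n \<Rightarrow> real) set" where
  "Wkp_loc k p \<Omega> = {u \<in> Lp_loc p \<Omega>.
     \<forall>is. length is \<le> k \<longrightarrow> (\<exists>g \<in> Lp_loc p \<Omega>. has_weak_deriv \<Omega> is u g)}"

section \<open>The Dirichlet problem\<close>

definition elliptic_coeffs ::
  "real \<Rightarrow> (real^'n) set \<Rightarrow> (real^'n \<Rightarrow> real^'n^'n) \<Rightarrow> bool" where
  "elliptic_coeffs \<Lambda> \<Omega> A \<longleftrightarrow>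
     (\<forall>i j. set_borel_measurable lebesgue \<Omega> (\<lambda>x. A x $ i $ j)) \<and>
     (\<exists>C. \<forall>x\<in>\<Omega>. \<forall>i j. \<bar>A x $ i $ j\<bar> \<le> C) \<and>
     (\<forall>x\<in>\<Omega>. transpose (A x) = A x) \<and>
     (\<forall>x\<in>\<Omega>. \<forall>\<xi>. 1 / \<Lambda> * (\<xi> \<bullet> \<xi>) \<le> \<xi> \<bullet> (A x *v \<xi>) \<and> \<xi> \<bullet> (A x *v \<xi>) \<le> \<Lambda> * (\<xi> \<bullet> \<xi>))"

text \<open>Values of \<open>u\<close> outside \<open>closure \<Omega>\<close> are irrelevant. The function \<open>H i j\<close> is a
  representative of the weak derivative \<open>\<partial>\<^sub>i \<partial>\<^sub>j u\<close>, which is unique almost everywhere.\<close>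

definition strong_solution ::
  "(real^'n) set \<Rightarrow> (real^'n \<Rightarrow> real^'n^'n) \<Rightarrow> (real \<Rightarrow> real) \<Rightarrow> real \<Rightarrow> (real^'n \<Rightarrow> real) \<Rightarrow> bool" where
  "strong_solution \<Omega> A f lam u \<longleftrightarrow>
     u \<in> Wkp_loc 2 CARD('n) \<Omega> \<and>
     continuous_on (closure \<Omega>) u \<and>
     (\<exists>H. (\<forall>i j. has_weak_deriv \<Omega> [i, j] u (H i j)) \<and>
          (AE x in lebesgue_on \<Omega>.
             - (\<Sum>i\<in>UNIV. \<Sum>j\<in>UNIV. A x $ i $ j * H i j x) = lam * f (u x))) \<and>
     (\<forall>x\<in>frontier \<Omega>. u x = 0)"

text \<open>The norm is \<open>\<infinity>\<close> exactly when \<open>u\<close> is not in \<open>L\<^sup>\<infinity>(\<Omega>)\<close>; this includes non-measurable \<open>u\<close>,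
  by the convention for \<open>esssup\<close>.\<close>

definition Linf_norm :: "(real^'n) set \<Rightarrow> (real^'n \<Rightarrow> real) \<Rightarrow> ereal" where
  "Linf_norm \<Omega> u = esssup (lebesgue_on \<Omega>) (\<lambda>x. ereal \<bar>u x\<bar>)"

definition bifurcation_point ::
  "(real^'n) set \<Rightarrow> (real^'n \<Rightarrow> real^'n^'n) \<Rightarrow> (real \<Rightarrow> real) \<Rightarrow> ereal \<Rightarrow> real \<Rightarrow> bool" where
  "bifurcation_point \<Omega> A f l mu \<longleftrightarrow>
     0 \<le> mu \<and>
     (\<exists>(lam :: nat \<Rightarrow> real) (u :: nat \<Rightarrow> real^'n \<Rightarrow> real).
        (\<forall>n. 0 < lam n \<and>
             u n \<in> borel_measurable (lebesgue_on \<Omega>) \<and> Linf_norm \<Omega> (u n) < \<infinity> \<and>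
             (\<forall>x\<in>\<Omega>. 0 \<le> u n x) \<and> (\<exists>x\<in>\<Omega>. u n x \<noteq> 0) \<and>
             strong_solution \<Omega> A f (lam n) (u n)) \<and>
        lam \<longlonglongrightarrow> mu \<and>
        (\<lambda>n. Linf_norm \<Omega> (u n)) \<longlonglongrightarrow> l)"

section \<open>The weighted primitive\<close>

definition F_weighted :: "real \<Rightarrow> (real \<Rightarrow> real) \<Rightarrow> real \<Rightarrow> real" where
  "F_weighted \<Lambda> f s =
     integral {0..s} (\<lambda>t. max (f t) 0) - 1 / \<Lambda>\<^sup>2 * integral {0..s} (\<lambda>t. max (- f t) 0)"

text \<open>The filter for limits as \<open>s \<rightarrow> l\<close>; only \<open>l = 0\<close> and \<open>l = \<infinity>\<close> are used.\<close>

definition towards :: "ereal \<Rightarrow> real filter" where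
  "towards l = (if l = \<infinity> then at_top else at_right 0)"

end

theory Submission
  imports Defs "HOL-Computational_Algebra.Polynomial"
begin

text \<open>A solution \<open>u\<close> is compared with one-dimensional profiles \<open>\<psi> (x $ k)\<close>. As the diagonal
  coefficient \<open>A x $ k $ k\<close> lies in \<open>[1/\<Lambda>, \<Lambda>]\<close>, a profile with
  \<open>\<psi>'' = - \<Lambda> \<lambda> (f\<^sup>+ - f\<^sup>- / \<Lambda>\<^sup>2)(\<psi>) = - \<Lambda> \<lambda> F'(\<psi>)\<close> is a supersolution whatever the sign of
  \<open>f(\<psi>)\<close>; this is where the weight \<open>1/\<Lambda>\<^sup>2\<close> in \<open>F\<close> comes from. The energy \<open>\<psi>'\<^sup>2/2 + \<Lambda> \<lambda> F(\<psi>) = E\<close> is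
  conserved, so \<open>\<psi>\<close> climbs from the level \<open>a\<close> to the level \<open>M\<close> in the time
  \<open>\<integral>\<^sub>a\<^sup>M ds / sqrt (2 (E - \<Lambda> \<lambda> F(s)))\<close>. If \<open>u\<close> vanishes on the boundary and has maximum \<open>M\<close>, this
  time is at most the width of the domain (\<open>travel_time_le_width\<close>, and \<open>travel_time_bound\<close> in the form
  used later): otherwise some translate of the profile would touch \<open>u\<close> from above inside the domain.

  Two choices of the energy give the theorem. If \<open>|F| \<le> K M\<^sup>2\<close> on \<open>[0, 2 M]\<close>, an energy of order
  \<open>\<lambda> K M\<^sup>2\<close> is admissible and the time is at least a multiple of \<open>1 / sqrt (\<lambda> K)\<close>, so \<open>\<lambda>\<close> is bounded
  below by a multiple of \<open>1/K\<close> (\<open>lambda_lower_bound\<close>). Near \<open>l\<close> such a \<open>K\<close> exists, and it is arbitrarily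
  small if \<open>L_minus = L_plus = 0\<close>. If \<open>L_plus < 0\<close>, then \<open>F\<close> attains its maximum over the relevant levels
  at some \<open>a\<close>, with \<open>F(a) - F(s) \<le> C (s - a)\<^sup>2\<close>; as \<open>E\<close> decreases to \<open>\<Lambda> \<lambda> F(a)\<close> the time spent near
  \<open>a\<close> diverges logarithmically, and \<open>u\<close> cannot exceed \<open>a\<close> (\<open>no_solution_above_maximum_of_F\<close>). For
  \<open>l = 0\<close> one has \<open>a = 0\<close>. For \<open>l = \<infinity>\<close>, \<open>a\<close> is a fixed zero of \<open>f\<close>, found at or beyond one of the given
  zeros, while the maxima of the solutions tend to infinity.

  The contact step requires a maximum principle for functions that are only in \<open>W\<^sup>2\<^sup>,\<^sup>N\<close>: such a function
  cannot be touched from above by a quadratic polynomial \<open>P\<close> with \<open>L P < L u\<close> near the contact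
  point (\<open>no_strict_contact\<close>, \<open>not_touched_from_above\<close>). The proof is that of Aleksandrov, Bakelman and
  Pucci. After mollifying \<open>u\<close>, the gradients of \<open>u\<^sub>\<epsilon> - P\<close> at points of negative semidefinite Hessian
  still fill a ball of fixed radius. The volume of this gradient image is at most a multiple of the
  integral of the \<open>N\<close>-th power of the Hessian over such points, and there ellipticity bounds the Hessian
  by the difference of the second derivatives of \<open>u\<close> and \<open>u\<^sub>\<epsilon>\<close>, which tends to \<open>0\<close> in \<open>L\<^sup>N\<close>.\<close>

section \<open>Smooth bumps and mollifiers\<close>

text \<open>The classical bump \<open>exp (- 1 / (1 - t\<^sup>2))\<close> times a rational factor. This family is closed under
  differentiation, which makes smoothness of its members an induction.\<close>

definition bump_term :: "real poly \<Rightarrow> nat \<Rightarrow> real \<Rightarrow> real" where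
  "bump_term p k t =
     (if \<bar>t\<bar> < 1 then poly p t / (1 - t\<^sup>2) ^ k * exp (- 1 / (1 - t\<^sup>2)) else 0)"

lemma power_mult_exp_neg_inverse_le:
  fixes s :: real
  assumes "0 < s" "0 < n"
  shows "exp (- 1 / s) \<le> (real n) ^ n * s ^ n"
proof -
  have "(1 / s / real n) ^ n \<le> (1 + 1 / s / real n) ^ n"
    using assms by (intro power_mono) auto
  also have "\<dots> \<le> exp (1 / s)"
    using assms by (intro exp_ge_one_plus_x_over_n_power_n) (auto intro: order_trans[of _ 0])
  finally have "1 / (s ^ n * real n ^ n) \<le> exp (1 / s)"
    by (simp add: power_divide field_simps)
  then show ?thesis
    using assms by (simp add: exp_minus field_simps)
qed

text \<open>Quadratic vanishing at \<open>t = 1\<close> and \<open>t = - 1\<close> is all that differentiability at these two points requires: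
  the exponential beats every power of \<open>1 - t\<^sup>2\<close>.\<close>

lemma bump_term_le_square:
  obtains C where "0 \<le> C" "\<And>t. \<bar>bump_term p k t\<bar> \<le> C * (1 - t\<^sup>2)\<^sup>2"
proof -
  have "bounded (poly p ` {-1..1})"
    by (intro compact_imp_bounded compact_continuous_image continuous_intros) auto
  then have "\<exists>P. \<forall>t\<in>{-1..1}. \<bar>poly p t\<bar> \<le> P"
    by (simp add: bounded_iff)
  then obtain P where P: "\<And>t. t \<in> {-1..1} \<Longrightarrow> \<bar>poly p t\<bar> \<le> P"
    by blast
  have "0 \<le> P" using P[of 0] by auto
  let ?n = "k + 2"
  show ?thesis
  proof
    show "0 \<le> P * real ?n ^ ?n" using \<open>0 \<le> P\<close> by simp
    fix t :: real
    show "\<bar>bump_term p k t\<bar> \<le> (P * real ?n ^ ?n) * (1 - t\<^sup>2)\<^sup>2"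
    proof (cases "\<bar>t\<bar> < 1")
      case True
      define s where "s = 1 - t\<^sup>2"
      have s: "0 < s" using True by (simp add: s_def abs_square_less_1)
      have pt: "\<bar>poly p t\<bar> \<le> P" using True by (intro P) auto
      have "\<bar>bump_term p k t\<bar> = \<bar>poly p t\<bar> * (exp (- 1 / s) / s ^ k)"
        using True s by (simp add: bump_term_def s_def[symmetric] abs_mult)
      also have "\<dots> \<le> P * (real ?n ^ ?n * s ^ ?n / s ^ k)"
        using pt s \<open>0 \<le> P\<close>
        by (intro mult_mono divide_right_mono power_mult_exp_neg_inverse_le) auto
      also have "s ^ ?n = s\<^sup>2 * s ^ k" by (metis add.commute power_add)
      finally show ?thesis using s by (simp add: s_def)
    qed (use \<open>0 \<le> P\<close> in \<open>auto simp: bump_term_def\<close>)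
  qed
qed

lemma bump_term_derivative:
  "\<exists>q. \<forall>t. (bump_term p k has_real_derivative bump_term q (k + 2) t) (at t)"
proof -
  \<comment> \<open>the quotient rule, brought to the common denominator \<open>(1 - t\<^sup>2) ^ (k + 2)\<close>\<close>
  define q where "q = pderiv p * [:1, 0, -1:]\<^sup>2 + smult (2 * real k) ([:0, 1:] * p * [:1, 0, -1:])
                      - smult 2 ([:0, 1:] * p)"
  have "(bump_term p k has_real_derivative bump_term q (k + 2) t) (at t)" for t
  proof -
    consider "\<bar>t\<bar> < 1" | "\<bar>t\<bar> > 1" | "\<bar>t\<bar> = 1" by linarith
    then show ?thesis
    proof cases
      case 1
      define s where "s = 1 - t\<^sup>2"
      have s: "0 < s" using 1 by (simp add: s_def abs_square_less_1)
      have q: "poly q t = poly (pderiv p) t * s\<^sup>2 + 2 * real k * (t * poly p t * s) - 2 * (t * poly p t)"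
        by (simp add: q_def s_def algebra_simps power2_eq_square)
      have "((\<lambda>t. poly p t / (1 - t\<^sup>2) ^ k * exp (- 1 / (1 - t\<^sup>2))) has_real_derivative
             ((poly (pderiv p) t * s ^ k - poly p t * (real k * s ^ (k - 1) * (- (2 * t)))) / (s ^ k * s ^ k)
               * exp (- 1 / s) + poly p t / s ^ k * (exp (- 1 / s) * (- (2 * t) / (s * s))))) (at t)"
      proof -
        have S: "((\<lambda>t. 1 - t\<^sup>2) has_real_derivative - (2 * t)) (at t)"
          by (auto intro!: derivative_eq_intros)
        have 1: "((\<lambda>t. poly p t / (1 - t\<^sup>2) ^ k) has_real_derivative
             (poly (pderiv p) t * s ^ k - poly p t * (real k * s ^ (k - 1) * (- (2 * t)))) / (s ^ k * s ^ k)) (at t)"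
          by (rule DERIV_cong[OF DERIV_divide[OF poly_DERIV DERIV_power[OF S, of k]]])
             (use s in \<open>auto simp: s_def[symmetric] mult_ac\<close>)
        have 2: "((\<lambda>t. exp (- 1 / (1 - t\<^sup>2))) has_real_derivative
              exp (- 1 / s) * (- (2 * t) / (s * s))) (at t)"
          by (rule DERIV_cong[OF DERIV_fun_exp[OF DERIV_divide[OF DERIV_const S]]])
             (use s in \<open>auto simp: s_def[symmetric]\<close>)
        show ?thesis
          by (rule DERIV_cong[OF DERIV_mult[OF 1 2]]) (simp add: s_def[symmetric] mult_ac)
      qed
      also have "(poly (pderiv p) t * s ^ k - poly p t * (real k * s ^ (k - 1) * (- (2 * t)))) / (s ^ k * s ^ k)
               * exp (- 1 / s) + poly p t / s ^ k * (exp (- 1 / s) * (- (2 * t) / (s * s)))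
             = poly q t / s ^ (k + 2) * exp (- 1 / s)"
      proof -
        have *: "(a * K - b * (c * (- (2 * t)))) / (K * K) * E + b / K * (E * (- (2 * t) / (s * s)))
            = (a * s\<^sup>2 + 2 * r * (t * b * s) - 2 * (t * b)) / (K * s\<^sup>2) * E"
          if "c = r * K / s" "K \<noteq> 0" for a b c r E K :: real
        proof -
          have 1: "(a * K - b * (c * (- (2 * t)))) / (K * K) = (a + 2 * r * t * b / s) / K"
            unfolding that(1) using that(2) s by (simp add: field_simps)
          have 2: "(a + 2 * r * t * b / s) * s\<^sup>2 = a * s\<^sup>2 + 2 * r * (t * b * s)"
            using s by (simp add: field_simps power2_eq_square)
          have "(a * K - b * (c * (- (2 * t)))) / (K * K) * E + b / K * (E * (- (2 * t) / (s * s)))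
            = ((a + 2 * r * t * b / s) * s\<^sup>2 - 2 * (t * b)) / (K * s\<^sup>2) * E"
            unfolding 1 using that(2) s by (simp add: field_simps power2_eq_square)
          then show ?thesis unfolding 2 .
        qed
        have c: "real k * s ^ (k - 1) = real k * s ^ k / s"
          using s by (cases k) auto
        show ?thesis
          unfolding q power_add by (rule *[OF c]) (use s in simp)
      qed
      also have "\<dots> = bump_term q (k + 2) t"
        using 1 by (simp add: bump_term_def s_def)
      finally have D: "((\<lambda>t. poly p t / (1 - t\<^sup>2) ^ k * exp (- 1 / (1 - t\<^sup>2))) has_real_derivative
          bump_term q (k + 2) t) (at t)" .
      show ?thesis
        by (rule has_field_derivative_transform_within_open[OF D, of "{-1<..<1}"])
           (use 1 in \<open>auto simp: bump_term_def\<close>)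
    next
      case 2
      have "((\<lambda>_. 0) has_real_derivative bump_term q (k + 2) t) (at t)"
        using 2 by (simp add: bump_term_def)
      then show ?thesis
        by (rule has_field_derivative_transform_within_open[of _ _ _ "- {-1..1}"])
           (use 2 in \<open>auto simp: bump_term_def\<close>)
    next
      case 3
      obtain C where C: "0 \<le> C" "\<And>t. \<bar>bump_term p k t\<bar> \<le> C * (1 - t\<^sup>2)\<^sup>2"
        using bump_term_le_square by blast
      have bd: "\<bar>bump_term p k y / (y - t)\<bar> \<le> C * (\<bar>y - t\<bar> * (\<bar>y\<bar> + 1)\<^sup>2)" for y
      proof (cases "y = t")
        case False
        have t2: "t\<^sup>2 = 1" using 3 by (metis power2_abs power_one)
        have "(1 - y\<^sup>2) = - ((y - t) * (y + t))" using t2 by (simp add: algebra_simps power2_eq_square)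
        then have "(1 - y\<^sup>2)\<^sup>2 = (y - t)\<^sup>2 * \<bar>y + t\<bar>\<^sup>2"
          by (simp add: power_mult_distrib)
        also have "\<dots> \<le> (y - t)\<^sup>2 * (\<bar>y\<bar> + 1)\<^sup>2"
          using 3 by (intro mult_left_mono power_mono) auto
        finally have "\<bar>bump_term p k y\<bar> \<le> C * ((y - t)\<^sup>2 * (\<bar>y\<bar> + 1)\<^sup>2)"
          using C(2)[of y] C(1) by (meson mult_left_mono order_trans)
        then have "\<bar>bump_term p k y\<bar> / \<bar>y - t\<bar> \<le> C * ((y - t)\<^sup>2 * (\<bar>y\<bar> + 1)\<^sup>2) / \<bar>y - t\<bar>"
          by (intro divide_right_mono) auto
        also have "\<dots> = C * (\<bar>y - t\<bar> * (\<bar>y\<bar> + 1)\<^sup>2)"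
        proof -
          have *: "C * (a * a * B) / a = C * (a * B)" if "a \<noteq> 0" for a B :: real
            using that by simp
          have sq: "(y - t)\<^sup>2 = \<bar>y - t\<bar> * \<bar>y - t\<bar>" by (simp add: power2_eq_square)
          show ?thesis unfolding sq by (rule *) (use False in simp)
        qed
        finally show ?thesis by (simp add: abs_divide)
      qed simp
      have "((\<lambda>y. C * (\<bar>y - t\<bar> * (\<bar>y\<bar> + 1)\<^sup>2)) \<longlongrightarrow> C * (\<bar>t - t\<bar> * (\<bar>t\<bar> + 1)\<^sup>2)) (at t)"
        by (intro tendsto_intros)
      then have lim: "((\<lambda>y. C * (\<bar>y - t\<bar> * (\<bar>y\<bar> + 1)\<^sup>2)) \<longlongrightarrow> 0) (at t)"
        by simp
      have "((\<lambda>y. bump_term p k y / (y - t)) \<longlongrightarrow> 0) (at t)"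
        by (rule Lim_null_comparison[OF _ lim], rule always_eventually, unfold real_norm_def, rule allI, rule bd)
      moreover have "bump_term p k t = 0" "bump_term q (k + 2) t = 0" using 3 by (auto simp: bump_term_def)
      ultimately show ?thesis by (simp add: has_field_derivative_iff)
    qed
  qed
  then show ?thesis by blast
qed

definition smooth_real :: "(real \<Rightarrow> real) \<Rightarrow> bool" where
  "smooth_real f \<longleftrightarrow> (\<exists>D. D 0 = f \<and> (\<forall>k t. (D k has_real_derivative D (Suc k) t) (at t)))"

lemma smooth_real_bump_term: "smooth_real (bump_term p k)"
proof -
  have "\<exists>h :: nat \<Rightarrow> real poly \<times> nat. \<forall>n. (n = 0 \<longrightarrow> h n = (p, k)) \<and>
      (\<forall>t. (bump_term (fst (h n)) (snd (h n)) has_real_derivative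
             bump_term (fst (h (Suc n))) (snd (h (Suc n))) t) (at t))"
    by (rule dependent_nat_choice) (use bump_term_derivative in fastforce)+
  then obtain h :: "nat \<Rightarrow> real poly \<times> nat" where h: "h 0 = (p, k)"
    "\<And>n t. (bump_term (fst (h n)) (snd (h n)) has_real_derivative
             bump_term (fst (h (Suc n))) (snd (h (Suc n))) t) (at t)" by blast
  then show ?thesis
    unfolding smooth_real_def by (intro exI[of _ "\<lambda>n. bump_term (fst (h n)) (snd (h n))"]) auto
qed

lemma smooth_real_scale:
  assumes "smooth_real f" shows "smooth_real (\<lambda>t. f (c * t))"
proof -
  obtain D where D: "D 0 = f" "\<And>k t. (D k has_real_derivative D (Suc k) t) (at t)"
    using assms unfolding smooth_real_def by blast
  have "((\<lambda>t. c ^ k * D k (c * t)) has_real_derivative c ^ Suc k * D (Suc k) (c * t)) (at t)" for k t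
    by (rule DERIV_cong) (rule derivative_intros DERIV_chain2[OF D(2)] | simp)+
  then show ?thesis
    unfolding smooth_real_def using D(1) by (intro exI[of _ "\<lambda>k t. c ^ k * D k (c * t)"]) auto
qed

lemma ex_bump_real:
  assumes "0 < e"
  shows "\<exists>b. smooth_real b \<and> (\<forall>t. 0 \<le> b t) \<and> 0 < b 0 \<and> (\<forall>t. e \<le> \<bar>t\<bar> \<longrightarrow> b t = (0::real))"
proof -
  let ?b = "\<lambda>t. bump_term [:1:] 0 ((1/e) * t)"
  have "smooth_real ?b"
    by (rule smooth_real_scale[OF smooth_real_bump_term])
  moreover have "e \<le> \<bar>t\<bar> \<Longrightarrow> ?b t = 0" for t
    using assms by (auto simp: bump_term_def abs_mult abs_divide)
  ultimately show ?thesis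
    by (intro exI[of _ ?b]) (auto simp: bump_term_def)
qed

lemma has_derivative_coordinate_product:
  fixes D :: "nat \<Rightarrow> real \<Rightarrow> real" and x :: "real^'n"
  assumes D: "\<And>k t. (D k has_real_derivative D (Suc k) t) (at t)"
  shows "((\<lambda>x. C * (\<Prod>i\<in>UNIV. D (c i) (x $ i))) has_derivative
          (\<lambda>h. \<Sum>i\<in>UNIV. h $ i * (C * (\<Prod>j\<in>UNIV. D ((c(i := Suc (c i))) j) (x $ j))))) (at x)"
proof -
  have 1: "((\<lambda>x. D (c i) (x $ i)) has_derivative (\<lambda>h. D (Suc (c i)) (x $ i) * h $ i)) (at x)" for i
    using has_derivative_compose[OF bounded_linear.has_derivative[OF bounded_linear_vec_nth has_derivative_ident]
        D[of "c i" "x $ i", unfolded has_field_derivative_def]] by simp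
  have "((\<lambda>x. C * (\<Prod>i\<in>UNIV. D (c i) (x $ i))) has_derivative
          (\<lambda>h. C * (\<Sum>i\<in>UNIV. D (Suc (c i)) (x $ i) * h $ i * (\<Prod>j\<in>UNIV - {i}. D (c j) (x $ j))))) (at x)"
    by (intro has_derivative_mult_right has_derivative_prod 1)
  moreover have "(\<Prod>j\<in>UNIV. D ((c(i := Suc (c i))) j) (x $ j))
      = D (Suc (c i)) (x $ i) * (\<Prod>j\<in>UNIV - {i}. D (c j) (x $ j))" for i
    by (subst prod.remove[of _ i]) (auto intro!: prod.cong)
  ultimately show ?thesis
    by (simp add: sum_distrib_left mult_ac)
qed

text \<open>Products of functions of single coordinates turn iterated partial derivatives into one-dimensional ones;
  only the number of occurrences of each coordinate matters, so partial derivatives of a product commute.\<close>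

lemma partials_coordinate_product:
  fixes D :: "nat \<Rightarrow> real \<Rightarrow> real"
  assumes D: "\<And>k t. (D k has_real_derivative D (Suc k) t) (at t)"
  shows "partials is (\<lambda>x::real^'n. C * (\<Prod>i\<in>UNIV. D 0 (x $ i)))
       = (\<lambda>x. C * (\<Prod>i\<in>UNIV. D (count_list is i) (x $ i)))"
proof (induction "is")
  case (Cons a "is")
  show ?case
  proof
    fix x :: "real^'n"
    have "frechet_derivative (\<lambda>x. C * (\<Prod>i\<in>UNIV. D (count_list is i) (x $ i))) (at x) (axis a 1)
      = (\<Sum>i\<in>UNIV. (axis a 1 :: real^'n) $ i * (C * (\<Prod>j\<in>UNIV. D (((count_list is)(i := Suc (count_list is i))) j) (x $ j))))"
      by (subst frechet_derivative_at[OF has_derivative_coordinate_product[where D=D, OF D, of C "count_list is" x], symmetric]) simp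
    also have "\<dots> = C * (\<Prod>j\<in>UNIV. D (((count_list is)(a := Suc (count_list is a))) j) (x $ j))"
      by (subst sum.remove[of _ a]) (auto simp: axis_def intro!: sum.neutral)
    also have "\<dots> = C * (\<Prod>j\<in>UNIV. D (count_list (a # is) j) (x $ j))"
      by (intro arg_cong2[where f = "(*)"] prod.cong refl) auto
    finally show "partials (a # is) (\<lambda>x::real^'n. C * (\<Prod>i\<in>UNIV. D 0 (x $ i))) x = \<dots>"
      by (simp only: partials.simps Cons.IH)
  qed
qed simp

text \<open>Symmetry of the second partial derivatives is part of the definition because it is immediate for the
  product kernels constructed below and makes the Hessian of a mollified function symmetric.\<close>

definition mollifier :: "real \<Rightarrow> (real^'n \<Rightarrow> real) \<Rightarrow> bool" where
  "mollifier e \<rho> \<longleftrightarrow>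
     (\<forall>is x. partials is \<rho> differentiable (at x)) \<and>
     (\<forall>i j. partials [i, j] \<rho> = partials [j, i] \<rho>) \<and>
     (\<forall>x. 0 \<le> \<rho> x) \<and> (\<forall>x. e \<le> norm x \<longrightarrow> \<rho> x = 0) \<and>
     integrable lborel \<rho> \<and> integral\<^sup>L lborel \<rho> = 1"

lemma ex_mollifier:
  assumes "0 < e" shows "\<exists>\<rho> :: real^'n \<Rightarrow> real. mollifier e \<rho>"
proof -
  let ?N = "real CARD('n)"
  have N: "0 < ?N" by simp
  obtain b where b: "smooth_real b" "\<And>t. 0 \<le> b t" "0 < b 0" "\<And>t. e / ?N \<le> \<bar>t\<bar> \<Longrightarrow> b t = 0"
    using ex_bump_real[of "e / ?N"] assms by auto
  obtain D where D: "D 0 = b" "\<And>k t. (D k has_real_derivative D (Suc k) t) (at t)"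
    using b(1) unfolding smooth_real_def by blast
  define \<phi> where "\<phi> C = (\<lambda>x::real^'n. C * (\<Prod>i\<in>UNIV. D 0 (x $ i)))" for C :: real
  have P: "partials is (\<phi> C) = (\<lambda>x. C * (\<Prod>i\<in>UNIV. D (count_list is i) (x $ i)))" for C "is"
    unfolding \<phi>_def by (rule partials_coordinate_product[where D=D, OF D(2)])
  have diff: "partials is (\<phi> C) differentiable (at x)" for C "is" x
    unfolding P differentiable_def
    by (rule exI, rule has_derivative_coordinate_product[where D=D, OF D(2)])
  have comm: "partials [i, j] (\<phi> C) = partials [j, i] (\<phi> C)" for C i j
  proof -
    have "count_list [i, j] = count_list [j, i]" by (auto simp: fun_eq_iff)
    then show ?thesis unfolding P by (simp only:)
  qed
  have cont: "continuous_on UNIV (\<phi> C)" for C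
    using diff[of "[]" C] by (auto simp: continuous_on_eq_continuous_at intro!: differentiable_imp_continuous_within)
  have nonneg: "0 \<le> \<phi> C x" if "0 \<le> C" for C x
    using that by (auto simp: \<phi>_def D(1) intro!: mult_nonneg_nonneg prod_nonneg b(2))
  have supp: "\<phi> C x = 0" if "e \<le> norm x" for C x
  proof -
    have "\<exists>i. e / ?N \<le> \<bar>x $ i\<bar>"
    proof (rule ccontr)
      assume "\<not> ?thesis"
      then have "(\<Sum>i\<in>UNIV. \<bar>x $ i\<bar>) < (\<Sum>i\<in>(UNIV :: 'n set). e / ?N)"
        by (intro sum_strict_mono) (auto simp: not_le)
      with norm_le_l1_cart[of x] that N show False by simp
    qed
    then show ?thesis using b(4) by (auto simp: \<phi>_def D(1))
  qed
  have int: "integrable lborel (\<phi> C)" for C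
  proof -
    have "integrable lborel (\<lambda>x. indicator (cball 0 e) x *\<^sub>R \<phi> C x)"
      by (intro borel_integrable_compact continuous_on_subset[OF cont]) auto
    moreover have "(\<lambda>x. indicator (cball 0 e) x *\<^sub>R \<phi> C x) = \<phi> C"
      using supp by (auto simp: fun_eq_iff indicator_def not_le)
    ultimately show ?thesis by simp
  qed
  have \<phi>0: "\<phi> 1 0 > 0" by (auto simp: \<phi>_def D(1) b(3) intro!: prod_pos)
  have "integral\<^sup>L lborel (\<phi> 1) \<noteq> 0"
  proof
    assume "integral\<^sup>L lborel (\<phi> 1) = 0"
    then have "AE x in lborel. \<phi> 1 x = 0"
      using integral_nonneg_eq_0_iff_AE[OF int[of 1]] nonneg[of 1] by auto
    moreover have op: "open {x. \<phi> 1 x > 0}"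
      using open_Collect_less[OF continuous_on_const cont] by simp
    ultimately have "{x. \<phi> 1 x > 0} \<in> null_sets lborel"
      by (subst AE_iff_null_sets) (use op in \<open>auto elim!: eventually_mono\<close>)
    then have "negligible {x. \<phi> 1 x > 0}"
      by (simp add: negligible_iff_null_sets null_sets_completionI)
    then show False
      using open_not_negligible op \<phi>0 by blast
  qed
  then have pos: "0 < integral\<^sup>L lborel (\<phi> 1)"
    using Bochner_Integration.integral_nonneg[of lborel "\<phi> 1"] nonneg[of 1] by fastforce
  define C where "C = 1 / integral\<^sup>L lborel (\<phi> 1)"
  have "integral\<^sup>L lborel (\<phi> C) = C * integral\<^sup>L lborel (\<phi> 1)"
    unfolding \<phi>_def by simp
  then have "integral\<^sup>L lborel (\<phi> C) = 1" using pos by (simp add: C_def)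
  then show ?thesis
    unfolding mollifier_def using diff comm nonneg[of C] supp int pos
    by (intro exI[of _ "\<phi> C"]) (auto simp: C_def)
qed

section \<open>Positive semidefinite quadratic forms\<close>

definition quad :: "('n::finite \<Rightarrow> 'n \<Rightarrow> real) \<Rightarrow> ('n \<Rightarrow> real) \<Rightarrow> real" where
  "quad B \<xi> = (\<Sum>i\<in>UNIV. \<Sum>j\<in>UNIV. B i j * \<xi> i * \<xi> j)"

lemma quad_add_single:
  assumes sym: "\<And>i j. B i j = B j i"
  shows "quad B (\<lambda>i. \<xi> i + t * (if i = k then 1 else 0))
       = quad B \<xi> + 2 * t * (\<Sum>i\<in>UNIV. B i k * \<xi> i) + t\<^sup>2 * B k k"
proof -
  have "B i j * (\<xi> i + t * (if i = k then 1 else 0)) * (\<xi> j + t * (if j = k then 1 else 0))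
     = B i j * \<xi> i * \<xi> j + (if j = k then t * (B i k * \<xi> i) else 0)
        + (if i = k then t * (B k j * \<xi> j) + (if j = k then t\<^sup>2 * B k k else 0) else 0)" for i j
    by (auto simp: algebra_simps power2_eq_square)
  moreover have "(\<Sum>i\<in>UNIV. \<Sum>j\<in>UNIV. (if i = k then t * (B k j * \<xi> j) + (if j = k then t\<^sup>2 * B k k else 0) else 0))
     = t * (\<Sum>j\<in>UNIV. B k j * \<xi> j) + t\<^sup>2 * B k k"
    by (subst sum.swap) (simp add: sum.distrib sum_distrib_left)
  moreover have "(\<Sum>j\<in>UNIV. B k j * \<xi> j) = (\<Sum>i\<in>UNIV. B i k * \<xi> i)"
    by (rule sum.cong[OF refl], rule arg_cong2[where f = "(*)", OF sym refl])
  moreover have "(\<Sum>i\<in>UNIV. \<Sum>j\<in>UNIV. (if j = k then t * (B i k * \<xi> i) else 0))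
     = t * (\<Sum>i\<in>UNIV. B i k * \<xi> i)"
    by (simp add: sum_distrib_left)
  ultimately show ?thesis
    unfolding quad_def by (simp only: sum.distrib)
qed

lemma quad_single:
  assumes sym: "\<And>i j. B i j = B j i"
  shows "quad B (\<lambda>i. if i = k then 1 else 0) = B k k"
  using quad_add_single[of B "\<lambda>_. 0" 1 k, OF sym] by (simp add: quad_def)

lemma quad_two:
  assumes sym: "\<And>i j. B i j = B j i"
  shows "quad B (\<lambda>i. (if i = l then 1 else 0) + t * (if i = k then 1 else 0))
     = B l l + 2 * t * B l k + t\<^sup>2 * B k k"
proof -
  have "(\<Sum>i\<in>UNIV. B i k * (if i = l then 1 else 0)) = B l k"
    by (simp add: if_distrib cong: if_cong)
  then show ?thesis using quad_single[OF sym] by (subst quad_add_single[OF sym]) simp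
qed

text \<open>The trace of a product of two positive semidefinite matrices is nonnegative. Elimination replaces the
  spectral theorem: subtracting the rank-one form \<open>b b\<^sup>T / d\<close> from \<open>B\<close>, where \<open>b\<close> is column \<open>k\<close> and
  \<open>d\<close> its diagonal entry, leaves a positive semidefinite form without the variable \<open>k\<close>, and the pairing of
  \<open>C\<close> with the subtracted part is \<open>quad C b / d \<ge> 0\<close>.\<close>

lemma psd_pairing_nonneg:
  fixes B C :: "'n::finite \<Rightarrow> 'n \<Rightarrow> real"
  assumes C: "\<And>\<xi>. 0 \<le> quad C \<xi>"
    and sym: "\<And>i j. B i j = B j i" and B: "\<And>\<xi>. 0 \<le> quad B \<xi>"
  shows "0 \<le> (\<Sum>i\<in>UNIV. \<Sum>j\<in>UNIV. C i j * B i j)"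
proof -
  have "0 \<le> (\<Sum>i\<in>UNIV. \<Sum>j\<in>UNIV. C i j * B i j)"
    if "finite S" "\<And>i j. B i j = B j i" "\<And>\<xi>. 0 \<le> quad B \<xi>" "\<And>i j. i \<notin> S \<Longrightarrow> B i j = 0"
    for S :: "'n set" and B
    using that
  proof (induction S arbitrary: B rule: finite_induct)
    case empty
    then show ?case by simp
  next
    case (insert k S)
    define d where "d = B k k"
    have d: "0 \<le> d" using insert.prems(2)[of "\<lambda>i. if i = k then 1 else 0"]
      unfolding quad_single[of B k, OF insert.prems(1)] d_def .
    show ?case
    proof (cases "d = 0")
      case True
      \<comment> \<open>a vanishing diagonal entry forces its column to vanish: test with \<open>e\<^sub>i + t e\<^sub>k\<close> for large \<open>\<bar>t\<bar>\<close>\<close>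
      have "B i k = 0" for i
      proof (rule ccontr)
        assume nz: "B i k \<noteq> 0"
        have "0 \<le> B i i + 2 * t * B i k" for t
          using insert.prems(2)[of "\<lambda>j. (if j = i then 1 else 0) + t * (if j = k then 1 else 0)"] True
          unfolding quad_two[of B i t k, OF insert.prems(1)] d_def by simp
        from this[of "- (B i i + 1) / (2 * B i k)"] nz show False by (simp add: field_simps)
      qed
      then have k: "B k i = 0" for i using insert.prems(1)[of k i] by simp
      show ?thesis
      proof (rule insert.IH)
        show "B i j = 0" if "i \<notin> S" for i j
          using that k insert.prems(3)[of i j] by (cases "i = k") auto
      qed (rule insert.prems(1) insert.prems(2))+
    next
      case False
      define b where "b i = B i k" for i
      define B' where "B' i j = B i j - b i * b j / d" for i j
      have psd': "0 \<le> quad B' \<xi>" for \<xi>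
      proof -
        define \<beta> where "\<beta> = (\<Sum>i\<in>UNIV. B i k * \<xi> i)"
        have "(\<Sum>i\<in>UNIV. \<Sum>j\<in>UNIV. b i * b j / d * \<xi> i * \<xi> j) = \<beta> * \<beta> / d"
          unfolding \<beta>_def b_def sum_product by (simp add: sum_divide_distrib mult_ac)
        then have "quad B' \<xi> = quad B \<xi> - \<beta> * \<beta> / d"
          by (simp add: quad_def B'_def left_diff_distrib sum_subtractf)
        \<comment> \<open>completing the square in the variable \<open>k\<close>\<close>
        also have "\<dots> = quad B (\<lambda>i. \<xi> i + (- \<beta> / d) * (if i = k then 1 else 0))"
          unfolding quad_add_single[of B, OF insert.prems(1)] \<beta>_def[symmetric] d_def[symmetric]
          using False by (simp add: field_simps power2_eq_square)
        finally show ?thesis using insert.prems(2) by simp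
      qed
      have sym': "B' i j = B' j i" for i j using insert.prems(1)[of i j] by (simp add: B'_def)
      have zero': "B' i j = 0" if "i \<notin> S" for i j
      proof (cases "i = k")
        case True
        then show ?thesis using False insert.prems(1)[of k j] by (simp add: B'_def b_def d_def)
      qed (use that insert.prems(3) in \<open>simp add: B'_def b_def\<close>)
      have "0 \<le> (\<Sum>i\<in>UNIV. \<Sum>j\<in>UNIV. C i j * B' i j)"
        by (rule insert.IH[OF sym' psd' zero'])
      also have "\<dots> = (\<Sum>i\<in>UNIV. \<Sum>j\<in>UNIV. C i j * B i j) - quad C b / d"
        by (simp add: B'_def quad_def right_diff_distrib sum_subtractf sum_divide_distrib mult_ac)
      finally show ?thesis
        using C[of b] d by (smt (verit) divide_nonneg_nonneg)
    qed
  qed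
  from this[of UNIV B, OF finite sym B] show ?thesis by simp
qed

lemma psd_entry_le_trace:
  fixes B :: "'n::finite \<Rightarrow> 'n \<Rightarrow> real"
  assumes sym: "\<And>i j. B i j = B j i" and B: "\<And>\<xi>. 0 \<le> quad B \<xi>"
  shows "\<bar>B i j\<bar> \<le> (\<Sum>k\<in>UNIV. B k k)"
proof -
  have diag: "0 \<le> B k k" for k using B[of "\<lambda>i. if i = k then 1 else 0"]
    unfolding quad_single[of B k, OF sym] .
  have le: "B k k \<le> (\<Sum>k\<in>UNIV. B k k)" for k
    by (rule member_le_sum) (auto simp: diag)
  have "0 \<le> B i i + 2 * t * B i j + t\<^sup>2 * B j j" for t
    using B[of "\<lambda>k. (if k = i then 1 else 0) + t * (if k = j then 1 else 0)"]
    unfolding quad_two[of B i t j, OF sym] .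
  from this[of 1] this[of "-1"] le[of i] le[of j] show ?thesis by (simp add: abs_le_iff)
qed

text \<open>Apply \<open>psd_pairing_nonneg\<close> to \<open>\<Lambda> A - I\<close>.\<close>

lemma trace_le_elliptic_pairing:
  fixes A B :: "'n::finite \<Rightarrow> 'n \<Rightarrow> real"
  assumes A: "\<And>\<xi>. (\<Sum>i\<in>UNIV. (\<xi> i)\<^sup>2) \<le> \<Lambda> * quad A \<xi>"
    and sym: "\<And>i j. B i j = B j i" and B: "\<And>\<xi>. 0 \<le> quad B \<xi>"
  shows "(\<Sum>k\<in>UNIV. B k k) \<le> \<Lambda> * (\<Sum>i\<in>UNIV. \<Sum>j\<in>UNIV. A i j * B i j)"
proof -
  define C where "C i j = \<Lambda> * A i j - (if i = j then 1 else 0)" for i j :: 'n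
  have "(\<Sum>i\<in>UNIV. \<Sum>j\<in>UNIV. (if i = j then 1 else 0) * \<xi> i * \<xi> j) = (\<Sum>i\<in>UNIV. (\<xi> i)\<^sup>2)" for \<xi> :: "'n \<Rightarrow> real"
    by (simp add: power2_eq_square if_distrib[where f = "\<lambda>a. a * _"] cong: if_cong)
  then have "quad C \<xi> = \<Lambda> * quad A \<xi> - (\<Sum>i\<in>UNIV. (\<xi> i)\<^sup>2)" for \<xi>
    by (simp add: quad_def C_def left_diff_distrib sum_subtractf) (simp add: sum_distrib_left mult_ac)
  then have "0 \<le> (\<Sum>i\<in>UNIV. \<Sum>j\<in>UNIV. C i j * B i j)"
    using A by (intro psd_pairing_nonneg sym B) simp
  moreover have "(\<Sum>i\<in>UNIV. \<Sum>j\<in>UNIV. (if i = j then 1 else 0) * B i j) = (\<Sum>i\<in>UNIV. B i i)"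
    by (simp add: if_distrib[where f = "\<lambda>a. a * _"] cong: if_cong)
  ultimately show ?thesis
    by (simp add: C_def left_diff_distrib sum_subtractf) (simp add: sum_distrib_left mult_ac)
qed

section \<open>Slopes and the volume of a gradient image\<close>

lemma second_derivative_nonpos_at_max:
  fixes \<phi> \<phi>' :: "real \<Rightarrow> real"
  assumes "0 < d" and \<phi>: "\<And>t. \<bar>t\<bar> < d \<Longrightarrow> (\<phi> has_real_derivative \<phi>' t) (at t)"
    and c: "(\<phi>' has_real_derivative c) (at 0)" and "\<phi>' 0 = 0"
    and max: "\<And>t. \<bar>t\<bar> < d \<Longrightarrow> \<phi> t \<le> \<phi> 0"
  shows "c \<le> 0"
proof (rule ccontr)
  assume "\<not> c \<le> 0"
  then obtain e where e: "0 < e" "\<And>h. 0 < h \<Longrightarrow> h < e \<Longrightarrow> \<phi>' 0 < \<phi>' (0 + h)"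
    using DERIV_pos_inc_right[OF c] by auto
  define h where "h = min (d/2) (e/2)"
  have h: "0 < h" "h < e" "h < d" using e(1) \<open>0 < d\<close> by (auto simp: h_def)
  obtain z where z: "0 < z" "z < h" "\<phi> h - \<phi> 0 = (h - 0) * \<phi>' z"
    using MVT2[of 0 h \<phi> \<phi>'] h \<phi> by force
  then have "0 < \<phi>' z" using e(2)[of z] h \<open>\<phi>' 0 = 0\<close> by simp
  then show False using z(3) max[of h] h by (smt (verit) mult_pos_pos)
qed

text \<open>If \<open>w\<close> drops by more than \<open>\<delta> r\<close> from the centre to the sphere, then subtracting a linear function
  of slope \<open>p\<close> with \<open>norm p < \<delta>\<close> leaves an interior maximum, at which the gradient is \<open>p\<close> and the
  Hessian is negative semidefinite.\<close>

lemma slopes_are_gradients_at_concave_points: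
  fixes w :: "real^'n \<Rightarrow> real" and G :: "real^'n \<Rightarrow> real^'n" and Hs :: "real^'n \<Rightarrow> real^'n^'n"
  assumes w: "\<And>x. x \<in> ball x0 R \<Longrightarrow> (w has_derivative (\<lambda>h. G x \<bullet> h)) (at x)"
    and G: "\<And>x. x \<in> ball x0 R \<Longrightarrow> (G has_derivative (\<lambda>h. Hs x *v h)) (at x)"
    and r: "0 < r" "r < R" and bdry: "\<And>x. dist x0 x = r \<Longrightarrow> w x < w x0 - \<delta> * r"
  shows "ball 0 \<delta> \<subseteq> G ` {x \<in> ball x0 r. \<forall>\<xi>. \<xi> \<bullet> (Hs x *v \<xi>) \<le> 0}"
proof
  fix p :: "real^'n" assume p: "p \<in> ball 0 \<delta>"
  define v where "v x = w x - p \<bullet> x" for x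
  have v: "(v has_derivative (\<lambda>h. (G x - p) \<bullet> h)) (at x)" if "x \<in> ball x0 R" for x
    unfolding v_def using w[OF that]
    by (auto intro!: derivative_eq_intros simp: inner_diff_left)
  have "continuous_on (cball x0 r) v"
    using v r by (intro continuous_at_imp_continuous_on ballI has_derivative_continuous) (force intro: v)
  then obtain z where z: "z \<in> cball x0 r" "\<And>y. y \<in> cball x0 r \<Longrightarrow> v y \<le> v z"
    using continuous_attains_sup[of "cball x0 r" v] r by auto
  have zb: "z \<in> ball x0 r"
  proof (rule ccontr)
    assume "z \<notin> ball x0 r"
    with z(1) have d: "dist x0 z = r" by auto
    have "v x0 \<le> v z" using z(2) r by simp
    then have "w x0 \<le> w z + p \<bullet> (x0 - z)" by (simp add: v_def inner_diff_right)
    also have "p \<bullet> (x0 - z) \<le> norm p * norm (x0 - z)" by (rule norm_cauchy_schwarz)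
    also have "\<dots> \<le> \<delta> * r"
      using p d r norm_ge_zero[of p] by (intro mult_mono) (auto simp: dist_norm intro: order_trans[OF norm_ge_zero less_imp_le])
    finally show False using bdry[OF d] by simp
  qed
  have zR: "z \<in> ball x0 R" using zb r by auto
  have "(\<lambda>h. (G z - p) \<bullet> h) = (\<lambda>_. 0)"
    by (rule differential_zero_maxmin[of z "ball x0 r" v]) (use zb z(2) v[OF zR] in auto)
  then have "(G z - p) \<bullet> (G z - p) = 0" by meson
  then have Gz: "G z = p" by simp
  have "\<xi> \<bullet> (Hs z *v \<xi>) \<le> 0" for \<xi>
  proof (cases "\<xi> = 0")
    case False
    define d where "d = (r - dist x0 z) / norm \<xi>"
    have d: "0 < d" using zb False by (simp add: d_def)
    have inb: "z + t *\<^sub>R \<xi> \<in> ball x0 r" if "\<bar>t\<bar> < d" for t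
    proof -
      have "dist x0 (z + t *\<^sub>R \<xi>) \<le> dist x0 z + dist z (z + t *\<^sub>R \<xi>)" by (rule dist_triangle)
      also have "dist z (z + t *\<^sub>R \<xi>) = \<bar>t\<bar> * norm \<xi>" by (simp add: dist_norm)
      also have "\<dots> < d * norm \<xi>" using that False by simp
      also have "\<dots> = r - dist x0 z" using False by (simp add: d_def)
      finally show ?thesis by simp
    qed
    have L: "((\<lambda>t. z + t *\<^sub>R \<xi>) has_derivative (\<lambda>t. t *\<^sub>R \<xi>)) (at t)" for t :: real
      by (auto intro!: derivative_eq_intros)
    show ?thesis
    proof (rule second_derivative_nonpos_at_max[OF d])
      show "((\<lambda>t. v (z + t *\<^sub>R \<xi>)) has_real_derivative (G (z + t *\<^sub>R \<xi>) - p) \<bullet> \<xi>) (at t)" if "\<bar>t\<bar> < d" for t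
        unfolding has_field_derivative_def
        using inb[OF that] r by (intro has_derivative_eq_rhs[OF has_derivative_compose[OF L v]]) (auto simp: mult.commute)
      have "((\<lambda>t. G (z + t *\<^sub>R \<xi>)) has_derivative (\<lambda>t. Hs z *v (t *\<^sub>R \<xi>))) (at 0)"
        using has_derivative_compose[OF L[of 0], of G "\<lambda>h. Hs z *v h"] G[OF zR] by simp
      then show "((\<lambda>t. (G (z + t *\<^sub>R \<xi>) - p) \<bullet> \<xi>) has_real_derivative \<xi> \<bullet> (Hs z *v \<xi>)) (at 0)"
        unfolding has_field_derivative_def
        by (auto intro!: derivative_eq_intros simp: matrix_vector_mult_scaleR inner_commute mult.commute fun_eq_iff)
    qed (use Gz z(2) inb in \<open>auto simp: less_imp_le\<close>)
  qed simp
  then show "p \<in> G ` {x \<in> ball x0 r. \<forall>\<xi>. \<xi> \<bullet> (Hs x *v \<xi>) \<le> 0}"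
    using zb Gz by blast
qed

lemma emeasure_cart_box:
  fixes a b :: "real^'n"
  assumes "\<And>i. a $ i \<le> b $ i"
  shows "emeasure lborel (cbox a b) = ennreal (\<Prod>i\<in>UNIV. b $ i - a $ i)"
    and "emeasure lborel (box a b) = ennreal (\<Prod>i\<in>UNIV. b $ i - a $ i)"
proof -
  have le: "\<forall>c\<in>Basis. a \<bullet> c \<le> b \<bullet> c"
    using assms by (auto simp: Basis_vec_def cart_eq_inner_axis)
  have "emeasure lborel (cbox a b) = ennreal (measure lborel (cbox a b))"
    by (rule emeasure_eq_ennreal_measure) (use emeasure_lborel_cbox_finite[of a b] in auto)
  also have "measure lborel (cbox a b) = (\<Prod>i\<in>UNIV. b $ i - a $ i)"
    using assms by (intro content_cbox_cart) (metis equals0D mem_box_cart(2) order_refl)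
  finally show 1: "emeasure lborel (cbox a b) = ennreal (\<Prod>i\<in>UNIV. b $ i - a $ i)" .
  show "emeasure lborel (box a b) = ennreal (\<Prod>i\<in>UNIV. b $ i - a $ i)"
    unfolding 1[symmetric] using le by (simp add: emeasure_lborel_box_eq emeasure_lborel_cbox_eq)
qed

text \<open>The image under \<open>G\<close> of the part of \<open>\<Gamma>\<close> in a cell of side \<open>1/m\<close> lies in a cube of side proportional
  to \<open>\<theta>/m\<close>; summing over a grid gives a Riemann sum for the integral of \<open>\<theta>\<^sup>N\<close>. A bound of the derivative
  by its operator norm replaces the Jacobian determinant, at the cost of the factor \<open>(2 N)\<^sup>N\<close>. The integral
  extends over a neighbourhood \<open>W\<close> of \<open>\<Gamma>\<close> and \<open>\<theta>\<close> is enlarged by \<open>\<tau>\<close>, since cells that meet \<open>\<Gamma>\<close>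
  are not contained in it.\<close>

lemma emeasure_gradient_image_le:
  fixes G :: "real^'n \<Rightarrow> real^'n" and \<theta> :: "real^'n \<Rightarrow> real"
  assumes K: "compact K" "convex K"
    and G: "\<And>x. x \<in> K \<Longrightarrow> (G has_derivative G' x) (at x)"
    and \<theta>: "\<And>x. x \<in> K \<Longrightarrow> onorm (G' x) \<le> \<theta> x" "continuous_on K \<theta>"
    and W: "W \<in> sets borel" "W \<subseteq> K"
    and "0 < s" and near: "\<And>x y. x \<in> \<Gamma> \<Longrightarrow> dist x y \<le> s \<Longrightarrow> y \<in> W"
    and "0 < \<tau>" and V: "V \<subseteq> G ` \<Gamma>"
  shows "emeasure lborel V \<le>
     (\<integral>\<^sup>+ y. ennreal ((2 * real CARD('n) * (\<theta> y + \<tau>)) ^ CARD('n)) * indicator W y \<partial>lborel)"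
proof -
  let ?N = "real CARD('n)"
  let ?E = "\<lambda>y. ennreal ((2 * ?N * (\<theta> y + \<tau>)) ^ CARD('n))"
  have N: "?N \<ge> 1" using card_gt_0_iff[of "UNIV :: 'n set"] by (simp add: Suc_leI)
  have \<Gamma>K: "\<Gamma> \<subseteq> K" using near[of x x for x] W \<open>0 < s\<close> by auto
  have \<theta>0: "0 \<le> \<theta> x" if "x \<in> K" for x
    using \<theta>(1)[OF that] onorm_pos_le[OF has_derivative_bounded_linear[OF G[OF that]]] by linarith
  have "uniformly_continuous_on K \<theta>" using \<theta>(2) K(1) by (rule compact_uniformly_continuous)
  then obtain d where d: "0 < d" "\<And>x y. x \<in> K \<Longrightarrow> y \<in> K \<Longrightarrow> dist y x < d \<Longrightarrow> dist (\<theta> y) (\<theta> x) < \<tau>/2"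
    unfolding uniformly_continuous_on_def using \<open>0 < \<tau>\<close> by (meson half_gt_zero)
  obtain m :: nat where m: "m > 0" "?N / m < min d s"
  proof -
    define e where "e = min d s"
    have e: "0 < e" using d(1) \<open>0 < s\<close> by (simp add: e_def)
    obtain m :: nat where m: "?N / e < real m" using reals_Archimedean2 by blast
    moreover have "0 < ?N / e" using N e by simp
    ultimately have "0 < real m" by linarith
    with m e show ?thesis by (intro that[of m]) (auto simp: field_simps e_def[symmetric])
  qed
  \<comment> \<open>\<open>cell y\<close> indexes the grid cell of \<open>y\<close>, with lower corner \<open>lo\<close> and upper corner \<open>hi\<close>; closed cells
    are used for covering, open ones for disjointness\<close>
  define cell :: "real^'n \<Rightarrow> 'n \<Rightarrow> int" where "cell y = (\<lambda>i. \<lfloor>real m * y $ i\<rfloor>)" for y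
  define lo :: "('n \<Rightarrow> int) \<Rightarrow> real^'n" where "lo k = (\<chi> i. real_of_int (k i) / m)" for k
  define hi :: "('n \<Rightarrow> int) \<Rightarrow> real^'n" where "hi k = (\<chi> i. (real_of_int (k i) + 1) / m)" for k
  have near_cell: "norm (y - x) \<le> ?N / m" if "x \<in> cbox (lo k) (hi k)" "y \<in> cbox (lo k) (hi k)" for x y k
  proof -
    have "\<bar>(y - x) $ i\<bar> \<le> 1 / m" for i
    proof -
      have "lo k $ i \<le> x $ i" "x $ i \<le> hi k $ i" "lo k $ i \<le> y $ i" "y $ i \<le> hi k $ i"
        using that by (auto simp: mem_box_cart)
      moreover have "hi k $ i = lo k $ i + 1 / m" by (simp add: hi_def lo_def add_divide_distrib)
      ultimately show ?thesis by (simp add: abs_le_iff)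
    qed
    then have "(\<Sum>i\<in>UNIV. \<bar>(y - x) $ i\<bar>) \<le> (\<Sum>i\<in>(UNIV::'n set). 1 / m)" by (intro sum_mono)
    then show ?thesis using norm_le_l1_cart[of "y - x"] by simp
  qed
  have in_cell: "x \<in> cbox (lo (cell x)) (hi (cell x))" for x
    using m(1) by (auto simp: mem_box_cart lo_def hi_def cell_def divide_le_eq le_divide_eq mult.commute)
  have cell_eq: "cell y = k" if "y \<in> box (lo k) (hi k)" for y k
  proof
    fix i
    have "real_of_int (k i) / m < y $ i" "y $ i < (real_of_int (k i) + 1) / m"
      using that by (auto simp: mem_box_cart lo_def hi_def)
    then have "real_of_int (k i) < m * y $ i" "m * y $ i < real_of_int (k i) + 1"
      using m(1) by (auto simp: field_simps)
    then show "cell y i = k i" unfolding cell_def by (intro floor_unique) auto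
  qed
  have side: "(\<Prod>i\<in>UNIV. hi k $ i - lo k $ i) = (1 / m) ^ CARD('n)" for k
  proof -
    have "hi k $ i - lo k $ i = 1 / m" for i by (simp add: hi_def lo_def add_divide_distrib)
    then show ?thesis by simp
  qed
  have lohi: "lo k $ i \<le> hi k $ i" for k i by (simp add: hi_def lo_def divide_right_mono)
  obtain b where b: "\<And>x. x \<in> \<Gamma> \<Longrightarrow> norm x \<le> b"
    using compact_imp_bounded[OF K(1)] \<Gamma>K by (meson bounded_iff subsetD)
  define I where "I = cell ` \<Gamma>"
  have "finite I"
  proof (rule finite_subset)
    show "I \<subseteq> PiE UNIV (\<lambda>_. {\<lfloor>- (m * b)\<rfloor>..\<lfloor>m * b\<rfloor>})"
    proof -
      have "\<lfloor>- (m * b)\<rfloor> \<le> \<lfloor>m * x $ i\<rfloor> \<and> \<lfloor>m * x $ i\<rfloor> \<le> \<lfloor>m * b\<rfloor>" if "x \<in> \<Gamma>" for x i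
      proof -
        have "\<bar>x $ i\<bar> \<le> b" using component_le_norm_cart[of x i] b[OF that] by linarith
        then have "m * \<bar>x $ i\<bar> \<le> m * b" by (intro mult_left_mono) auto
        then have "\<bar>m * x $ i\<bar> \<le> m * b" by (simp add: abs_mult)
        then show ?thesis by (intro conjI floor_mono) (auto simp: abs_le_iff)
      qed
      then show ?thesis by (auto simp: I_def cell_def)
    qed
  qed (intro finite_PiE, auto)
  have "\<forall>k\<in>I. \<exists>x. x \<in> \<Gamma> \<and> cell x = k" by (auto simp: I_def)
  then obtain c where c: "\<And>k. k \<in> I \<Longrightarrow> c k \<in> \<Gamma>" "\<And>k. k \<in> I \<Longrightarrow> cell (c k) = k" by metis
  have cK: "c k \<in> K" if "k \<in> I" for k using c(1)[OF that] \<Gamma>K by auto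
  have cc: "c k \<in> cbox (lo k) (hi k)" if "k \<in> I" for k using in_cell[of "c k"] c(2)[OF that] by simp
  have cW: "y \<in> W" "\<bar>\<theta> y - \<theta> (c k)\<bar> < \<tau>/2" if "k \<in> I" "y \<in> cbox (lo k) (hi k)" for k y
  proof -
    have n: "norm (y - c k) \<le> ?N / m" using near_cell[OF cc[OF that(1)] that(2)] .
    then show "y \<in> W" using m(2) by (intro near[OF c(1)[OF that(1)]]) (auto simp: dist_norm norm_minus_commute)
    then show "\<bar>\<theta> y - \<theta> (c k)\<bar> < \<tau>/2"
      using d(2)[OF cK[OF that(1)], of y] W(2) n m(2) by (auto simp: dist_norm)
  qed
  define \<rho> where "\<rho> k = (\<theta> (c k) + \<tau>/2) * (?N / m)" for k
  have \<rho>0: "0 \<le> \<rho> k" if "k \<in> I" for k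
    using \<theta>0[OF cK[OF that]] \<open>0 < \<tau>\<close> N by (simp add: \<rho>_def)
  define Q where "Q k = cbox (G (c k) - (\<chi> i. \<rho> k)) (G (c k) + (\<chi> i. \<rho> k))" for k
  have "V \<subseteq> (\<Union>k\<in>I. Q k)"
  proof
    fix v assume "v \<in> V"
    then obtain x where x: "x \<in> \<Gamma>" "v = G x" using V by auto
    define k where "k = cell x"
    have k: "k \<in> I" using x by (simp add: k_def I_def)
    have xc: "x \<in> cbox (lo k) (hi k)" using in_cell[of x] by (simp add: k_def)
    have sub: "cbox (lo k) (hi k) \<subseteq> K" using cW(1)[OF k] W(2) by blast
    have "norm (G x - G (c k)) \<le> (\<theta> (c k) + \<tau>/2) * norm (x - c k)"
    proof (rule differentiable_bound[of "cbox (lo k) (hi k)" G G'])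
      show "(G has_derivative G' y) (at y within cbox (lo k) (hi k))" if "y \<in> cbox (lo k) (hi k)" for y
        using G sub that by (meson has_derivative_at_withinI subsetD)
      show "onorm (G' y) \<le> \<theta> (c k) + \<tau>/2" if "y \<in> cbox (lo k) (hi k)" for y
      proof -
        have "onorm (G' y) \<le> \<theta> y" using sub that by (intro \<theta>(1)) auto
        with cW(2)[OF k that] show ?thesis by linarith
      qed
    qed (use xc cc[OF k] in auto)
    also have "\<dots> \<le> \<rho> k"
      unfolding \<rho>_def using near_cell[OF cc[OF k] xc] \<theta>0[OF cK[OF k]] \<open>0 < \<tau>\<close> by (intro mult_left_mono) auto
    finally have n: "norm (v - G (c k)) \<le> \<rho> k" by (simp add: x)
    have "v \<in> Q k"
      using order_trans[OF component_le_norm_cart n]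
      by (auto simp: Q_def mem_box_cart abs_le_iff) (smt (verit))+
    then show "v \<in> (\<Union>k\<in>I. Q k)" using k by blast
  qed
  then have "emeasure lborel V \<le> emeasure lborel (\<Union>k\<in>I. Q k)"
    using \<open>finite I\<close> by (intro emeasure_mono) (auto simp: Q_def)
  also have "\<dots> \<le> (\<Sum>k\<in>I. emeasure lborel (Q k))"
    using \<open>finite I\<close> by (intro emeasure_subadditive_finite) (auto simp: Q_def)
  also have "\<dots> \<le> (\<Sum>k\<in>I. \<integral>\<^sup>+ y. ?E y * indicator (box (lo k) (hi k)) y \<partial>lborel)"
  proof (rule sum_mono)
    fix k assume k: "k \<in> I"
    have "emeasure lborel (Q k) = ennreal ((2 * \<rho> k) ^ CARD('n))"
      unfolding Q_def by (subst emeasure_cart_box) (use \<rho>0[OF k] in auto)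
    also have "\<dots> = ennreal ((2 * ?N * (\<theta> (c k) + \<tau>/2)) ^ CARD('n) * (1 / m) ^ CARD('n))"
      by (simp add: \<rho>_def power_mult_distrib[symmetric] mult_ac)
    also have "\<dots> = ennreal ((2 * ?N * (\<theta> (c k) + \<tau>/2)) ^ CARD('n)) * emeasure lborel (box (lo k) (hi k))"
      using \<theta>0[OF cK[OF k]] \<open>0 < \<tau>\<close> by (subst emeasure_cart_box) (auto simp: lohi side ennreal_mult)
    also have "\<dots> = (\<integral>\<^sup>+ y. ennreal ((2 * ?N * (\<theta> (c k) + \<tau>/2)) ^ CARD('n)) * indicator (box (lo k) (hi k)) y \<partial>lborel)"
      by (simp add: nn_integral_cmult_indicator)
    also have "\<dots> \<le> (\<integral>\<^sup>+ y. ?E y * indicator (box (lo k) (hi k)) y \<partial>lborel)"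
    proof (intro nn_integral_mono)
      fix y
      show "ennreal ((2 * ?N * (\<theta> (c k) + \<tau>/2)) ^ CARD('n)) * indicator (box (lo k) (hi k)) y
         \<le> ?E y * indicator (box (lo k) (hi k)) y"
      proof (cases "y \<in> box (lo k) (hi k)")
        case True
        then have "y \<in> cbox (lo k) (hi k)" using box_subset_cbox by blast
        then have "\<theta> (c k) + \<tau>/2 \<le> \<theta> y + \<tau>" using cW(2)[OF k, of y] by linarith
        then show ?thesis
          using True \<theta>0[OF cK[OF k]] \<open>0 < \<tau>\<close>
          by (auto intro!: ennreal_leI power_mono mult_left_mono)
      qed simp
    qed
    finally show "emeasure lborel (Q k) \<le> \<dots>" .
  qed
  also have "\<dots> = (\<integral>\<^sup>+ y. (\<Sum>k\<in>I. ?E y * indicator (box (lo k) (hi k)) y) \<partial>lborel)"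
  proof (rule nn_integral_sum[symmetric])
    fix k assume k: "k \<in> I"
    have sub: "box (lo k) (hi k) \<subseteq> K" using cW(1)[OF k] W box_subset_cbox by blast
    have "continuous_on (box (lo k) (hi k)) (\<lambda>y. (2 * ?N * (\<theta> y + \<tau>)) ^ CARD('n))"
      by (intro continuous_intros continuous_on_subset[OF \<theta>(2) sub])
    then have "(\<lambda>y. indicator (box (lo k) (hi k)) y *\<^sub>R (2 * ?N * (\<theta> y + \<tau>)) ^ CARD('n)) \<in> borel_measurable borel"
      by (rule borel_measurable_continuous_on_indicator[rotated]) auto
    then have "(\<lambda>y. ennreal (indicator (box (lo k) (hi k)) y *\<^sub>R (2 * ?N * (\<theta> y + \<tau>)) ^ CARD('n))) \<in> borel_measurable borel"
      by measurable
    moreover have "(\<lambda>y. ennreal (indicator (box (lo k) (hi k)) y *\<^sub>R (2 * ?N * (\<theta> y + \<tau>)) ^ CARD('n)))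
      = (\<lambda>y. ?E y * indicator (box (lo k) (hi k)) y)"
      by (auto simp: fun_eq_iff indicator_def)
    ultimately show "(\<lambda>y. ?E y * indicator (box (lo k) (hi k)) y) \<in> borel_measurable lborel"
      by simp
  qed
  also have "\<dots> \<le> (\<integral>\<^sup>+ y. ?E y * indicator W y \<partial>lborel)"
  proof (intro nn_integral_mono)
    fix y
    have "(\<Sum>k\<in>I. indicator (box (lo k) (hi k)) y) \<le> (\<Sum>k\<in>I. if k = cell y then indicator W y else 0 :: ennreal)"
    proof (rule sum_mono)
      fix k assume k: "k \<in> I"
      show "indicator (box (lo k) (hi k)) y \<le> (if k = cell y then indicator W y else 0 :: ennreal)"
      proof (cases "y \<in> box (lo k) (hi k)")
        case True
        then have "y \<in> cbox (lo k) (hi k)" using box_subset_cbox by blast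
        then have "y \<in> W" by (rule cW(1)[OF k])
        with True cell_eq[OF True] show ?thesis by simp
      qed simp
    qed
    also have "\<dots> \<le> indicator W y" using \<open>finite I\<close> by simp
    finally have "?E y * (\<Sum>k\<in>I. indicator (box (lo k) (hi k)) y)
       \<le> ?E y * indicator W y"
      by (rule mult_left_mono) simp
    then show "(\<Sum>k\<in>I. ?E y * indicator (box (lo k) (hi k)) y)
       \<le> ?E y * indicator W y"
      by (simp only: sum_distrib_left)
  qed
  finally show ?thesis .
qed

section \<open>Mollification\<close>

definition mollify :: "(real^'n \<Rightarrow> real) \<Rightarrow> (real^'n \<Rightarrow> real) \<Rightarrow> real^'n \<Rightarrow> real" where
  "mollify h \<rho> x = (LINT z|lborel. h z * \<rho> (x - z))"

lemma partials_append: "partials (is @ js) \<phi> = partials is (partials js \<phi>)"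
  by (induction "is") auto

lemma has_derivative_partials:
  fixes \<phi> :: "real^'n \<Rightarrow> real"
  assumes "\<phi> differentiable (at x)"
  shows "(\<phi> has_derivative (\<lambda>h. \<Sum>i\<in>UNIV. h $ i * partials [i] \<phi> x)) (at x)"
proof -
  let ?D = "frechet_derivative \<phi> (at x)"
  have D: "(\<phi> has_derivative ?D) (at x)" using assms by (simp add: frechet_derivative_works)
  then have lin: "linear ?D" by (rule has_derivative_linear)
  have "?D h = (\<Sum>i\<in>UNIV. h $ i * partials [i] \<phi> x)" for h
  proof -
    have e: "h = (\<Sum>i\<in>UNIV. h $ i *\<^sub>R axis i 1)"
      using basis_expansion[of h, symmetric] by (simp only: scalar_mult_eq_scaleR)
    have "?D h = ?D (\<Sum>i\<in>UNIV. h $ i *\<^sub>R axis i 1)"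
      using e by (rule arg_cong)
    also have "\<dots> = (\<Sum>i\<in>UNIV. ?D (h $ i *\<^sub>R axis i 1))"
      by (rule linear_sum[OF lin])
    also have "\<dots> = (\<Sum>i\<in>UNIV. h $ i * ?D (axis i 1))"
      by (intro sum.cong refl) (simp only: linear_scale[OF lin] real_scaleR_def)
    finally show ?thesis by (simp only: partials.simps)
  qed
  then have "?D = (\<lambda>h. \<Sum>i\<in>UNIV. h $ i * partials [i] \<phi> x)" by (rule ext)
  with D show ?thesis by (rule has_derivative_eq_rhs)
qed

text \<open>Integrating a continuous \<open>u\<close> against a smooth kernel over a fixed box gives a function whose partial
  derivatives are integrals of the same form, so the statement can be iterated.\<close>

lemma has_derivative_kernel_integral:
  fixes \<phi> u :: "real^'n \<Rightarrow> real"
  assumes sm: "\<And>is x. partials is \<phi> differentiable (at x)" and u: "continuous_on (cbox a b) u"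
  shows "((\<lambda>x. integral (cbox a b) (\<lambda>z. u z * \<phi> (x - z))) has_derivative
      (\<lambda>h. \<Sum>i\<in>UNIV. h $ i * integral (cbox a b) (\<lambda>z. u z * partials [i] \<phi> (x - z)))) (at x)"
proof -
  define B :: "'n \<Rightarrow> (real^'n) \<Rightarrow>\<^sub>L real" where "B i = Blinfun (\<lambda>h. h $ i)" for i
  have B: "blinfun_apply (B i) h = h $ i" for i h
    unfolding B_def by (simp add: bounded_linear_Blinfun_apply bounded_linear_vec_nth)
  have cont: "continuous_on S (partials is \<phi>)" for "is" S
    using sm by (intro continuous_at_imp_continuous_on ballI differentiable_imp_continuous_within)
  have contu: "continuous_on (UNIV \<times> cbox a b) (\<lambda>p. u (snd p))"
    by (rule continuous_on_compose2[OF u]) (auto intro!: continuous_intros)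
  have contp: "continuous_on (UNIV \<times> cbox a b) (\<lambda>p. partials is \<phi> (fst p - snd p))" for "is"
    by (rule continuous_on_compose2[OF cont[of UNIV]]) (auto intro!: continuous_intros)
  have contz: "continuous_on (cbox a b) (\<lambda>z. u z * partials is \<phi> (x - z))" for "is" x
    by (intro continuous_intros u continuous_on_compose2[OF cont[of UNIV]]) auto
  define fx where "fx x z = (\<Sum>i\<in>UNIV. (u z * partials [i] \<phi> (x - z)) *\<^sub>R B i)" for x z
  have L: "((\<lambda>x. integral (cbox a b) (\<lambda>z. u z * \<phi> (x - z))) has_derivative integral (cbox a b) (fx x)) (at x)"
  proof (rule leibniz_rule[where U = UNIV, simplified])
    fix x z
    have "((\<lambda>x. u z * \<phi> (x - z)) has_derivative (\<lambda>h. u z * (\<Sum>i\<in>UNIV. h $ i * partials [i] \<phi> (x - z)))) (at x)"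
    proof -
      have "((\<lambda>x. x - z) has_derivative (\<lambda>h. h)) (at x)" by (auto intro!: derivative_eq_intros)
      from has_derivative_compose[OF this has_derivative_partials[OF sm[of "[]", simplified]]]
      show ?thesis by (intro has_derivative_mult_right)
    qed
    then show "((\<lambda>x. u z * \<phi> (x - z)) has_derivative blinfun_apply (fx x z)) (at x)"
      by (rule has_derivative_eq_rhs)
         (simp add: fx_def fun_eq_iff blinfun.sum_left blinfun.scaleR_left B sum_distrib_left mult_ac)
  next
    fix x show "(\<lambda>z. u z * \<phi> (x - z)) integrable_on cbox a b"
      using contz[of "[]" x] by (intro integrable_continuous) simp
  next
    show "continuous_on (UNIV \<times> cbox a b) (\<lambda>(x, z). fx x z)"
      unfolding fx_def split_beta by (intro continuous_intros contu contp)
  qed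
  have int: "fx x integrable_on cbox a b"
    unfolding fx_def by (intro integrable_continuous continuous_on_sum continuous_on_scaleR contz continuous_on_const)
  have "blinfun_apply (integral (cbox a b) (fx x)) h
     = (\<Sum>i\<in>UNIV. h $ i * integral (cbox a b) (\<lambda>z. u z * partials [i] \<phi> (x - z)))" for h
  proof -
    have "blinfun_apply (integral (cbox a b) (fx x)) h = integral (cbox a b) (\<lambda>z. blinfun_apply (fx x z) h)"
      using integral_linear[OF int, of "\<lambda>f. blinfun_apply f h"]
      by (simp add: o_def bounded_linear_intros)
    also have "\<dots> = integral (cbox a b) (\<lambda>z. \<Sum>i\<in>UNIV. h $ i * (u z * partials [i] \<phi> (x - z)))"
      by (simp add: fx_def blinfun.sum_left blinfun.scaleR_left B mult_ac)
    also have "\<dots> = (\<Sum>i\<in>UNIV. integral (cbox a b) (\<lambda>z. h $ i * (u z * partials [i] \<phi> (x - z))))"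
      by (intro integral_sum integrable_continuous continuous_on_mult continuous_on_const contz) auto
    finally show ?thesis by simp
  qed
  then show ?thesis by (intro has_derivative_eq_rhs[OF L]) auto
qed

lemma partials_reflect:
  fixes \<rho> :: "real^'n \<Rightarrow> real"
  assumes sm: "\<And>is x. partials is \<rho> differentiable (at x)"
  shows "partials is (\<lambda>y. \<rho> (x - y)) = (\<lambda>y. (- 1) ^ length is * partials is \<rho> (x - y))"
proof (induction "is")
  case (Cons i "is")
  have "((\<lambda>y. (- 1) ^ length is * partials is \<rho> (x - y)) has_derivative
      (\<lambda>h. (- 1) ^ length is * (\<Sum>j\<in>UNIV. (- h) $ j * partials (j # is) \<rho> (x - y)))) (at y)" for y
  proof -
    have "((\<lambda>y. x - y) has_derivative (\<lambda>h. - h)) (at y)" by (auto intro!: derivative_eq_intros)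
    from has_derivative_compose[OF this has_derivative_partials[OF sm[of "is"]]]
    show ?thesis by (intro has_derivative_mult_right) simp
  qed
  note D = frechet_derivative_at[OF this, symmetric]
  have "(\<Sum>j\<in>UNIV. (- axis i 1 :: real^'n) $ j * partials (j # is) \<rho> y) = - partials (i # is) \<rho> y" for y
    by (subst sum.remove[of _ i]) (auto simp: axis_def intro!: sum.neutral)
  then show ?case by (simp add: Cons.IH D del: partials.simps) (simp add: Cons.IH D)
qed simp

lemma mollifierD:
  assumes "mollifier e \<rho>"
  shows "\<And>is x. partials is \<rho> differentiable (at x)"
    and "\<And>x. 0 \<le> \<rho> x" and "\<And>x. e \<le> norm x \<Longrightarrow> \<rho> x = 0"
    and "integrable lborel \<rho>" and "integral\<^sup>L lborel \<rho> = 1"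
    and "continuous_on UNIV \<rho>" and "\<rho> \<in> borel_measurable borel"
    and "integrable lborel (\<lambda>z. \<rho> (x - z))" and "(LINT z|lborel. \<rho> (x - z)) = 1"
    and "\<exists>B. \<forall>x. \<rho> x \<le> B"
proof -
  show 1: "\<And>is x. partials is \<rho> differentiable (at x)"
    and "\<And>x. 0 \<le> \<rho> x" and 3: "\<And>x. e \<le> norm x \<Longrightarrow> \<rho> x = 0"
    and "integrable lborel \<rho>" and "integral\<^sup>L lborel \<rho> = 1"
    using assms by (auto simp: mollifier_def)
  note this(4,5)
  show c: "continuous_on UNIV \<rho>"
    using 1[of "[]"] by (intro continuous_at_imp_continuous_on ballI differentiable_imp_continuous_within) simp
  then show "\<rho> \<in> borel_measurable borel" by (rule borel_measurable_continuous_onI)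
  have D: "distr lborel borel (\<lambda>z. x - z) = lborel"
    by (subst (2) lborel_affine[of "-1" x]) (simp_all add: density_1)
  have [measurable]: "(\<lambda>z. x - z) \<in> borel_measurable borel" by simp
  show "integrable lborel (\<lambda>z. \<rho> (x - z))" and "(LINT z|lborel. \<rho> (x - z)) = 1"
    using integrable_distr_eq[of "\<lambda>z. x - z" lborel borel \<rho>] integral_distr[of "\<lambda>z. x - z" lborel borel \<rho>]
      \<open>integrable lborel \<rho>\<close> \<open>integral\<^sup>L lborel \<rho> = 1\<close> D \<open>\<rho> \<in> borel_measurable borel\<close> by auto
  have "bounded (\<rho> ` cball 0 e)"
    by (intro compact_imp_bounded compact_continuous_image continuous_on_subset[OF c]) auto
  then have "\<exists>B. \<forall>x\<in>cball 0 e. \<bar>\<rho> x\<bar> \<le> B" by (simp add: bounded_iff)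
  then obtain B where B: "\<And>x. x \<in> cball 0 e \<Longrightarrow> \<bar>\<rho> x\<bar> \<le> B" by blast
  have "\<rho> x \<le> max B 0" for x
  proof (cases "norm x \<le> e")
    case True
    then have "\<bar>\<rho> x\<bar> \<le> B" by (intro B) simp
    then show ?thesis by linarith
  qed (use 3[of x] in simp)
  then show "\<exists>B. \<forall>x. \<rho> x \<le> B" by blast
qed

lemma mollify_integrable:
  assumes "mollifier e \<rho>" "integrable lborel h"
  shows "integrable lborel (\<lambda>z. h z * \<rho> (x - z))"
proof -
  obtain B where B: "\<And>x. \<rho> x \<le> B" using mollifierD(10)[OF assms(1)] by blast
  have [measurable]: "\<rho> \<in> borel_measurable borel" "h \<in> borel_measurable borel"
    using mollifierD(7)[OF assms(1)] assms(2) by auto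
  show ?thesis
  proof (rule Bochner_Integration.integrable_bound[of _ "\<lambda>z. B * h z"])
    have "\<bar>\<rho> y\<bar> \<le> \<bar>B\<bar>" for y using mollifierD(2)[OF assms(1), of y] B[of y] by linarith
    then show "AE z in lborel. norm (h z * \<rho> (x - z)) \<le> norm (B * h z)"
      by (intro always_eventually allI) (simp add: abs_mult mult.commute[of "\<bar>B\<bar>"] mult_left_mono)
  qed (use assms(2) in auto)
qed

text \<open>A mollification is an average with total weight \<open>1\<close> over a ball of radius \<open>e\<close>.\<close>

lemma mollify_close:
  assumes m: "mollifier e \<rho>" and g: "integrable lborel g"
    and close: "\<And>z. norm (x - z) < e \<Longrightarrow> \<bar>g z - c\<bar> \<le> \<omega>"
  shows "\<bar>mollify g \<rho> x - c\<bar> \<le> \<omega>"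
proof -
  note M = mollifierD[OF m]
  have i: "integrable lborel (\<lambda>z. g z * \<rho> (x - z))" by (rule mollify_integrable[OF m g])
  have "mollify g \<rho> x - c = (LINT z|lborel. g z * \<rho> (x - z) - c * \<rho> (x - z))"
    using i M(8,9) by (simp add: mollify_def)
  also have "\<bar>\<dots>\<bar> \<le> (LINT z|lborel. \<omega> * \<rho> (x - z))"
  proof (rule order_trans[OF integral_abs_bound], rule integral_mono)
    fix z
    have "\<bar>g z - c\<bar> * \<rho> (x - z) \<le> \<omega> * \<rho> (x - z)"
    proof (cases "e \<le> norm (x - z)")
      case False
      then show ?thesis using M(2) by (intro mult_right_mono close) auto
    qed (use M(3) in simp)
    then show "\<bar>g z * \<rho> (x - z) - c * \<rho> (x - z)\<bar> \<le> \<omega> * \<rho> (x - z)"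
      using M(2)[of "x - z"] by (simp add: left_diff_distrib[symmetric] abs_mult)
  qed (use i M(8) in \<open>auto intro!: Bochner_Integration.integrable_abs Bochner_Integration.integrable_diff\<close>)
  also have "\<dots> = \<omega>" using M(9) by simp
  finally show ?thesis .
qed

text \<open>Jensen's inequality for the probability density \<open>\<rho> (x - z)\<close>. Convexity of the power enters through its
  tangent at the mean \<open>k\<close> of \<open>\<bar>h\<bar>\<close>, which is Bernoulli's inequality.\<close>

lemma mollify_power_le:
  assumes m: "mollifier e \<rho>" and h: "integrable lborel h" "integrable lborel (\<lambda>z. \<bar>h z\<bar> ^ p)" and "0 < p"
  shows "ennreal (\<bar>mollify h \<rho> x\<bar> ^ p) \<le> (\<integral>\<^sup>+ z. ennreal (\<bar>h z\<bar> ^ p) * ennreal (\<rho> (x - z)) \<partial>lborel)"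
proof -
  note M = mollifierD[OF m]
  define k where "k = (LINT z|lborel. \<bar>h z\<bar> * \<rho> (x - z))"
  have i1: "integrable lborel (\<lambda>z. \<bar>h z\<bar> * \<rho> (x - z))"
    using h by (intro mollify_integrable[OF m]) auto
  have i2: "integrable lborel (\<lambda>z. \<bar>h z\<bar> ^ p * \<rho> (x - z))" by (rule mollify_integrable[OF m h(2)])
  have k0: "0 \<le> k" unfolding k_def using M(2) by (intro Bochner_Integration.integral_nonneg) auto
  have "\<bar>mollify h \<rho> x\<bar> \<le> k"
    unfolding mollify_def k_def
    using integral_norm_bound[of lborel "\<lambda>z. h z * \<rho> (x - z)"] M(2) by (simp add: abs_mult)
  then have "\<bar>mollify h \<rho> x\<bar> ^ p \<le> k ^ p" by (intro power_mono) auto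
  also have "k ^ p \<le> (LINT z|lborel. \<bar>h z\<bar> ^ p * \<rho> (x - z))"
  proof (cases "k = 0")
    case True
    then show ?thesis using \<open>0 < p\<close> M(2) by (auto simp: zero_power intro!: Bochner_Integration.integral_nonneg)
  next
    case False
    have bern: "k ^ p + p * k ^ p / k * (t - k) \<le> t ^ p" if "0 \<le> t" for t
    proof -
      have "1 + real p * ((t - k) / k) \<le> (1 + (t - k) / k) ^ p"
        using that k0 False by (intro Bernoulli_inequality) (auto simp: field_simps)
      also have "1 + (t - k) / k = t / k" using False by (simp add: field_simps)
      finally have "k ^ p * (1 + real p * ((t - k) / k)) \<le> k ^ p * (t / k) ^ p"
        using k0 by (intro mult_left_mono) auto
      also have "k ^ p * (t / k) ^ p = t ^ p" using False by (simp add: power_divide)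
      finally show ?thesis by (simp add: algebra_simps)
    qed
    define c where "c = p * k ^ p / k"
    have "k ^ p = (LINT z|lborel. (k ^ p - c * k) * \<rho> (x - z) + c * (\<bar>h z\<bar> * \<rho> (x - z)))"
      using i1 M(8,9) by (simp add: k_def[symmetric])
    also have "\<dots> \<le> (LINT z|lborel. \<bar>h z\<bar> ^ p * \<rho> (x - z))"
    proof (rule integral_mono)
      fix z
      have "(k ^ p + c * (\<bar>h z\<bar> - k)) * \<rho> (x - z) \<le> \<bar>h z\<bar> ^ p * \<rho> (x - z)"
        unfolding c_def using M(2) by (intro mult_right_mono bern) auto
      then show "(k ^ p - c * k) * \<rho> (x - z) + c * (\<bar>h z\<bar> * \<rho> (x - z)) \<le> \<bar>h z\<bar> ^ p * \<rho> (x - z)"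
        by (simp add: algebra_simps)
    qed (use i1 i2 M(8) in auto)
    finally show ?thesis .
  qed
  finally have "ennreal (\<bar>mollify h \<rho> x\<bar> ^ p) \<le> ennreal (LINT z|lborel. \<bar>h z\<bar> ^ p * \<rho> (x - z))"
    by (rule ennreal_leI)
  also have "\<dots> = (\<integral>\<^sup>+ z. ennreal (\<bar>h z\<bar> ^ p * \<rho> (x - z)) \<partial>lborel)"
    using M(2) by (intro nn_integral_eq_integral[symmetric] i2) auto
  finally show ?thesis using M(2) by (simp add: ennreal_mult)
qed

lemma mollify_measurable [measurable]:
  assumes [measurable]: "h \<in> borel_measurable borel" "\<rho> \<in> borel_measurable borel"
  shows "mollify h \<rho> \<in> borel_measurable borel"
  unfolding mollify_def by (rule lborel.borel_measurable_lebesgue_integral) measurable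

lemma nn_integral_mollify_power_le:
  assumes m: "mollifier e \<rho>" and h: "integrable lborel h" "integrable lborel (\<lambda>z. \<bar>h z\<bar> ^ p)" and "0 < p"
  shows "(\<integral>\<^sup>+ x. ennreal (\<bar>mollify h \<rho> x\<bar> ^ p) \<partial>lborel) \<le> (\<integral>\<^sup>+ z. ennreal (\<bar>h z\<bar> ^ p) \<partial>lborel)"
proof -
  note M = mollifierD[OF m]
  have [measurable]: "\<rho> \<in> borel_measurable borel" "h \<in> borel_measurable borel" using M h by auto
  have *: "(\<integral>\<^sup>+ x. ennreal (\<rho> (x - z)) \<partial>lborel) = 1" for z
  proof -
    have D: "distr lborel borel (\<lambda>x. x - z) = lborel"
      by (subst (2) lborel_affine[of 1 "- z"]) (simp_all add: density_1)
    have "(\<integral>\<^sup>+ x. ennreal (\<rho> x) \<partial>lborel) = ennreal (integral\<^sup>L lborel \<rho>)"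
      using M(2,4) by (intro nn_integral_eq_integral) auto
    then show ?thesis
      using nn_integral_distr[of "\<lambda>x. x - z" lborel borel "\<lambda>x. ennreal (\<rho> x)"] M(5) by (simp add: D)
  qed
  have "(\<integral>\<^sup>+ x. ennreal (\<bar>mollify h \<rho> x\<bar> ^ p) \<partial>lborel)
      \<le> (\<integral>\<^sup>+ x. \<integral>\<^sup>+ z. ennreal (\<bar>h z\<bar> ^ p) * ennreal (\<rho> (x - z)) \<partial>lborel \<partial>lborel)"
    by (intro nn_integral_mono mollify_power_le[OF m] assms)
  also have "\<dots> = (\<integral>\<^sup>+ z. \<integral>\<^sup>+ x. ennreal (\<bar>h z\<bar> ^ p) * ennreal (\<rho> (x - z)) \<partial>lborel \<partial>lborel)"
    by (rule lborel_pair.Fubini') simp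
  also have "\<dots> = (\<integral>\<^sup>+ z. ennreal (\<bar>h z\<bar> ^ p) \<partial>lborel)"
    by (simp add: nn_integral_cmult *)
  finally show ?thesis .
qed

lemma sum_power_le:
  fixes a :: "'a \<Rightarrow> real"
  assumes "finite I" "\<And>k. k \<in> I \<Longrightarrow> 0 \<le> a k" "0 < p"
  shows "(\<Sum>k\<in>I. a k) ^ p \<le> real (card I) ^ p * (\<Sum>k\<in>I. a k ^ p)"
proof (cases "I = {}")
  case False
  define m where "m = Max (a ` I)"
  have "m \<in> a ` I" unfolding m_def using assms(1) False by (intro Max_in) auto
  then obtain k where k: "k \<in> I" "m = a k" by blast
  have "a i \<le> m" if "i \<in> I" for i unfolding m_def using assms(1) that by (intro Max_ge) auto
  then have "(\<Sum>k\<in>I. a k) \<le> real (card I) * m" by (rule sum_bounded_above)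
  then have "(\<Sum>k\<in>I. a k) ^ p \<le> (real (card I) * m) ^ p"
    using assms(2) by (intro power_mono sum_nonneg)
  also have "\<dots> = real (card I) ^ p * a k ^ p" by (simp add: power_mult_distrib k(2))
  also have "a k ^ p \<le> (\<Sum>k\<in>I. a k ^ p)"
    using assms(1,2) k(1) by (intro member_le_sum) auto
  finally show ?thesis by (simp add: mult_left_mono)
qed (use assms(3) in \<open>simp add: zero_power\<close>)

lemma power_add2_le:
  fixes a b :: real
  assumes "0 \<le> a" "0 \<le> b"
  shows "(a + b) ^ p \<le> 2 ^ p * (a ^ p + b ^ p)"
proof -
  have "(a + b) ^ p \<le> (2 * max a b) ^ p" using assms by (intro power_mono) auto
  also have "\<dots> = 2 ^ p * max a b ^ p" by (rule power_mult_distrib)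
  also have "max a b ^ p \<le> a ^ p + b ^ p" using assms by (auto simp: max_def)
  finally show ?thesis by simp
qed

lemma power_add3_le:
  fixes a b c :: real
  assumes "0 \<le> a" "0 \<le> b" "0 \<le> c"
  shows "(a + b + c) ^ p \<le> 3 ^ p * (a ^ p + b ^ p + c ^ p)"
proof -
  define m where "m = max a (max b c)"
  have "(a + b + c) ^ p \<le> (3 * m) ^ p" using assms by (intro power_mono) (auto simp: m_def)
  also have "\<dots> = 3 ^ p * m ^ p" by (rule power_mult_distrib)
  also have "m ^ p \<le> a ^ p + b ^ p + c ^ p"
    using assms by (auto simp: m_def max_def)
  finally show ?thesis by simp
qed

abbreviation Lp_error :: "nat \<Rightarrow> (real^'n) set \<Rightarrow> (real^'n \<Rightarrow> real) \<Rightarrow> (real^'n \<Rightarrow> real) \<Rightarrow> ennreal" where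
  "Lp_error p S g h \<equiv> \<integral>\<^sup>+ x. ennreal (\<bar>g x - h x\<bar> ^ p) * indicator S x \<partial>lborel"

text \<open>Truncation at height \<open>T\<close> costs little by dominated convergence. The truncated function is an almost
  everywhere limit of continuous functions, which may be truncated at the same height, and dominated
  convergence on a set of finite measure applies again.\<close>

lemma continuous_dense_Lp:
  fixes h :: "real^'n \<Rightarrow> real"
  assumes [measurable]: "h \<in> borel_measurable borel" and fin: "(\<integral>\<^sup>+ z. ennreal (\<bar>h z\<bar> ^ p) \<partial>lborel) < \<infinity>"
    and [measurable]: "S \<in> sets borel" and S: "emeasure lborel S < \<infinity>" and p: "0 < p" and "0 < \<eta>"
  shows "\<exists>g. continuous_on UNIV g \<and>
     Lp_error p S h g \<le> ennreal \<eta>"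
proof -
  define c :: "nat \<Rightarrow> real \<Rightarrow> real" where "c T t = max (- real T) (min (real T) t)" for T t
  have [measurable]: "c T \<in> borel_measurable borel" for T unfolding c_def by measurable
  have cc: "continuous_on UNIV (c T)" for T unfolding c_def by (intro continuous_intros)
  have c1: "\<bar>t - c T t\<bar> \<le> \<bar>t\<bar>" "\<bar>c T t\<bar> \<le> T" for T t by (auto simp: c_def)
  define \<eta>' where "\<eta>' = \<eta> / (2 * 2 ^ p)"
  have \<eta>': "0 < \<eta>'" using \<open>0 < \<eta>\<close> by (simp add: \<eta>'_def)
  have "(\<lambda>i. \<integral>\<^sup>+ z. ennreal (\<bar>h z - c i (h z)\<bar> ^ p) \<partial>lborel) \<longlonglongrightarrow> (\<integral>\<^sup>+ z. 0 \<partial>(lborel :: (real^'n) measure))"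
  proof (rule nn_integral_dominated_convergence[OF _ _ _ _ fin])
    show "AE z in lborel. ennreal (\<bar>h z - c j (h z)\<bar> ^ p) \<le> ennreal (\<bar>h z\<bar> ^ p)" for j
      by (intro always_eventually allI ennreal_leI power_mono c1) auto
    have "(\<lambda>i. ennreal (\<bar>h z - c i (h z)\<bar> ^ p)) \<longlonglongrightarrow> 0" for z
    proof (rule tendsto_eventually)
      obtain n :: nat where n: "\<bar>h z\<bar> \<le> real n" using real_arch_simple by blast
      have "ennreal (\<bar>h z - c i (h z)\<bar> ^ p) = 0" if "n \<le> i" for i
      proof -
        have "c i (h z) = h z" using n that by (auto simp: c_def)
        then show ?thesis using p by simp
      qed
      then show "\<forall>\<^sub>F i in sequentially. ennreal (\<bar>h z - c i (h z)\<bar> ^ p) = 0"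
        by (auto simp: eventually_sequentially)
    qed
    then show "AE z in lborel. (\<lambda>i. ennreal (\<bar>h z - c i (h z)\<bar> ^ p)) \<longlonglongrightarrow> 0" by simp
  qed auto
  then have "\<forall>\<^sub>F i in sequentially. (\<integral>\<^sup>+ z. ennreal (\<bar>h z - c i (h z)\<bar> ^ p) \<partial>lborel) < ennreal \<eta>'"
    using \<eta>' by (intro order_tendstoD) auto
  then obtain T where T: "(\<integral>\<^sup>+ z. ennreal (\<bar>h z - c T (h z)\<bar> ^ p) \<partial>lborel) < ennreal \<eta>'"
    by (auto simp: eventually_sequentially)
  have "h measurable_on UNIV"
    by (rule lebesgue_measurable_imp_measurable_on_real) (auto intro: measurable_completion)
  then obtain N G where N: "negligible N" and G: "\<And>n. continuous_on UNIV (G n)"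
    "\<And>x. x \<notin> N \<Longrightarrow> (\<lambda>n. G n x) \<longlonglongrightarrow> h x"
    unfolding measurable_on_def by auto
  have Gm: "G n \<in> borel_measurable borel" for n using G(1) by (rule borel_measurable_continuous_onI)
  note [measurable] = Gm
  have "AE x in lebesgue. x \<notin> N" using N by (simp add: negligible_iff_null_sets AE_not_in)
  then have AEN: "AE x in lborel. x \<notin> N" by (simp add: AE_completion_iff)
  have "(\<lambda>i. \<integral>\<^sup>+ z. ennreal (\<bar>c T (h z) - c T (G i z)\<bar> ^ p) * indicator S z \<partial>lborel)
        \<longlonglongrightarrow> (\<integral>\<^sup>+ z. 0 \<partial>(lborel :: (real^'n) measure))"
  proof (rule nn_integral_dominated_convergence[where w = "\<lambda>z. ennreal ((2 * real T) ^ p) * indicator S z"])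
    have "\<bar>c T s - c T t\<bar> \<le> 2 * real T" for s t using c1(2)[of T s] c1(2)[of T t] by linarith
    then show "AE z in lborel. ennreal (\<bar>c T (h z) - c T (G j z)\<bar> ^ p) * indicator S z
          \<le> ennreal ((2 * real T) ^ p) * indicator S z" for j
      by (intro always_eventually allI mult_right_mono ennreal_leI power_mono) auto
    show "(\<integral>\<^sup>+ z. ennreal ((2 * real T) ^ p) * indicator S z \<partial>lborel) < \<infinity>"
      using S by (simp add: nn_integral_cmult_indicator ennreal_mult_less_top)
    show "AE z in lborel. (\<lambda>i. ennreal (\<bar>c T (h z) - c T (G i z)\<bar> ^ p) * indicator S z) \<longlonglongrightarrow> 0"
      using AEN
    proof eventually_elim
      case (elim z)
      have "(\<lambda>i. c T (G i z)) \<longlonglongrightarrow> c T (h z)"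
        by (rule continuous_on_tendsto_compose[OF cc G(2)[OF elim]]) auto
      then have "(\<lambda>i. \<bar>c T (h z) - c T (G i z)\<bar> ^ p) \<longlonglongrightarrow> \<bar>c T (h z) - c T (h z)\<bar> ^ p"
        by (intro tendsto_intros)
      then have "(\<lambda>i. \<bar>c T (h z) - c T (G i z)\<bar> ^ p) \<longlonglongrightarrow> 0"
        using p by (simp only: diff_self abs_zero zero_power)
      then have "(\<lambda>i. ennreal (\<bar>c T (h z) - c T (G i z)\<bar> ^ p)) \<longlonglongrightarrow> ennreal 0" by (rule tendsto_ennrealI)
      then show ?case by (cases "z \<in> S") auto
    qed
  qed auto
  then have "\<forall>\<^sub>F i in sequentially.
      (\<integral>\<^sup>+ z. ennreal (\<bar>c T (h z) - c T (G i z)\<bar> ^ p) * indicator S z \<partial>lborel) < ennreal \<eta>'"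
    using \<eta>' by (intro order_tendstoD) auto
  then obtain i where i: "(\<integral>\<^sup>+ z. ennreal (\<bar>c T (h z) - c T (G i z)\<bar> ^ p) * indicator S z \<partial>lborel) < ennreal \<eta>'"
    by (auto simp: eventually_sequentially)
  let ?g = "\<lambda>z. c T (G i z)"
  have "Lp_error p S h ?g
     \<le> (\<integral>\<^sup>+ z. ennreal (2 ^ p) * (ennreal (\<bar>h z - c T (h z)\<bar> ^ p) + ennreal (\<bar>c T (h z) - ?g z\<bar> ^ p) * indicator S z) \<partial>lborel)"
  proof (intro nn_integral_mono)
    fix z
    have "\<bar>h z - ?g z\<bar> ^ p \<le> 2 ^ p * (\<bar>h z - c T (h z)\<bar> ^ p + \<bar>c T (h z) - ?g z\<bar> ^ p)"
    proof -
      have "\<bar>h z - ?g z\<bar> ^ p \<le> (\<bar>h z - c T (h z)\<bar> + \<bar>c T (h z) - ?g z\<bar>) ^ p"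
        by (intro power_mono) auto
      also have "\<dots> \<le> 2 ^ p * (\<bar>h z - c T (h z)\<bar> ^ p + \<bar>c T (h z) - ?g z\<bar> ^ p)"
        by (rule power_add2_le) auto
      finally show ?thesis .
    qed
    then have "ennreal (\<bar>h z - ?g z\<bar> ^ p) \<le> ennreal (2 ^ p * (\<bar>h z - c T (h z)\<bar> ^ p + \<bar>c T (h z) - ?g z\<bar> ^ p))"
      by (rule ennreal_leI)
    also have "\<dots> = ennreal (2 ^ p) * (ennreal (\<bar>h z - c T (h z)\<bar> ^ p) + ennreal (\<bar>c T (h z) - ?g z\<bar> ^ p))"
      by (subst ennreal_mult) auto
    finally show "ennreal (\<bar>h z - ?g z\<bar> ^ p) * indicator S z
       \<le> ennreal (2 ^ p) * (ennreal (\<bar>h z - c T (h z)\<bar> ^ p) + ennreal (\<bar>c T (h z) - ?g z\<bar> ^ p) * indicator S z)"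
      by (cases "z \<in> S") simp_all
  qed
  also have "\<dots> = ennreal (2 ^ p) * ((\<integral>\<^sup>+ z. ennreal (\<bar>h z - c T (h z)\<bar> ^ p) \<partial>lborel)
        + (\<integral>\<^sup>+ z. ennreal (\<bar>c T (h z) - ?g z\<bar> ^ p) * indicator S z \<partial>lborel))"
    by (subst nn_integral_cmult, measurable, subst nn_integral_add, measurable)
  also have "\<dots> \<le> ennreal (2 ^ p) * (ennreal \<eta>' + ennreal \<eta>')"
    using T i by (intro mult_left_mono add_mono) auto
  also have "\<dots> = ennreal (2 ^ p * (\<eta>' + \<eta>'))"
    using \<eta>' by (simp only: ennreal_mult ennreal_plus add_nonneg_nonneg less_imp_le zero_le_power zero_le_numeral)
  also have "2 ^ p * (\<eta>' + \<eta>') = \<eta>" by (simp add: \<eta>'_def)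
  finally show ?thesis
    using continuous_on_compose2[OF cc G(1)] by (intro exI[of _ ?g]) auto
qed

text \<open>For a continuous \<open>g\<close> close to \<open>h\<close> in \<open>L\<^sup>p\<close>, the mollification error of \<open>g\<close> is uniformly small and
  that of \<open>h - g\<close> is controlled by \<open>nn_integral_mollify_power_le\<close>. The limit is taken on a ball
  smaller than the one supporting \<open>h\<close>, since \<open>g\<close>, cut off outside the latter, is not continuous across
  its boundary.\<close>

lemma mollify_tendsto_Lp:
  fixes h :: "real^'n \<Rightarrow> real"
  assumes h: "integrable lborel h" "integrable lborel (\<lambda>z. \<bar>h z\<bar> ^ p)" and p: "0 < p"
    and supp: "\<And>z. z \<notin> cball x0 R' \<Longrightarrow> h z = 0" and R: "R < R'" and "0 < \<eta>"
  shows "\<exists>e0>0. \<forall>e \<rho>. e < e0 \<longrightarrow> mollifier e \<rho> \<longrightarrow>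
     Lp_error p (cball x0 R) (mollify h \<rho>) h \<le> ennreal \<eta>"
proof -
  let ?S = "cball x0 R" and ?S' = "cball x0 R'"
  define V where "V = measure lborel ?S"
  have V: "emeasure lborel ?S = ennreal V" "0 \<le> V"
    using emeasure_lborel_cball_finite[of x0 R] by (auto simp: V_def emeasure_eq_ennreal_measure)
  define \<eta>1 where "\<eta>1 = \<eta> / (4 * 3 ^ p)"
  define \<omega> where "\<omega> = min 1 (\<eta> / (2 * 3 ^ p * (V + 1)))"
  have pos: "0 < \<eta>1" "0 < \<omega>" using \<open>0 < \<eta>\<close> V(2) by (auto simp: \<eta>1_def \<omega>_def)
  have [measurable]: "h \<in> borel_measurable borel" using h(1) by auto
  have "(\<integral>\<^sup>+ z. ennreal (\<bar>h z\<bar> ^ p) \<partial>lborel) < \<infinity>"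
    using h(2) by (simp add: integrable_iff_bounded)
  then obtain g where g: "continuous_on UNIV g"
     "Lp_error p ?S' h g \<le> ennreal \<eta>1"
    using continuous_dense_Lp[of h p ?S' \<eta>1] emeasure_lborel_cball_finite[of x0 R'] p pos by auto
  have [measurable]: "g \<in> borel_measurable borel" using g(1) by (rule borel_measurable_continuous_onI)
  define g' where "g' z = indicator ?S' z * g z" for z
  define k where "k z = h z - g' z" for z
  have [measurable]: "g' \<in> borel_measurable borel" "k \<in> borel_measurable borel"
    unfolding k_def g'_def
    by (intro borel_measurable_diff borel_measurable_times borel_measurable_indicator; simp)+
  have g'i: "integrable lborel g'"
    using borel_integrable_compact[of ?S' g] continuous_on_subset[OF g(1)]
    unfolding g'_def by auto
  have ki: "integrable lborel k" unfolding k_def using h(1) g'i by auto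
  have "(\<integral>\<^sup>+ z. ennreal (\<bar>k z\<bar> ^ p) \<partial>lborel) = Lp_error p ?S' h g"
    using supp p by (intro nn_integral_cong) (auto simp: k_def g'_def indicator_def)
  with g(2) have k1: "(\<integral>\<^sup>+ z. ennreal (\<bar>k z\<bar> ^ p) \<partial>lborel) \<le> ennreal \<eta>1" by simp
  then have "(\<integral>\<^sup>+ z. ennreal (\<bar>k z\<bar> ^ p) \<partial>lborel) < \<infinity>" by (rule le_less_trans) simp
  then have kpi: "integrable lborel (\<lambda>z. \<bar>k z\<bar> ^ p)" by (simp add: integrable_iff_bounded)
  have "uniformly_continuous_on ?S' g"
    by (intro compact_uniformly_continuous continuous_on_subset[OF g(1)]) auto
  then obtain d where d: "0 < d" "\<And>x y. x \<in> ?S' \<Longrightarrow> y \<in> ?S' \<Longrightarrow> dist y x < d \<Longrightarrow> dist (g y) (g x) < \<omega>"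
    unfolding uniformly_continuous_on_def using pos(2) by meson
  define e0 where "e0 = min d (R' - R)"
  have "0 < e0" using d(1) R by (simp add: e0_def)
  moreover have "Lp_error p ?S (mollify h \<rho>) h \<le> ennreal \<eta>"
    if e: "e < e0" and m: "mollifier e \<rho>" for e \<rho>
  proof -
    note M = mollifierD[OF m]
    have [measurable]: "\<rho> \<in> borel_measurable borel" using M by simp
    have split: "\<bar>mollify h \<rho> x - h x\<bar> \<le> \<bar>mollify k \<rho> x\<bar> + \<omega> + \<bar>k x\<bar>" if x: "x \<in> ?S" for x
    proof -
      have i1: "integrable lborel (\<lambda>z. k z * \<rho> (x - z))" by (rule mollify_integrable[OF m ki])
      have i2: "integrable lborel (\<lambda>z. g' z * \<rho> (x - z))" by (rule mollify_integrable[OF m g'i])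
      have "mollify h \<rho> x = (LINT z|lborel. k z * \<rho> (x - z) + g' z * \<rho> (x - z))"
        unfolding mollify_def by (simp add: k_def algebra_simps)
      also have "\<dots> = mollify k \<rho> x + (LINT z|lborel. g' z * \<rho> (x - z))"
        using i1 i2 by (simp add: mollify_def)
      finally have 1: "mollify h \<rho> x = mollify k \<rho> x + (LINT z|lborel. g' z * \<rho> (x - z))" .
      have "\<bar>mollify g' \<rho> x - g x\<bar> \<le> \<omega>"
      proof (rule mollify_close[OF m g'i])
        fix z assume "norm (x - z) < e"
        then have xz: "dist x z < e0" using e by (simp add: dist_norm)
        then have "dist x0 z \<le> R'"
          using x dist_triangle[of x0 z x] by (auto simp: e0_def)
        then have "g' z = g z" "dist (g z) (g x) < \<omega>"
          using xz x R by (auto simp: g'_def e0_def dist_commute intro!: d(2))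
        then show "\<bar>g' z - g x\<bar> \<le> \<omega>" by (auto simp: dist_norm)
      qed
      then have 2: "\<bar>(LINT z|lborel. g' z * \<rho> (x - z)) - g x\<bar> \<le> \<omega>"
        by (simp add: mollify_def)
      have "x \<in> ?S'" using x R by auto
      then have "k x = h x - g x" by (simp add: k_def g'_def)
      with 1 2 show ?thesis by linarith
    qed
    have "Lp_error p ?S (mollify h \<rho>) h
      \<le> (\<integral>\<^sup>+ x. ennreal (3 ^ p) * (ennreal (\<bar>mollify k \<rho> x\<bar> ^ p) + ennreal (\<omega> ^ p) * indicator ?S x
              + ennreal (\<bar>k x\<bar> ^ p)) \<partial>lborel)"
    proof (intro nn_integral_mono)
      fix x
      show "ennreal (\<bar>mollify h \<rho> x - h x\<bar> ^ p) * indicator ?S x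
        \<le> ennreal (3 ^ p) * (ennreal (\<bar>mollify k \<rho> x\<bar> ^ p) + ennreal (\<omega> ^ p) * indicator ?S x
              + ennreal (\<bar>k x\<bar> ^ p))"
      proof (cases "x \<in> ?S")
        case True
        have "\<bar>mollify h \<rho> x - h x\<bar> ^ p \<le> (\<bar>mollify k \<rho> x\<bar> + \<omega> + \<bar>k x\<bar>) ^ p"
          by (intro power_mono split True) auto
        also have "\<dots> \<le> 3 ^ p * (\<bar>mollify k \<rho> x\<bar> ^ p + \<omega> ^ p + \<bar>k x\<bar> ^ p)"
          using pos(2) by (intro power_add3_le) auto
        finally have "ennreal (\<bar>mollify h \<rho> x - h x\<bar> ^ p) \<le> ennreal (3 ^ p * (\<bar>mollify k \<rho> x\<bar> ^ p + \<omega> ^ p + \<bar>k x\<bar> ^ p))"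
          by (rule ennreal_leI)
        also have "\<dots> = ennreal (3 ^ p) * (ennreal (\<bar>mollify k \<rho> x\<bar> ^ p) + ennreal (\<omega> ^ p) + ennreal (\<bar>k x\<bar> ^ p))"
          using pos(2) by (subst ennreal_mult) auto
        finally show ?thesis using True by simp
      qed simp
    qed
    also have "\<dots> = ennreal (3 ^ p) * ((\<integral>\<^sup>+ x. ennreal (\<bar>mollify k \<rho> x\<bar> ^ p) \<partial>lborel)
         + ennreal (\<omega> ^ p) * ennreal V + (\<integral>\<^sup>+ x. ennreal (\<bar>k x\<bar> ^ p) \<partial>lborel))"
    proof -
      have [measurable]: "?S \<in> sets borel" by simp
      have [measurable]: "mollify k \<rho> \<in> borel_measurable borel" by (rule mollify_measurable) measurable
      show ?thesis
        by (subst nn_integral_cmult, measurable, subst nn_integral_add, measurable,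
            subst nn_integral_add, measurable, subst nn_integral_cmult_indicator) (simp_all add: V(1))
    qed
    also have "\<dots> \<le> ennreal (3 ^ p) * (ennreal \<eta>1 + ennreal (\<omega> ^ p) * ennreal V + ennreal \<eta>1)"
      using k1 nn_integral_mollify_power_le[OF m ki kpi p]
      by (intro mult_left_mono add_mono) auto
    also have "\<dots> = ennreal (3 ^ p * (\<eta>1 + \<omega> ^ p * V + \<eta>1))"
      using pos V(2) by (simp only: ennreal_mult ennreal_plus add_nonneg_nonneg mult_nonneg_nonneg
          less_imp_le zero_le_power zero_le_numeral)
    also have "\<dots> \<le> ennreal \<eta>"
    proof (rule ennreal_leI)
      have "\<omega> ^ p \<le> \<omega> ^ 1" using pos p by (intro power_decreasing) (auto simp: \<omega>_def)
      then have "\<omega> ^ p * V \<le> \<omega> * (V + 1)" using pos V(2) by (intro mult_mono) auto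
      also have "\<dots> \<le> \<eta> / (2 * 3 ^ p * (V + 1)) * (V + 1)" using V(2) by (intro mult_right_mono) (auto simp: \<omega>_def)
      also have "\<dots> = \<eta> / (2 * 3 ^ p)"
      proof -
        have "\<eta> / (a * b) * b = \<eta> / a" if "b \<noteq> 0" for a b :: real using that by simp
        then show ?thesis using V(2) by simp
      qed
      finally have "3 ^ p * (\<eta>1 + \<omega> ^ p * V + \<eta>1) \<le> 3 ^ p * (\<eta>1 + \<eta> / (2 * 3 ^ p) + \<eta>1)" by simp
      also have "\<dots> = \<eta>" by (simp add: \<eta>1_def field_simps)
      finally show "3 ^ p * (\<eta>1 + \<omega> ^ p * V + \<eta>1) \<le> \<eta>" .
    qed
    finally show ?thesis .
  qed
  ultimately show ?thesis by blast
qed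

section \<open>Weak derivatives and mollification\<close>

lemma partials_vanish:
  assumes "open T" "\<And>x. x \<in> T \<Longrightarrow> \<phi> x = 0" "x \<in> T"
  shows "partials is \<phi> x = 0"
  using assms(3)
proof (induction "is" arbitrary: x)
  case (Cons i "is")
  have "((\<lambda>_. 0) has_derivative (\<lambda>_. 0)) (at x)" by simp
  then have "(partials is \<phi> has_derivative (\<lambda>_. 0)) (at x)"
    by (rule has_derivative_transform_within_open[OF _ assms(1) Cons.prems]) (simp add: Cons.IH)
  then show ?case by (simp add: frechet_derivative_at[symmetric])
qed (use assms(2) in simp)

lemma test_function_mollifier:
  assumes m: "mollifier e \<rho>" and sub: "cball x e \<subseteq> \<Omega>"
  shows "test_function \<Omega> (\<lambda>y. \<rho> (x - y))"
proof -
  note M = mollifierD[OF m]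
  have "{y. \<rho> (x - y) \<noteq> 0} \<subseteq> cball x e"
    using M(3) by (force simp: dist_norm)
  then have c: "closure {y. \<rho> (x - y) \<noteq> 0} \<subseteq> cball x e" by (rule closure_minimal) simp
  have "partials is (\<lambda>y. \<rho> (x - y)) differentiable (at y)" for "is" y
    unfolding partials_reflect[OF M(1)]
    by (intro differentiable_mult differentiable_const differentiable_compose[OF M(1)] differentiable_diff
        differentiable_ident)
  moreover have "compact (closure {y. \<rho> (x - y) \<noteq> 0})"
    using c by (meson bounded_cball bounded_subset closed_closure compact_eq_bounded_closed)
  ultimately show ?thesis using c sub by (auto simp: test_function_def)
qed

text \<open>Products and Fubini arguments need Borel functions on the whole space, whereas weak derivatives are
  Lebesgue measurable on an open set and only locally integrable.\<close>

lemma ex_borel_localization: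
  fixes g :: "real^'n \<Rightarrow> real"
  assumes g: "g \<in> Lp_loc 1 \<Omega>" "g \<in> Lp_loc p \<Omega>" and sub: "cball x0 R \<subseteq> \<Omega>" and "0 < p"
  shows "\<exists>h. integrable lborel h \<and> integrable lborel (\<lambda>z. \<bar>h z\<bar> ^ p) \<and>
     (\<forall>z. z \<notin> cball x0 R \<longrightarrow> h z = 0) \<and> (AE z in lborel. z \<in> cball x0 R \<longrightarrow> h z = g z)"
proof -
  let ?B = "cball x0 R"
  have "(\<lambda>z. indicator ?B z * (indicator \<Omega> z *\<^sub>R g z)) \<in> borel_measurable lebesgue"
    using g(1) by (intro borel_measurable_times borel_measurable_indicator)
      (auto simp: Lp_loc_def set_borel_measurable_def)
  also have "(\<lambda>z. indicator ?B z * (indicator \<Omega> z *\<^sub>R g z)) = (\<lambda>z. indicator ?B z * g z)"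
    using sub by (auto simp: fun_eq_iff indicator_def)
  finally have gm: "(\<lambda>z. indicator ?B z * g z) \<in> borel_measurable lebesgue" .
  then obtain h' where h': "h' \<in> borel_measurable lborel" "AE z in lborel. indicator ?B z * g z = h' z"
    using completion_ex_borel_measurable_real by blast
  define h where "h z = indicator ?B z * h' z" for z
  have hm: "h \<in> borel_measurable lborel" unfolding h_def
    using h'(1) by (intro borel_measurable_times borel_measurable_indicator) auto
  have ae: "AE z in lborel. h z = indicator ?B z * g z"
    using h'(2) by eventually_elim (auto simp: h_def indicator_def split: if_splits)
  have pw: "integrable lborel (\<lambda>z. \<bar>h z\<bar> ^ q)" if q: "g \<in> Lp_loc q \<Omega>" "0 < q" for q
  proof -
    have 1: "integrable lebesgue (\<lambda>z. indicator ?B z *\<^sub>R \<bar>g z\<bar> ^ q)"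
      using q(1) sub by (auto simp: Lp_loc_def set_integrable_def)
    have "AE z in lborel. \<bar>h z\<bar> ^ q = indicator ?B z *\<^sub>R \<bar>g z\<bar> ^ q"
      using ae by eventually_elim (use q(2) in \<open>auto simp: indicator_def\<close>)
    then have 2: "AE z in lebesgue. indicator ?B z *\<^sub>R \<bar>g z\<bar> ^ q = \<bar>h z\<bar> ^ q"
      by (intro AE_completion) (auto elim: eventually_mono)
    have 3: "(\<lambda>z. \<bar>h z\<bar> ^ q) \<in> borel_measurable lborel" using hm by measurable
    then have "integrable lebesgue (\<lambda>z. \<bar>h z\<bar> ^ q)"
      by (intro integrable_cong_AE_imp[OF 1 _ 2] measurable_completion)
    then show ?thesis using 3 by (simp add: integrable_completion)
  qed
  have "integrable lborel (\<lambda>z. \<bar>h z\<bar>)" using pw[OF g(1)] by simp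
  then have "integrable lborel h" using hm by (simp add: integrable_abs_iff)
  then show ?thesis
    using pw[OF g(2) \<open>0 < p\<close>] ae by (intro exI[of _ h]) (auto simp: h_def elim: eventually_mono)
qed

text \<open>The translated reflected kernel is an admissible test function in the definition of a weak derivative,
  and reflecting the kernel cancels the sign \<open>(- 1) ^ length is\<close>.\<close>

lemma mollify_weak_deriv:
  fixes g :: "real^'n \<Rightarrow> real"
  assumes w: "has_weak_deriv \<Omega> is u g" and sub: "cball x0 R' \<subseteq> \<Omega>"
    and h: "h \<in> borel_measurable borel" "\<And>z. z \<notin> cball x0 R' \<Longrightarrow> h z = 0"
    and hg: "AE z in lborel. z \<in> cball x0 R' \<longrightarrow> h z = g z"
    and m: "mollifier e \<rho>" and x: "cball x e \<subseteq> cball x0 R'"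
  shows "mollify h \<rho> x = (LINT z:\<Omega>|lebesgue. u z * partials is \<rho> (x - z))"
proof -
  note M = mollifierD[OF m]
  have gm: "(\<lambda>z. indicator \<Omega> z *\<^sub>R g z) \<in> borel_measurable lebesgue"
    using w by (auto simp: has_weak_deriv_def Lp_loc_def set_borel_measurable_def)
  have [measurable]: "\<rho> \<in> borel_measurable borel" "h \<in> borel_measurable borel" using M h by auto
  have \<rho>m: "(\<lambda>z. \<rho> (x - z)) \<in> borel_measurable lebesgue"
    by (rule measurable_completion) measurable
  have hm: "(\<lambda>z. h z * \<rho> (x - z)) \<in> borel_measurable lborel" by measurable
  have "test_function \<Omega> (\<lambda>y. \<rho> (x - y))" using test_function_mollifier[OF m] x sub by blast
  with w have "(LINT z:\<Omega>|lebesgue. u z * partials is (\<lambda>y. \<rho> (x - y)) z)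
      = (- 1) ^ length is * (LINT z:\<Omega>|lebesgue. g z * \<rho> (x - z))"
    by (auto simp: has_weak_deriv_def)
  also have "(LINT z:\<Omega>|lebesgue. u z * partials is (\<lambda>y. \<rho> (x - y)) z)
      = (LINT z:\<Omega>|lebesgue. (- 1) ^ length is * (u z * partials is \<rho> (x - z)))"
    unfolding partials_reflect[OF M(1)] by (simp add: mult_ac)
  also have "\<dots> = (- 1) ^ length is * (LINT z:\<Omega>|lebesgue. u z * partials is \<rho> (x - z))"
    by (rule set_integral_mult_right)
  finally have 1: "(LINT z:\<Omega>|lebesgue. u z * partials is \<rho> (x - z)) = (LINT z:\<Omega>|lebesgue. g z * \<rho> (x - z))"
    by simp
  have "(LINT z:\<Omega>|lebesgue. g z * \<rho> (x - z)) = (LINT z|lebesgue. (indicator \<Omega> z *\<^sub>R g z) * \<rho> (x - z))"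
    by (simp add: set_lebesgue_integral_def mult_ac)
  also have "\<dots> = (LINT z|lebesgue. h z * \<rho> (x - z))"
  proof (rule integral_cong_AE)
    have "AE z in lborel. (indicator \<Omega> z *\<^sub>R g z) * \<rho> (x - z) = h z * \<rho> (x - z)"
      using hg
    proof eventually_elim
      case (elim z)
      show ?case
      proof (cases "z \<in> cball x0 R'")
        case True
        then show ?thesis using elim sub by (auto simp: indicator_def)
      next
        case False
        then have "e \<le> norm (x - z)" using x by (force simp: dist_norm)
        then show ?thesis using M(3) by simp
      qed
    qed
    then show "AE z in lebesgue. (indicator \<Omega> z *\<^sub>R g z) * \<rho> (x - z) = h z * \<rho> (x - z)"
      by (rule AE_completion)
  qed (use gm \<rho>m measurable_completion[OF hm] in \<open>auto intro!: borel_measurable_times\<close>)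
  also have "\<dots> = mollify h \<rho> x" unfolding mollify_def by (rule integral_completion[OF hm])
  finally show ?thesis using 1 by simp
qed

text \<open>Both derivatives have the same mollifications, which converge to both of them in \<open>L\<^sup>1\<close>. This allows to
  pass from the second derivatives appearing in the equation, which are only locally integrable by
  definition, to representatives that are locally in \<open>L\<^sup>N\<close>.\<close>

lemma weak_deriv_unique_locally:
  fixes g g' :: "real^'n \<Rightarrow> real"
  assumes g: "has_weak_deriv \<Omega> is u g" and g': "has_weak_deriv \<Omega> is u g'"
    and sub: "cball x0 R' \<subseteq> \<Omega>" and R: "0 < R" "R < R'"
  shows "AE z in lborel. z \<in> cball x0 R \<longrightarrow> g z = g' z"
proof -
  have L: "g \<in> Lp_loc 1 \<Omega>" "g' \<in> Lp_loc 1 \<Omega>" using g g' by (auto simp: has_weak_deriv_def)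
  obtain h where h: "integrable lborel h" "integrable lborel (\<lambda>z. \<bar>h z\<bar> ^ 1)"
     "\<And>z. z \<notin> cball x0 R' \<Longrightarrow> h z = 0" "AE z in lborel. z \<in> cball x0 R' \<longrightarrow> h z = g z"
    using ex_borel_localization[OF L(1) L(1) sub] by auto
  obtain h' where h': "integrable lborel h'" "integrable lborel (\<lambda>z. \<bar>h' z\<bar> ^ 1)"
     "\<And>z. z \<notin> cball x0 R' \<Longrightarrow> h' z = 0" "AE z in lborel. z \<in> cball x0 R' \<longrightarrow> h' z = g' z"
    using ex_borel_localization[OF L(2) L(2) sub] by auto
  have [measurable]: "h \<in> borel_measurable borel" "h' \<in> borel_measurable borel" using h(1) h'(1) by auto
  let ?I = "\<integral>\<^sup>+ z. ennreal \<bar>h z - h' z\<bar> * indicator (cball x0 R) z \<partial>lborel"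
  have "?I \<le> 0 + ennreal \<eta>" if "0 < \<eta>" for \<eta>
  proof -
    obtain e1 where e1: "0 < e1" "\<And>e \<rho>. e < e1 \<Longrightarrow> mollifier e \<rho> \<Longrightarrow>
       Lp_error 1 (cball x0 R) (mollify h \<rho>) h \<le> ennreal (\<eta>/2)"
      using mollify_tendsto_Lp[OF h(1,2) zero_less_one h(3) R(2), where ?x0.0 = x0 and \<eta> = "\<eta>/2"] \<open>0 < \<eta>\<close> by auto
    obtain e2 where e2: "0 < e2" "\<And>e \<rho>. e < e2 \<Longrightarrow> mollifier e \<rho> \<Longrightarrow>
       Lp_error 1 (cball x0 R) (mollify h' \<rho>) h' \<le> ennreal (\<eta>/2)"
      using mollify_tendsto_Lp[OF h'(1,2) zero_less_one h'(3) R(2), where ?x0.0 = x0 and \<eta> = "\<eta>/2"] \<open>0 < \<eta>\<close> by auto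
    define e where "e = min (min e1 e2) (R' - R) / 2"
    have e: "0 < e" "e < e1" "e < e2" "e < R' - R" using e1(1) e2(1) R by (auto simp: e_def)
    obtain \<rho> :: "real^'n \<Rightarrow> real" where m: "mollifier e \<rho>" using ex_mollifier[OF e(1)] by blast
    have [measurable]: "\<rho> \<in> borel_measurable borel" using mollifierD[OF m] by simp
    have eq: "mollify h \<rho> x = mollify h' \<rho> x" if "x \<in> cball x0 R" for x
    proof -
      have "cball x e \<subseteq> cball x0 R'"
      proof
        fix z assume "z \<in> cball x e"
        then show "z \<in> cball x0 R'" using that e(4) dist_triangle[of x0 z x] by simp
      qed
      then show ?thesis
        using mollify_weak_deriv[OF g sub _ h(3,4) m, of x] mollify_weak_deriv[OF g' sub _ h'(3,4) m, of x] by simp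
    qed
    have "?I \<le> (\<integral>\<^sup>+ x. ennreal (\<bar>mollify h \<rho> x - h x\<bar> ^ 1) * indicator (cball x0 R) x
             + ennreal (\<bar>mollify h' \<rho> x - h' x\<bar> ^ 1) * indicator (cball x0 R) x \<partial>lborel)"
    proof (intro nn_integral_mono)
      fix x
      show "ennreal \<bar>h x - h' x\<bar> * indicator (cball x0 R) x \<le> ennreal (\<bar>mollify h \<rho> x - h x\<bar> ^ 1) * indicator (cball x0 R) x
             + ennreal (\<bar>mollify h' \<rho> x - h' x\<bar> ^ 1) * indicator (cball x0 R) x"
      proof (cases "x \<in> cball x0 R")
        case True
        have "\<bar>h x - h' x\<bar> \<le> \<bar>mollify h \<rho> x - h x\<bar> + \<bar>mollify h' \<rho> x - h' x\<bar>"
          using eq[OF True] by linarith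
        then have "ennreal \<bar>h x - h' x\<bar> \<le> ennreal (\<bar>mollify h \<rho> x - h x\<bar> + \<bar>mollify h' \<rho> x - h' x\<bar>)"
          by (rule ennreal_leI)
        then show ?thesis using True by simp
      qed simp
    qed
    also have "\<dots> = Lp_error 1 (cball x0 R) (mollify h \<rho>) h
        + Lp_error 1 (cball x0 R) (mollify h' \<rho>) h'"
    proof -
      have [measurable]: "cball x0 R \<in> sets borel" by simp
      have [measurable]: "mollify h \<rho> \<in> borel_measurable borel" "mollify h' \<rho> \<in> borel_measurable borel"
        by (rule mollify_measurable; measurable)+
      show ?thesis by (rule nn_integral_add) measurable
    qed
    also have "\<dots> \<le> ennreal (\<eta>/2) + ennreal (\<eta>/2)"
      by (rule add_mono[OF e1(2)[OF e(2) m] e2(2)[OF e(3) m]])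
    also have "\<dots> = ennreal \<eta>" using \<open>0 < \<eta>\<close> by (simp only: ennreal_plus[symmetric] field_sum_of_halves less_imp_le half_gt_zero)
    finally show ?thesis by simp
  qed
  then have "?I \<le> 0" by (rule ennreal_le_epsilon)
  then have I0: "?I = 0" by simp
  have "(\<lambda>z. ennreal \<bar>h z - h' z\<bar> * indicator (cball x0 R) z) \<in> borel_measurable lborel"
  proof -
    have [measurable]: "cball x0 R \<in> sets borel" by simp
    show ?thesis by measurable
  qed
  from iffD1[OF nn_integral_0_iff_AE[OF this] I0]
  have "AE z in lborel. ennreal \<bar>h z - h' z\<bar> * indicator (cball x0 R) z = 0" .
  then show ?thesis using h(4) h'(4)
  proof eventually_elim
    case (elim z)
    then show ?case using R by (auto simp: indicator_def split: if_splits)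
  qed
qed

section \<open>Contact with a quadratic polynomial\<close>

lemma symmetric_inner:
  fixes Q :: "real^'n^'n"
  assumes "\<And>i j. Q $ i $ j = Q $ j $ i"
  shows "x \<bullet> (Q *v y) = (Q *v x) \<bullet> y"
proof -
  have "transpose Q = Q" using assms by (simp add: transpose_def vec_eq_iff)
  then show ?thesis by (metis dot_lmul_matrix transpose_matrix_vector)
qed

text \<open>Ellipticity controls all entries of a nearly positive semidefinite matrix by the single number
  \<open>\<Sum>i j. A i j * B i j\<close>: every entry of \<open>B + \<tau> I\<close> is at most its trace.\<close>

lemma almost_psd_entry_bound:
  fixes A B :: "'n::finite \<Rightarrow> 'n \<Rightarrow> real"
  assumes A: "\<And>\<xi>. (\<Sum>i\<in>UNIV. (\<xi> i)\<^sup>2) \<le> \<Lambda> * quad A \<xi>" and C: "\<And>i j. \<bar>A i j\<bar> \<le> C" and "0 < \<Lambda>"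
    and sym: "\<And>i j. B i j = B j i" and B: "\<And>\<xi>. 0 \<le> quad B \<xi> + \<tau> * (\<Sum>i\<in>UNIV. (\<xi> i)\<^sup>2)" and "0 \<le> \<tau>"
    and E: "(\<Sum>i\<in>UNIV. \<Sum>j\<in>UNIV. A i j * B i j) \<le> E"
  shows "\<bar>B i j\<bar> \<le> \<Lambda> * E + (\<Lambda> * real CARD('n) * C + 1) * \<tau>"
proof -
  define M where "M i j = B i j + \<tau> * (if i = j then 1 else 0)" for i j
  have "(\<Sum>i\<in>UNIV. \<Sum>j\<in>UNIV. \<tau> * (if i = j then 1 else 0) * \<xi> i * \<xi> j) = \<tau> * (\<Sum>i\<in>UNIV. (\<xi> i)\<^sup>2)" for \<xi> :: "'n \<Rightarrow> real"
    by (simp add: power2_eq_square sum_distrib_left if_distrib[where f = "\<lambda>a. a * _"] if_distrib[where f = "\<lambda>a. _ * a"] mult.assoc cong: if_cong)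
  then have qM: "quad M \<xi> = quad B \<xi> + \<tau> * (\<Sum>i\<in>UNIV. (\<xi> i)\<^sup>2)" for \<xi>
    unfolding quad_def M_def by (simp only: distrib_right sum.distrib)
  have psd: "0 \<le> quad M \<xi>" for \<xi> unfolding qM by (rule B)
  have symM: "M i j = M j i" for i j using sym[of i j] by (simp add: M_def)
  have "(\<Sum>i\<in>UNIV. \<Sum>j\<in>UNIV. A i j * (\<tau> * (if i = j then 1 else 0))) = \<tau> * (\<Sum>i\<in>UNIV. A i i)"
    by (simp add: sum_distrib_left if_distrib[where f = "\<lambda>a. _ * a"] mult.commute cong: if_cong)
  then have "(\<Sum>i\<in>UNIV. \<Sum>j\<in>UNIV. A i j * M i j) = (\<Sum>i\<in>UNIV. \<Sum>j\<in>UNIV. A i j * B i j) + \<tau> * (\<Sum>i\<in>UNIV. A i i)"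
    unfolding M_def by (simp only: distrib_left sum.distrib)
  also have "\<dots> \<le> E + \<tau> * (real CARD('n) * C)"
  proof (intro add_mono E mult_left_mono \<open>0 \<le> \<tau>\<close>)
    show "(\<Sum>i\<in>UNIV. A i i) \<le> real CARD('n) * C"
      by (rule sum_bounded_above) (use C abs_le_D1 in blast)
  qed
  finally have "\<Lambda> * (\<Sum>i\<in>UNIV. \<Sum>j\<in>UNIV. A i j * M i j) \<le> \<Lambda> * (E + \<tau> * (real CARD('n) * C))"
    using \<open>0 < \<Lambda>\<close> by (intro mult_left_mono) auto
  with trace_le_elliptic_pairing[OF A symM psd] psd_entry_le_trace[OF symM psd, of i j]
  have "\<bar>M i j\<bar> \<le> \<Lambda> * (E + \<tau> * (real CARD('n) * C))" by linarith
  moreover have "\<bar>B i j\<bar> \<le> \<bar>M i j\<bar> + \<tau>" using \<open>0 \<le> \<tau>\<close> by (cases "i = j") (auto simp: M_def)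
  ultimately show ?thesis by (simp add: algebra_simps)
qed

lemma quad_eq_inner_lambda:
  fixes M :: "real^'n^'n"
  shows "(\<chi> i. \<xi> i) \<bullet> (M *v (\<chi> i. \<xi> i)) = quad (\<lambda>i j. M $ i $ j) \<xi>"
  by (simp add: inner_vec_def matrix_vector_mult_def quad_def sum_distrib_left mult_ac)

lemma has_derivative_vec_lambda:
  fixes f :: "'a::real_normed_vector \<Rightarrow> 'n::finite \<Rightarrow> real"
  assumes "\<And>i. ((\<lambda>x. f x i) has_derivative (\<lambda>h. f' h i)) (at x)"
  shows "((\<lambda>x. \<chi> i. f x i) has_derivative (\<lambda>h. \<chi> i. f' h i)) (at x)"
  unfolding has_derivative_componentwise_within[of "\<lambda>x. \<chi> i. f x i"]
  using assms by (auto simp: Basis_vec_def inner_axis)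

lemma cube_between_balls:
  fixes x0 :: "real^'n"
  assumes "0 \<le> r"
  shows "cball x0 (r / real CARD('n)) \<subseteq> cbox (x0 - (\<chi> i. r / real CARD('n))) (x0 + (\<chi> i. r / real CARD('n)))"
    and "cbox (x0 - (\<chi> i. r / real CARD('n))) (x0 + (\<chi> i. r / real CARD('n))) \<subseteq> cball x0 r"
proof -
  let ?s = "r / real CARD('n)"
  show "cball x0 ?s \<subseteq> cbox (x0 - (\<chi> i. ?s)) (x0 + (\<chi> i. ?s))"
  proof
    fix x assume "x \<in> cball x0 ?s"
    then have "\<bar>(x - x0) $ i\<bar> \<le> ?s" for i
      using component_le_norm_cart[of "x - x0" i] by (simp add: dist_norm norm_minus_commute)
    then show "x \<in> cbox (x0 - (\<chi> i. ?s)) (x0 + (\<chi> i. ?s))"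
      by (simp add: mem_box_cart abs_le_iff algebra_simps)
  qed
  show "cbox (x0 - (\<chi> i. ?s)) (x0 + (\<chi> i. ?s)) \<subseteq> cball x0 r"
  proof
    fix x assume x: "x \<in> cbox (x0 - (\<chi> i. ?s)) (x0 + (\<chi> i. ?s))"
    have "\<bar>(x - x0) $ i\<bar> \<le> ?s" for i
      using x by (simp add: mem_box_cart abs_le_iff algebra_simps)
    then have "(\<Sum>i\<in>UNIV. \<bar>(x - x0) $ i\<bar>) \<le> (\<Sum>i\<in>(UNIV::'n set). ?s)" by (intro sum_mono)
    then have "norm (x - x0) \<le> r" using norm_le_l1_cart[of "x - x0"] by simp
    then show "x \<in> cball x0 r" by (simp add: dist_norm norm_minus_commute)
  qed
qed

text \<open>The maximum principle in its Aleksandrov-Bakelman-Pucci form. The term \<open>- \<kappa> (norm (x - x0))\<^sup>2\<close> keeps the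
  drop from \<open>x0\<close> to a small sphere positive after \<open>u\<close> is replaced by a mollification, so the slopes of
  the mollified difference fill the ball of radius \<open>\<delta>\<close>, uniformly in the mollifier. At the concave points
  the Hessian \<open>Hs - Q\<close> satisfies
  \<open>0 \<le> \<Sum> A (Q - Hs) \<le> \<Sum> A (H - Hs)\<close> by the differential inequality for \<open>H\<close>, so it is bounded by the
  mollification error of the second derivatives, and the volume of the ball would tend to \<open>0\<close>.\<close>

lemma no_strict_contact:
  fixes u :: "real^'n \<Rightarrow> real" and H :: "'n \<Rightarrow> 'n \<Rightarrow> real^'n \<Rightarrow> real" and Q :: "real^'n^'n"
  assumes "0 < \<kappa>" "0 < r" and r: "cball x0 r \<subseteq> \<Omega>" and cu: "continuous_on \<Omega> u"
    and ell: "elliptic_coeffs \<Lambda> \<Omega> A" and "0 < \<Lambda>"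
    and weak: "\<And>i j. has_weak_deriv \<Omega> [i, j] u (H i j)" and HL: "\<And>i j. H i j \<in> Lp_loc CARD('n) \<Omega>"
    and Q: "\<And>i j. Q $ i $ j = Q $ j $ i"
    and touch: "\<And>x. x \<in> cball x0 r \<Longrightarrow>
        u x \<le> u x0 + p \<bullet> (x - x0) + (x - x0) \<bullet> (Q *v (x - x0)) / 2 - \<kappa> * (norm (x - x0))\<^sup>2"
    and sub: "AE x in lborel. x \<in> cball x0 r \<longrightarrow>
        (\<Sum>i\<in>UNIV. \<Sum>j\<in>UNIV. A x $ i $ j * Q $ i $ j) \<le> (\<Sum>i\<in>UNIV. \<Sum>j\<in>UNIV. A x $ i $ j * H i j x)"
  shows False
proof -
  note partials.simps(2) [simp del]
  let ?N = "real CARD('n)"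
  have N: "1 \<le> ?N" using card_gt_0_iff[of "UNIV :: 'n set"] by (simp add: Suc_leI)
  obtain C where C: "1 \<le> C" "\<And>x i j. x \<in> \<Omega> \<Longrightarrow> \<bar>A x $ i $ j\<bar> \<le> C"
  proof -
    obtain C' where "\<And>x i j. x \<in> \<Omega> \<Longrightarrow> \<bar>A x $ i $ j\<bar> \<le> C'"
      using ell unfolding elliptic_coeffs_def by blast
    then show ?thesis by (intro that[of "max 1 C'"]) (auto intro: order_trans[OF _ max.cobounded2])
  qed
  have Aell: "(\<Sum>i\<in>UNIV. (\<xi> i)\<^sup>2) \<le> \<Lambda> * quad (\<lambda>i j. A x $ i $ j) \<xi>" if "x \<in> \<Omega>" for x and \<xi> :: "'n \<Rightarrow> real"
  proof -
    have "1 / \<Lambda> * ((\<chi> i. \<xi> i) \<bullet> (\<chi> i. \<xi> i)) \<le> (\<chi> i. \<xi> i) \<bullet> (A x *v (\<chi> i. \<xi> i))"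
      using ell that unfolding elliptic_coeffs_def by blast
    then have "1 / \<Lambda> * (\<Sum>i\<in>UNIV. (\<xi> i)\<^sup>2) \<le> quad (\<lambda>i j. A x $ i $ j) \<xi>"
      unfolding quad_eq_inner_lambda by (simp add: inner_vec_def power2_eq_square)
    then show ?thesis using \<open>0 < \<Lambda>\<close> by (simp add: field_simps)
  qed
  \<comment> \<open>Contact points are sought in the ball of radius \<open>r1\<close>, derivatives are compared on radius \<open>R\<close>, second
    derivatives are localized to radius \<open>R'\<close>, and \<open>u\<close> is integrated over a cube \<open>D\<close> containing the ball of
    radius \<open>\<rho>0\<close>. The factor \<open>1/N\<close> keeps the cube inside the ball of radius \<open>r\<close>.\<close>
  define \<rho>0 where "\<rho>0 = r / ?N"
  define R' R r1 where "R' = \<rho>0 / 2" and "R = \<rho>0 / 4" and "r1 = \<rho>0 / 8"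
  have \<rho>0: "0 < \<rho>0" using N \<open>0 < r\<close> by (simp add: \<rho>0_def)
  have Rs: "0 < r1" "r1 < R" "R < R'" "R' < \<rho>0" "0 < R" "R' - R = R" "R' + R \<le> \<rho>0" using \<rho>0 by (auto simp: R'_def R_def r1_def)
  have \<rho>0r: "\<rho>0 \<le> r" using N \<open>0 < r\<close> by (simp add: \<rho>0_def divide_le_eq)
  define D where "D = cbox (x0 - (\<chi> i. \<rho>0)) (x0 + (\<chi> i. \<rho>0))"
  have D: "cball x0 \<rho>0 \<subseteq> D" "D \<subseteq> \<Omega>" "compact D"
    using cube_between_balls[of r x0] r \<open>0 < r\<close> by (auto simp: D_def \<rho>0_def)
  have contD: "continuous_on D u" using cu D(2) by (rule continuous_on_subset)
  have R'\<Omega>: "cball x0 R' \<subseteq> \<Omega>" using Rs \<rho>0r r by auto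
  \<comment> \<open>an error \<open>\<theta>\<close> at the centre and on the sphere and a slope \<open>\<delta>\<close> together use up three quarters of the
    drop \<open>\<kappa> r1\<^sup>2\<close>\<close>
  define \<theta> \<delta> where "\<theta> = \<kappa> * r1\<^sup>2 / 4" and "\<delta> = \<kappa> * r1 / 4"
  have \<theta>\<delta>: "0 < \<theta>" "0 < \<delta>" using \<open>0 < \<kappa>\<close> Rs by (auto simp: \<theta>_def \<delta>_def)
  obtain d where d: "0 < d" "\<And>x y. x \<in> D \<Longrightarrow> y \<in> D \<Longrightarrow> dist y x < d \<Longrightarrow> dist (u y) (u x) < \<theta>"
    using compact_uniformly_continuous[OF contD D(3)] \<theta>\<delta>(1) unfolding uniformly_continuous_on_def by meson
  define L where "L i j k \<longleftrightarrow> integrable lborel k \<and> integrable lborel (\<lambda>z. \<bar>k z\<bar> ^ CARD('n)) \<and>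
     (\<forall>z. z \<notin> cball x0 R' \<longrightarrow> k z = 0) \<and> (AE z in lborel. z \<in> cball x0 R' \<longrightarrow> k z = H i j z)" for i j k
  have "\<exists>k. L i j k" for i j
    unfolding L_def
  proof (rule ex_borel_localization[OF _ HL R'\<Omega>])
    show "H i j \<in> Lp_loc 1 \<Omega>" using weak[of i j] by (simp add: has_weak_deriv_def)
  qed simp
  then obtain h where "\<And>i j. L i j (h i j)" by metis
  then have h: "\<And>i j. integrable lborel (h i j)" "\<And>i j. integrable lborel (\<lambda>z. \<bar>h i j z\<bar> ^ CARD('n))"
     "\<And>i j z. z \<notin> cball x0 R' \<Longrightarrow> h i j z = 0"
     "\<And>i j. AE z in lborel. z \<in> cball x0 R' \<longrightarrow> h i j z = H i j z"
    unfolding L_def by blast+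
  have hm: "h i j \<in> borel_measurable borel" for i j using h(1)[of i j] by auto
  define \<beta> where "\<beta> = measure lborel (ball (0 :: real^'n) \<delta>)"
  have \<beta>: "emeasure lborel (ball (0 :: real^'n) \<delta>) = ennreal \<beta>" "0 < \<beta>"
  proof -
    show e: "emeasure lborel (ball (0 :: real^'n) \<delta>) = ennreal \<beta>"
      unfolding \<beta>_def by (rule emeasure_eq_ennreal_measure) (use emeasure_lborel_ball_finite[of "0 :: real^'n" \<delta>] in auto)
    show "0 < \<beta>" unfolding \<beta>_def using \<theta>\<delta>(2) by (simp add: content_ball_pos)
  qed
  define V where "V = measure lborel (cball x0 R)"
  have V: "emeasure lborel (cball x0 R) = ennreal V" "0 \<le> V"
    unfolding V_def by (rule emeasure_eq_ennreal_measure) (use emeasure_lborel_cball_finite[of x0 R] in auto)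
  define c where "c = ?N * ?N * (\<Lambda> * C) + (?N * ?N * (\<Lambda> * ?N * C + 1) + 1)"
  have c: "0 \<le> c" "?N * ?N * (\<Lambda> * C) \<le> c" "?N * ?N * (\<Lambda> * ?N * C + 1) + 1 \<le> c"
    using C(1) \<open>0 < \<Lambda>\<close> by (auto simp: c_def)
  define K where "K = (2 * ?N * c) ^ CARD('n) * (2 ^ CARD('n) * (?N * ?N) ^ CARD('n))"
  have K: "0 \<le> K" using c(1) by (simp add: K_def)
  \<comment> \<open>\<open>\<tau>\<close> serves both as the enlargement in the gradient-image estimate and as the bound for the \<open>L\<^sup>N\<close> errors;
    it is chosen so that the final estimate yields at most half of the volume \<open>\<beta>\<close>\<close>
  define Z where "Z = K * (?N * ?N + V) + 1"
  have Z: "0 < Z" unfolding Z_def using K V(2) by (simp add: add_nonneg_pos)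
  define \<tau> where "\<tau> = min 1 (\<beta> / (2 * Z))"
  have \<tau>: "0 < \<tau>" "\<tau> \<le> 1" using \<beta>(2) Z by (auto simp: \<tau>_def)
  have small: "K * (?N * ?N * \<tau> + \<tau> ^ CARD('n) * V) \<le> \<beta> / 2"
  proof -
    have "\<tau> ^ CARD('n) \<le> \<tau> ^ 1"
      using \<tau> card_gt_0_iff[of "UNIV :: 'n set"] by (intro power_decreasing) (auto simp: Suc_leI)
    then have "K * (?N * ?N * \<tau> + \<tau> ^ CARD('n) * V) \<le> K * (?N * ?N * \<tau> + \<tau> * V)"
      using K V(2) by (intro mult_left_mono add_left_mono mult_right_mono) auto
    also have "\<dots> \<le> Z * \<tau>" using \<tau> by (simp add: Z_def algebra_simps)
    also have "\<dots> \<le> Z * (\<beta> / (2 * Z))" using Z by (intro mult_left_mono) (auto simp: \<tau>_def)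
    also have "\<dots> = \<beta> / 2" using Z by simp
    finally show ?thesis .
  qed
  define S where "S i j d \<longleftrightarrow> (\<forall>e \<rho>. e < d \<longrightarrow> mollifier e \<rho> \<longrightarrow>
     Lp_error CARD('n) (cball x0 R) (mollify (h i j) \<rho>) (h i j) \<le> ennreal \<tau>)" for i j d
  have "\<exists>d>0. S i j d" for i j
    unfolding S_def by (rule mollify_tendsto_Lp[OF h(1,2) _ h(3) Rs(3) \<tau>(1)]) auto
  then obtain E where "\<And>i j. 0 < E i j \<and> S i j (E i j)" by metis
  then have E: "\<And>i j. 0 < E i j" "\<And>i j e \<rho>. e < E i j \<Longrightarrow> mollifier e \<rho> \<Longrightarrow>
     Lp_error CARD('n) (cball x0 R) (mollify (h i j) \<rho>) (h i j) \<le> ennreal \<tau>"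
    unfolding S_def by blast+
  define e0 where "e0 = Min (range (\<lambda>(i, j). E i j))"
  have e0: "0 < e0" "e0 \<le> E i j" for i j
    using E(1) by (auto simp: e0_def intro!: Min_le)
  define e where "e = min d (min e0 R) / 2"
  have e: "0 < e" "e < d" "e < E i j" "e < R" for i j
    using d(1) e0(1) e0(2)[of i j] Rs by (auto simp: e_def min_def)
  obtain \<rho> :: "real^'n \<Rightarrow> real" where m: "mollifier e \<rho>" using ex_mollifier[OF e(1)] by blast
  note M = mollifierD[OF m]
  have comm: "partials [i, j] \<rho> = partials [j, i] \<rho>" for i j using m by (simp add: mollifier_def)
  have sm: "partials is (partials js \<rho>) differentiable (at x)" for "is" js x
    unfolding partials_append[symmetric] by (rule M(1))
  define I where "I \<phi> x = integral D (\<lambda>z. u z * \<phi> (x - z))" for \<phi> x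
  have I: "(I (partials js \<rho>) has_derivative (\<lambda>v. \<Sum>i\<in>UNIV. v $ i * I (partials (i # js) \<rho>) x)) (at x)" for js x
    using has_derivative_kernel_integral[OF sm, of "x0 - (\<chi> i. \<rho>0)" "x0 + (\<chi> i. \<rho>0)" u js x] contD
    by (simp add: I_def[abs_def] D_def partials_append[of "[i]" js for i, symmetric])
  have I\<rho>: "I \<rho> x = mollify (\<lambda>z. indicator D z *\<^sub>R u z) \<rho> x" for x
  proof -
    have "set_integrable lborel D (\<lambda>z. u z * \<rho> (x - z))"
      unfolding set_integrable_def
      by (intro borel_integrable_compact D(3) continuous_intros contD continuous_on_compose2[OF M(6)]) auto
    from set_borel_integral_eq_integral(2)[OF this]
    show ?thesis unfolding I_def mollify_def set_lebesgue_integral_def by (simp add: mult.assoc)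
  qed
  have close: "\<bar>I \<rho> x - u x\<bar> \<le> \<theta>" if x: "x \<in> cball x0 R" for x
    unfolding I\<rho>
  proof (rule mollify_close[OF m])
    show "integrable lborel (\<lambda>z. indicator D z *\<^sub>R u z)"
      by (intro borel_integrable_compact D(3) contD)
    fix z assume z: "norm (x - z) < e"
    then have "dist x0 z \<le> \<rho>0" using x e(4) Rs dist_triangle[of x0 z x] by (auto simp: dist_norm)
    then have "z \<in> D" "x \<in> D" using D(1) x Rs by auto
    with d(2)[of x z] z e(2) show "\<bar>indicator D z *\<^sub>R u z - u x\<bar> \<le> \<theta>"
      by (auto simp: dist_norm norm_minus_commute)
  qed
  have ident: "I (partials [i, j] \<rho>) x = mollify (h i j) \<rho> x" if x: "x \<in> cball x0 R" for i j x
  proof -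
    have xe: "cball x e \<subseteq> cball x0 R'"
    proof
      fix z assume "z \<in> cball x e"
      then show "z \<in> cball x0 R'" using x e(4) Rs dist_triangle[of x0 z x] by simp
    qed
    have "mollify (h i j) \<rho> x = (LINT z:\<Omega>|lebesgue. u z * partials [i, j] \<rho> (x - z))"
      by (rule mollify_weak_deriv[OF weak R'\<Omega> hm h(3,4) m xe])
    also have "\<dots> = (LINT z:D|lebesgue. u z * partials [i, j] \<rho> (x - z))"
      unfolding set_lebesgue_integral_def
    proof (rule Bochner_Integration.integral_cong[OF refl])
      fix z
      show "indicator \<Omega> z *\<^sub>R (u z * partials [i, j] \<rho> (x - z)) = indicator D z *\<^sub>R (u z * partials [i, j] \<rho> (x - z))"
      proof (cases "z \<in> D")
        case True
        then show ?thesis using D(2) by (auto simp: indicator_def)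
      next
        case False
        then have "z \<notin> cball x e" using xe D(1) Rs by (meson dual_order.trans le_less subset_cball subset_iff less_imp_le)
        then have "x - z \<in> {y. e < norm y}" by (simp add: dist_norm)
        then have "partials [i, j] \<rho> (x - z) = 0"
          by (intro partials_vanish[of "{y. e < norm y}"]) (auto intro!: open_Collect_less continuous_intros M(3))
        then show ?thesis by simp
      qed
    qed
    also have "\<dots> = I (partials [i, j] \<rho>) x"
    proof -
      have "continuous_on UNIV (partials [i, j] \<rho>)"
        using M(1) by (intro continuous_at_imp_continuous_on ballI differentiable_imp_continuous_within)
      moreover have "continuous_on D (\<lambda>z. x - z)" by (intro continuous_intros)
      ultimately have "continuous_on D (\<lambda>z. partials [i, j] \<rho> (x - z))"
        by (rule continuous_on_compose2) simp
      then have "continuous_on D (\<lambda>z. u z * partials [i, j] \<rho> (x - z))"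
        by (rule continuous_on_mult[OF contD])
      then have "(\<lambda>z. u z * partials [i, j] \<rho> (x - z)) absolutely_integrable_on D"
        unfolding D_def by (rule absolutely_integrable_continuous)
      from set_lebesgue_integral_eq_integral(2)[OF this] show ?thesis by (simp only: I_def)
    qed
    finally show ?thesis by simp
  qed
  define Hs :: "real^'n \<Rightarrow> real^'n^'n" where "Hs x = (\<chi> i j. I (partials [j, i] \<rho>) x)" for x
  have contHs: "continuous_on UNIV Hs"
    unfolding Hs_def
    by (intro continuous_on_vec_lambda continuous_at_imp_continuous_on ballI has_derivative_continuous[OF I])
  have Hs: "Hs x $ i $ j = mollify (h i j) \<rho> x" if "x \<in> cball x0 R" for x i j
    using ident[OF that, of i j] unfolding Hs_def comm[of i j] by (simp only: vec_lambda_beta)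
  have Hsym: "Hs x $ i $ j = Hs x $ j $ i" for x i j
    unfolding Hs_def vec_lambda_beta by (rule arg_cong2[where f = I, OF comm refl])
  define G :: "real^'n \<Rightarrow> real^'n" where "G x = (\<chi> i. I (partials [i] \<rho>) x) - (p + Q *v (x - x0))" for x
  define w where "w x = I \<rho> x - (u x0 + p \<bullet> (x - x0) + (x - x0) \<bullet> (Q *v (x - x0)) / 2)" for x
  have Qd: "((\<lambda>x. Q *v (x - x0)) has_derivative (\<lambda>v. Q *v v)) (at x)" for x
  proof -
    have "((\<lambda>x. x - x0) has_derivative (\<lambda>v. v)) (at x)" by (auto intro!: derivative_eq_intros)
    from bounded_linear.has_derivative[OF matrix_vector_mul_bounded_linear this] show ?thesis .
  qed
  have wd: "(w has_derivative (\<lambda>v. G x \<bullet> v)) (at x)" for x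
  proof -
    have "(w has_derivative (\<lambda>v. (\<Sum>i\<in>UNIV. v $ i * I (partials [i] \<rho>) x)
       - (p \<bullet> v + ((x - x0) \<bullet> (Q *v v) + v \<bullet> (Q *v (x - x0))) / 2))) (at x)"
      unfolding w_def using I[of "[]" x]
      by (auto intro!: derivative_eq_intros Qd)
    moreover have "(x - x0) \<bullet> (Q *v v) = (Q *v (x - x0)) \<bullet> v" for v by (rule symmetric_inner[OF Q])
    ultimately show ?thesis
      by (elim has_derivative_eq_rhs)
         (auto simp: G_def inner_diff_left inner_add_left inner_commute[of _ "Q *v (x - x0)"] inner_vec_def[of "\<chi> i. I (partials [i] \<rho>) x"] mult.commute fun_eq_iff)
  qed
  have Gd: "(G has_derivative (\<lambda>v. (Hs x - Q) *v v)) (at x)" for x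
  proof -
    have "((\<lambda>x. \<chi> i. I (partials [i] \<rho>) x) has_derivative (\<lambda>v. \<chi> i. \<Sum>j\<in>UNIV. v $ j * I (partials [j, i] \<rho>) x)) (at x)"
      by (intro has_derivative_vec_lambda I)
    moreover have "(\<lambda>v. \<chi> i. \<Sum>j\<in>UNIV. v $ j * I (partials [j, i] \<rho>) x) = (\<lambda>v. Hs x *v v)"
      by (simp add: Hs_def matrix_vector_mult_def mult.commute)
    ultimately have 1: "((\<lambda>x. \<chi> i. I (partials [i] \<rho>) x) has_derivative (\<lambda>v. Hs x *v v)) (at x)" by simp
    have 2: "((\<lambda>x. p + Q *v (x - x0)) has_derivative (\<lambda>v. 0 + Q *v v)) (at x)"
      by (intro has_derivative_add has_derivative_const Qd)
    have "(G has_derivative (\<lambda>v. Hs x *v v - (0 + Q *v v))) (at x)"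
      unfolding G_def[abs_def] by (rule has_derivative_diff[OF 1 2])
    then show ?thesis by (simp add: matrix_vector_mult_diff_rdistrib)
  qed
  let ?\<Gamma> = "{x \<in> ball x0 r1. \<forall>\<xi>. \<xi> \<bullet> ((Hs x - Q) *v \<xi>) \<le> 0}"
  have ball: "ball 0 \<delta> \<subseteq> G ` ?\<Gamma>"
  proof (rule slopes_are_gradients_at_concave_points[of x0 R w G "\<lambda>x. Hs x - Q"])
    fix x assume x: "dist x0 x = r1"
    have n: "norm (x - x0) = r1" using x by (simp add: dist_norm norm_minus_commute)
    have xr: "x \<in> cball x0 R" "x0 \<in> cball x0 R" "x \<in> cball x0 r" using x Rs \<rho>0r by auto
    have "w x \<le> \<theta> - \<kappa> * r1\<^sup>2"
      using close[OF xr(1)] touch[OF xr(3)] n unfolding w_def by (simp add: abs_le_iff)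
    moreover have "- \<theta> \<le> w x0" using close[OF xr(2)] by (simp add: w_def abs_le_iff)
    moreover have "\<theta> - \<kappa> * r1\<^sup>2 < - \<theta> - \<delta> * r1"
      using \<open>0 < \<kappa>\<close> Rs(1) by (simp add: \<theta>_def \<delta>_def power2_eq_square field_simps)
    ultimately show "w x < w x0 - \<delta> * r1" by linarith
  qed (use wd Gd Rs in auto)
  \<comment> \<open>near the concave points the Hessian \<open>Hs - Q\<close> is still negative semidefinite up to \<open>\<tau>\<close>\<close>
  define W where "W = {y \<in> cball x0 R. \<forall>\<xi>::real^'n. 0 \<le> \<xi> \<bullet> ((Q - Hs y) *v \<xi>) + \<tau> * (\<xi> \<bullet> \<xi>)}"
  have "closed W"
  proof -
    have c: "continuous_on UNIV (\<lambda>y. \<xi> \<bullet> ((Q - Hs y) *v \<xi>) + \<tau> * (\<xi> \<bullet> \<xi>))" for \<xi> :: "real^'n"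
    proof -
      have "continuous_on UNIV (\<lambda>y. Hs y $ i $ j)" for i j
        using contHs by (intro continuous_intros)
      then show ?thesis
        unfolding matrix_vector_mult_def inner_vec_def by (simp, intro continuous_intros contHs)
    qed
    have "W = cball x0 R \<inter> {y. \<forall>\<xi>::real^'n. 0 \<le> \<xi> \<bullet> ((Q - Hs y) *v \<xi>) + \<tau> * (\<xi> \<bullet> \<xi>)}"
      by (auto simp: W_def)
    moreover have "closed {y. \<forall>\<xi>::real^'n. 0 \<le> \<xi> \<bullet> ((Q - Hs y) *v \<xi>) + \<tau> * (\<xi> \<bullet> \<xi>)}"
      by (intro closed_Collect_all closed_Collect_le continuous_on_const c)
    ultimately show ?thesis by (simp add: closed_Int)
  qed
  have "uniformly_continuous_on (cball x0 R) Hs"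
    by (intro compact_uniformly_continuous continuous_on_subset[OF contHs]) auto
  moreover have "0 < \<tau> / (?N * ?N)" using \<tau>(1) N by simp
  ultimately obtain d2 where d2: "0 < d2"
      "\<And>x y. x \<in> cball x0 R \<Longrightarrow> y \<in> cball x0 R \<Longrightarrow> dist y x < d2 \<Longrightarrow> dist (Hs y) (Hs x) < \<tau> / (?N * ?N)"
    unfolding uniformly_continuous_on_def by meson
  define s where "s = min (d2 / 2) (R - r1)"
  have s: "0 < s" using d2(1) Rs by (simp add: s_def)
  have near: "y \<in> W" if x: "x \<in> ?\<Gamma>" and xy: "dist x y \<le> s" for x y
  proof -
    have yR: "y \<in> cball x0 R" and xR: "x \<in> cball x0 R" using x xy dist_triangle[of x0 y x] Rs by (auto simp: s_def)
    have "dist (Hs y) (Hs x) < \<tau> / (?N * ?N)" using d2 xy by (intro d2(2) xR yR) (auto simp: s_def dist_commute)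
    then have nH: "norm (Hs x - Hs y) \<le> \<tau> / (?N * ?N)" by (simp add: dist_norm norm_minus_commute)
    have "0 \<le> \<xi> \<bullet> ((Q - Hs y) *v \<xi>) + \<tau> * (\<xi> \<bullet> \<xi>)" for \<xi>
    proof -
      have "onorm ((*v) (Hs x - Hs y)) \<le> ?N * ?N * (\<tau> / (?N * ?N))"
      proof (rule onorm_le_matrix_component)
        fix i j
        have "\<bar>(Hs x - Hs y) $ i $ j\<bar> \<le> norm ((Hs x - Hs y) $ i)" by (rule component_le_norm_cart)
        also have "\<dots> \<le> norm (Hs x - Hs y)" by (rule Finite_Cartesian_Product.norm_nth_le)
        finally show "\<bar>(Hs x - Hs y) $ i $ j\<bar> \<le> \<tau> / (?N * ?N)" using nH by linarith
      qed
      also have "\<dots> = \<tau>" using N by simp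
      finally have on: "onorm ((*v) (Hs x - Hs y)) \<le> \<tau>" .
      have "norm ((Hs x - Hs y) *v \<xi>) \<le> onorm ((*v) (Hs x - Hs y)) * norm \<xi>"
        by (rule onorm[OF matrix_vector_mul_bounded_linear])
      also have "\<dots> \<le> \<tau> * norm \<xi>" using on by (intro mult_right_mono) auto
      finally have "norm \<xi> * norm ((Hs x - Hs y) *v \<xi>) \<le> norm \<xi> * (\<tau> * norm \<xi>)" by (intro mult_left_mono) auto
      moreover have "\<bar>\<xi> \<bullet> ((Hs x - Hs y) *v \<xi>)\<bar> \<le> norm \<xi> * norm ((Hs x - Hs y) *v \<xi>)" by (rule Cauchy_Schwarz_ineq2)
      moreover have "norm \<xi> * (\<tau> * norm \<xi>) = \<tau> * (\<xi> \<bullet> \<xi>)" by (simp add: power2_norm_eq_inner[symmetric] power2_eq_square)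
      moreover have "\<xi> \<bullet> ((Hs x - Q) *v \<xi>) \<le> 0" using x by simp
      moreover have "\<xi> \<bullet> ((Q - Hs y) *v \<xi>) = \<xi> \<bullet> ((Hs x - Hs y) *v \<xi>) - \<xi> \<bullet> ((Hs x - Q) *v \<xi>)"
        by (simp add: matrix_vector_mult_diff_rdistrib inner_diff_right)
      ultimately show ?thesis by linarith
    qed
    then show ?thesis using yR by (simp add: W_def)
  qed
  define T where "T y = (\<Sum>i\<in>UNIV. \<Sum>j\<in>UNIV. \<bar>(Hs y - Q) $ i $ j\<bar>)" for y
  let ?B = "\<lambda>y. indicator (cball x0 R) y :: ennreal"
  let ?e = "\<lambda>k y. ennreal (\<bar>mollify (h (fst k) (snd k)) \<rho> y - h (fst k) (snd k) y\<bar> ^ CARD('n)) * ?B y"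
  have "ennreal \<beta> \<le> (\<integral>\<^sup>+ y. ennreal ((2 * ?N * (T y + \<tau>)) ^ CARD('n)) * indicator W y \<partial>lborel)"
    unfolding \<beta>(1)[symmetric]
  proof (rule emeasure_gradient_image_le[OF _ _ _ _ _ _ _ s near \<tau>(1) ball])
    show "continuous_on (cball x0 R) T"
      unfolding T_def using continuous_on_subset[OF contHs subset_UNIV]
      by (intro continuous_intros) 
    show "onorm ((*v) (Hs x - Q)) \<le> T x" for x unfolding T_def by (rule onorm_le_matrix_component_sum)
    show "W \<in> sets borel" using \<open>closed W\<close> by simp
    show "W \<subseteq> cball x0 R" by (auto simp: W_def)
  qed (use Gd in auto)
  also have "\<dots> \<le> (\<integral>\<^sup>+ y. ennreal K * ((\<Sum>k\<in>UNIV. ?e k y) + ennreal (\<tau> ^ CARD('n)) * ?B y) \<partial>lborel)"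
  proof (rule nn_integral_mono_AE)
    have "AE y in lborel. \<forall>k\<in>UNIV. y \<in> cball x0 R' \<longrightarrow> h (fst k) (snd k) y = H (fst k) (snd k) y"
      by (subst AE_finite_all) (use h(4) in auto)
    with sub show "AE y in lborel. ennreal ((2 * ?N * (T y + \<tau>)) ^ CARD('n)) * indicator W y
      \<le> ennreal K * ((\<Sum>k\<in>UNIV. ?e k y) + ennreal (\<tau> ^ CARD('n)) * ?B y)"
    proof eventually_elim
      case (elim y)
      show ?case
      proof (cases "y \<in> W")
        case True
        then have yR: "y \<in> cball x0 R" by (simp add: W_def)
        then have yr: "y \<in> cball x0 r" "y \<in> cball x0 R'" "y \<in> \<Omega>" using Rs \<rho>0r r by auto
        have hH: "h i j y = H i j y" for i j using elim(2) yr(2) by auto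
        define \<Delta> where "\<Delta> k = \<bar>mollify (h (fst k) (snd k)) \<rho> y - h (fst k) (snd k) y\<bar>" for k
        define S where "S = (\<Sum>k\<in>UNIV. \<Delta> k)"
        have \<Delta>0: "0 \<le> \<Delta> k" for k by (simp add: \<Delta>_def)
        have S0: "0 \<le> S" unfolding S_def by (intro sum_nonneg \<Delta>0)
        have bd: "\<bar>(Q - Hs y) $ i $ j\<bar> \<le> \<Lambda> * (C * S) + (\<Lambda> * ?N * C + 1) * \<tau>" for i j
        proof (rule almost_psd_entry_bound[of \<Lambda> "\<lambda>i j. A y $ i $ j"])
          show "0 \<le> quad (\<lambda>i j. (Q - Hs y) $ i $ j) \<xi> + \<tau> * (\<Sum>i\<in>UNIV. (\<xi> i)\<^sup>2)" for \<xi> :: "'n \<Rightarrow> real"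
          proof -
            have "0 \<le> (\<chi> i. \<xi> i) \<bullet> ((Q - Hs y) *v (\<chi> i. \<xi> i)) + \<tau> * ((\<chi> i. \<xi> i) \<bullet> (\<chi> i. \<xi> i))"
              using True by (simp add: W_def)
            then show ?thesis
              unfolding quad_eq_inner_lambda
              by (simp only: inner_vec_def power2_eq_square vec_lambda_beta inner_real_def)
          qed
          have "(\<Sum>i\<in>UNIV. \<Sum>j\<in>UNIV. A y $ i $ j * (Q - Hs y) $ i $ j)
             = (\<Sum>i\<in>UNIV. \<Sum>j\<in>UNIV. A y $ i $ j * Q $ i $ j) - (\<Sum>i\<in>UNIV. \<Sum>j\<in>UNIV. A y $ i $ j * Hs y $ i $ j)"
            by (simp add: right_diff_distrib sum_subtractf)
          also have "\<dots> \<le> (\<Sum>i\<in>UNIV. \<Sum>j\<in>UNIV. A y $ i $ j * H i j y) - (\<Sum>i\<in>UNIV. \<Sum>j\<in>UNIV. A y $ i $ j * Hs y $ i $ j)"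
            using elim(1) yr(1) by simp
          also have "\<dots> = (\<Sum>i\<in>UNIV. \<Sum>j\<in>UNIV. A y $ i $ j * (H i j y - Hs y $ i $ j))"
            by (simp add: right_diff_distrib sum_subtractf)
          also have "\<dots> \<le> (\<Sum>i\<in>UNIV. \<Sum>j\<in>UNIV. C * \<Delta> (i, j))"
          proof (intro sum_mono)
            fix i j
            have "\<bar>H i j y - Hs y $ i $ j\<bar> = \<Delta> (i, j)"
              by (simp add: \<Delta>_def Hs[OF yR] hH abs_minus_commute)
            then have "\<bar>A y $ i $ j * (H i j y - Hs y $ i $ j)\<bar> \<le> C * \<Delta> (i, j)"
              unfolding abs_mult using C(2)[OF yr(3), of i j] \<Delta>0 by (intro mult_mono) (auto intro: order_trans)
            then show "A y $ i $ j * (H i j y - Hs y $ i $ j) \<le> C * \<Delta> (i, j)" by (simp add: abs_le_iff)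
          qed
          also have "\<dots> = C * S"
            unfolding S_def by (simp add: sum_distrib_left[symmetric] sum.cartesian_product)
          finally show "(\<Sum>i\<in>UNIV. \<Sum>j\<in>UNIV. A y $ i $ j * (Q - Hs y) $ i $ j) \<le> C * S" .
        qed (use Aell[OF yr(3)] C(2)[OF yr(3)] \<open>0 < \<Lambda>\<close> \<tau>(1) Q Hsym in \<open>auto simp: less_imp_le\<close>)
        have "T y \<le> (\<Sum>i\<in>(UNIV::'n set). \<Sum>j\<in>(UNIV::'n set). \<Lambda> * (C * S) + (\<Lambda> * ?N * C + 1) * \<tau>)"
          unfolding T_def using bd by (intro sum_mono) (simp add: abs_minus_commute)
        also have "\<dots> = ?N * ?N * (\<Lambda> * (C * S) + (\<Lambda> * ?N * C + 1) * \<tau>)" by simp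
        finally have "T y + \<tau> \<le> (?N * ?N * (\<Lambda> * C)) * S + (?N * ?N * (\<Lambda> * ?N * C + 1) + 1) * \<tau>"
          by (simp add: algebra_simps)
        also have "\<dots> \<le> c * S + c * \<tau>"
          using c S0 \<tau>(1) by (intro add_mono mult_right_mono) auto
        finally have "2 * ?N * (T y + \<tau>) \<le> 2 * ?N * (c * S + c * \<tau>)"
          by (rule mult_left_mono) simp
        also have "\<dots> = 2 * ?N * c * (S + \<tau>)" by (simp add: distrib_left mult.assoc)
        finally have "2 * ?N * (T y + \<tau>) \<le> 2 * ?N * c * (S + \<tau>)" .
        then have "(2 * ?N * (T y + \<tau>)) ^ CARD('n) \<le> (2 * ?N * c * (S + \<tau>)) ^ CARD('n)"
          using \<tau>(1) by (intro power_mono mult_nonneg_nonneg add_nonneg_nonneg) (auto simp: T_def intro!: sum_nonneg)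
        also have "\<dots> \<le> (2 * ?N * c) ^ CARD('n) * (2 ^ CARD('n) * (S ^ CARD('n) + \<tau> ^ CARD('n)))"
          unfolding power_mult_distrib[of "2 * ?N * c"]
          using c(1) S0 \<tau>(1) by (intro mult_left_mono power_add2_le) auto
        also have "\<dots> \<le> (2 * ?N * c) ^ CARD('n) * (2 ^ CARD('n) *
            ((?N * ?N) ^ CARD('n) * (\<Sum>k\<in>UNIV. \<Delta> k ^ CARD('n)) + (?N * ?N) ^ CARD('n) * \<tau> ^ CARD('n)))"
        proof (intro mult_left_mono add_mono)
          show "S ^ CARD('n) \<le> (?N * ?N) ^ CARD('n) * (\<Sum>k\<in>UNIV. \<Delta> k ^ CARD('n))"
            using sum_power_le[of "UNIV :: ('n \<times> 'n) set" \<Delta> "CARD('n)"] \<Delta>0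
            by (simp add: S_def card_prod)
          have "1 * 1 \<le> ?N * ?N" using N by (intro mult_mono) auto
          then have "1 \<le> (?N * ?N) ^ CARD('n)" by (intro one_le_power) simp
          then show "\<tau> ^ CARD('n) \<le> (?N * ?N) ^ CARD('n) * \<tau> ^ CARD('n)"
            using mult_right_mono[of 1 "(?N * ?N) ^ CARD('n)" "\<tau> ^ CARD('n)"] \<tau>(1) by simp
        qed (use c(1) in auto)
        also have "\<dots> = K * ((\<Sum>k\<in>UNIV. \<Delta> k ^ CARD('n)) + \<tau> ^ CARD('n))"
          by (simp add: K_def distrib_left mult.assoc)
        finally have "ennreal ((2 * ?N * (T y + \<tau>)) ^ CARD('n))
            \<le> ennreal (K * ((\<Sum>k\<in>UNIV. \<Delta> k ^ CARD('n)) + \<tau> ^ CARD('n)))"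
          by (rule ennreal_leI)
        also have "\<dots> = ennreal K * ((\<Sum>k\<in>UNIV. ennreal (\<Delta> k ^ CARD('n))) + ennreal (\<tau> ^ CARD('n)))"
          using K \<tau>(1) \<Delta>0 by (simp add: ennreal_mult sum_nonneg sum_ennreal)
        finally show ?thesis using True yR by (simp add: \<Delta>_def)
      qed simp
    qed
  qed
  also have "\<dots> = ennreal K * ((\<Sum>k\<in>UNIV. \<integral>\<^sup>+ y. ?e k y \<partial>lborel) + ennreal (\<tau> ^ CARD('n)) * ennreal V)"
  proof -
    have [measurable]: "cball x0 R \<in> sets borel" by simp
    have [measurable]: "mollify (h i j) \<rho> \<in> borel_measurable borel" for i j
      using hm M(7) by (rule mollify_measurable)
    note [measurable] = hm
    show ?thesis
      by (subst nn_integral_cmult, measurable, subst nn_integral_add, measurable, subst nn_integral_sum, measurable)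
         (simp add: nn_integral_cmult_indicator V(1))
  qed
  also have "\<dots> \<le> ennreal K * ((\<Sum>k\<in>(UNIV::('n\<times>'n) set). ennreal \<tau>) + ennreal (\<tau> ^ CARD('n)) * ennreal V)"
    by (intro add_mono mult_left_mono sum_mono E(2)[OF e(3) m] order_refl) auto
  also have "\<dots> = ennreal (K * (?N * ?N * \<tau> + \<tau> ^ CARD('n) * V))"
  proof -
    have "(\<Sum>k\<in>(UNIV::('n\<times>'n) set). ennreal \<tau>) = ennreal (\<Sum>k\<in>(UNIV::('n\<times>'n) set). \<tau>)"
      using \<tau>(1) by (intro sum_ennreal) auto
    also have "(\<Sum>k\<in>(UNIV::('n\<times>'n) set). \<tau>) = ?N * ?N * \<tau>" by (simp add: card_prod)
    finally show ?thesis
      using K \<tau>(1) V(2)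
      by (simp only: ennreal_mult ennreal_plus add_nonneg_nonneg mult_nonneg_nonneg of_nat_0_le_iff less_imp_le zero_le_power)
  qed
  also have "\<dots> \<le> ennreal (\<beta> / 2)" by (rule ennreal_leI[OF small])
  finally show False using \<beta>(2) by (simp add: ennreal_le_iff)
qed

lemma elliptic_diagonal_bounds:
  fixes A :: "real^'n \<Rightarrow> real^'n^'n"
  assumes ell: "elliptic_coeffs \<Lambda> \<Omega> A" and x: "x \<in> \<Omega>"
  shows "1 / \<Lambda> \<le> A x $ k $ k" "A x $ k $ k \<le> \<Lambda>"
proof -
  have "axis k 1 \<bullet> (A x *v axis k 1) = A x $ k $ k"
    by (simp add: inner_axis' matrix_vector_mul_component inner_axis)
  moreover have "(axis k 1 :: real^'n) \<bullet> axis k 1 = 1" by (simp add: inner_axis_axis)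
  ultimately show "1 / \<Lambda> \<le> A x $ k $ k" "A x $ k $ k \<le> \<Lambda>"
    using ell x unfolding elliptic_coeffs_def by (metis mult.right_neutral)+
qed

text \<open>A gap \<open>c\<close> in the differential inequality pays for the strictly convex perturbation \<open>\<kappa> (norm (x - x0))\<^sup>2\<close>
  that makes the contact strict.\<close>

lemma no_contact:
  fixes u :: "real^'n \<Rightarrow> real" and H :: "'n \<Rightarrow> 'n \<Rightarrow> real^'n \<Rightarrow> real" and Q :: "real^'n^'n"
  assumes "0 < c" "0 < r" and r: "cball x0 r \<subseteq> \<Omega>" and cu: "continuous_on \<Omega> u"
    and ell: "elliptic_coeffs \<Lambda> \<Omega> A" and "0 < \<Lambda>"
    and weak: "\<And>i j. has_weak_deriv \<Omega> [i, j] u (H i j)" and HL: "\<And>i j. H i j \<in> Lp_loc CARD('n) \<Omega>"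
    and Q: "\<And>i j. Q $ i $ j = Q $ j $ i"
    and touch: "\<And>x. x \<in> cball x0 r \<Longrightarrow>
        u x \<le> u x0 + p \<bullet> (x - x0) + (x - x0) \<bullet> (Q *v (x - x0)) / 2"
    and sub: "AE x in lborel. x \<in> cball x0 r \<longrightarrow>
        (\<Sum>i\<in>UNIV. \<Sum>j\<in>UNIV. A x $ i $ j * Q $ i $ j) + c \<le> (\<Sum>i\<in>UNIV. \<Sum>j\<in>UNIV. A x $ i $ j * H i j x)"
  shows False
proof -
  let ?N = "real CARD('n)"
  define \<kappa> where "\<kappa> = c / (2 * ?N * \<Lambda>)"
  have \<kappa>: "0 < \<kappa>" using \<open>0 < c\<close> \<open>0 < \<Lambda>\<close> by (simp add: \<kappa>_def)
  define Q' where "Q' = Q + (2 * \<kappa>) *\<^sub>R mat 1"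
  have Q'v: "Q' *v y = Q *v y + (2 * \<kappa>) *\<^sub>R y" for y
    by (simp add: Q'_def matrix_vector_mult_add_rdistrib scaleR_matrix_vector_assoc[symmetric])
  show False
  proof (rule no_strict_contact[OF \<kappa> \<open>0 < r\<close> r cu ell \<open>0 < \<Lambda>\<close> weak HL, of Q' p])
    show "Q' $ i $ j = Q' $ j $ i" for i j using Q[of i j] by (simp add: Q'_def mat_def)
    show "u x \<le> u x0 + p \<bullet> (x - x0) + (x - x0) \<bullet> (Q' *v (x - x0)) / 2 - \<kappa> * (norm (x - x0))\<^sup>2"
      if "x \<in> cball x0 r" for x
      using touch[OF that] by (simp add: Q'v inner_add_right power2_norm_eq_inner add_divide_distrib)
    show "AE x in lborel. x \<in> cball x0 r \<longrightarrow>
        (\<Sum>i\<in>UNIV. \<Sum>j\<in>UNIV. A x $ i $ j * Q' $ i $ j) \<le> (\<Sum>i\<in>UNIV. \<Sum>j\<in>UNIV. A x $ i $ j * H i j x)"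
      using sub
    proof eventually_elim
      case (elim x)
      show ?case
      proof
        assume x: "x \<in> cball x0 r"
        have "(\<Sum>i\<in>UNIV. \<Sum>j\<in>UNIV. A x $ i $ j * Q' $ i $ j)
           = (\<Sum>i\<in>UNIV. \<Sum>j\<in>UNIV. A x $ i $ j * Q $ i $ j) + (\<Sum>i\<in>UNIV. \<Sum>j\<in>UNIV. if i = j then A x $ i $ i * (2 * \<kappa>) else 0)"
          unfolding sum.distrib[symmetric] by (intro sum.cong refl) (auto simp: Q'_def mat_def algebra_simps)
        also have "(\<Sum>i\<in>UNIV. \<Sum>j\<in>UNIV. if i = j then A x $ i $ i * (2 * \<kappa>) else 0) = (\<Sum>i\<in>UNIV. A x $ i $ i * (2 * \<kappa>))"
          by simp
        also have "\<dots> \<le> (\<Sum>i\<in>(UNIV :: 'n set). \<Lambda> * (2 * \<kappa>))"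
          using elliptic_diagonal_bounds(2)[OF ell] x r \<kappa> by (intro sum_mono mult_right_mono) auto
        also have "\<dots> = c" using \<open>0 < \<Lambda>\<close> by (simp add: \<kappa>_def)
        finally show "(\<Sum>i\<in>UNIV. \<Sum>j\<in>UNIV. A x $ i $ j * Q' $ i $ j) \<le> (\<Sum>i\<in>UNIV. \<Sum>j\<in>UNIV. A x $ i $ j * H i j x)"
          using elim x by simp
      qed
    qed
  qed
qed

locale dirichlet_solution =
  fixes \<Omega> :: "(real^'n) set" and A :: "real^'n \<Rightarrow> real^'n^'n" and \<Lambda> :: real
    and f :: "real \<Rightarrow> real" and lam :: real and u :: "real^'n \<Rightarrow> real"
  assumes open_domain: "open \<Omega>" and elliptic: "elliptic_coeffs \<Lambda> \<Omega> A" and \<Lambda>_pos: "0 < \<Lambda>"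
    and continuous_f: "continuous_on UNIV f" and solution: "strong_solution \<Omega> A f lam u"
begin

text \<open>For a contact polynomial in one variable, \<open>gap\<close> says that it is a strict supersolution at the contact
  point. Continuity of \<open>f \<circ> u\<close> extends the inequality to a neighbourhood with half the gap.\<close>

lemma not_touched_from_above:
  assumes x0: "x0 \<in> \<Omega>" and "0 < r" "0 < c"
    and touch: "\<And>x. x \<in> ball x0 r \<Longrightarrow> u x \<le> u x0 + b * (x - x0) $ k + q * ((x - x0) $ k)\<^sup>2 / 2"
    and gap: "\<And>x. x \<in> \<Omega> \<Longrightarrow> A x $ k $ k * q + c \<le> - lam * f (u x0)"
  shows False
proof -
  have cu: "continuous_on \<Omega> u"
    using solution closure_subset unfolding strong_solution_def by (meson continuous_on_subset)
  obtain H where H: "\<And>i j. has_weak_deriv \<Omega> [i, j] u (H i j)"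
      "AE x in lebesgue_on \<Omega>. - (\<Sum>i\<in>UNIV. \<Sum>j\<in>UNIV. A x $ i $ j * H i j x) = lam * f (u x)"
    using solution unfolding strong_solution_def by blast
  have "\<exists>g. g \<in> Lp_loc CARD('n) \<Omega> \<and> has_weak_deriv \<Omega> [i, j] u g" for i j
  proof -
    have "\<forall>is. length is \<le> 2 \<longrightarrow> (\<exists>g\<in>Lp_loc CARD('n) \<Omega>. has_weak_deriv \<Omega> is u g)"
      using solution unfolding strong_solution_def Wkp_loc_def by blast
    from this[rule_format, of "[i, j]"] show ?thesis by auto
  qed
  then obtain g where g: "\<And>i j. g i j \<in> Lp_loc CARD('n) \<Omega>" "\<And>i j. has_weak_deriv \<Omega> [i, j] u (g i j)"
    by metis
  have "continuous_on \<Omega> (\<lambda>x. lam * f (u x))"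
    by (intro continuous_intros continuous_on_compose2[OF continuous_f cu]) auto
  then have "continuous (at x0) (\<lambda>x. lam * f (u x))"
    using open_domain x0 by (simp add: continuous_on_eq_continuous_at)
  then obtain d where d: "0 < d" "\<And>x. dist x x0 < d \<Longrightarrow> dist (lam * f (u x)) (lam * f (u x0)) < c / 2"
    using \<open>0 < c\<close> unfolding continuous_at_eps_delta by (meson half_gt_zero)
  obtain R' where R': "0 < R'" "cball x0 R' \<subseteq> \<Omega>" using open_domain x0 open_contains_cball by blast
  define R where "R = min (R' / 2) (min (r / 2) (d / 2))"
  have R: "0 < R" "R < R'" "R < r" "R < d" using R' \<open>0 < r\<close> d(1) by (auto simp: R_def min_def)
  have sub: "cball x0 R \<subseteq> \<Omega>" using R R' by auto
  define Q :: "real^'n^'n" where "Q = (\<chi> i j. if i = k \<and> j = k then q else 0)"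
  have Qv: "y \<bullet> (Q *v y) = q * (y $ k)\<^sup>2" for y
  proof -
    have "Q *v y = axis k (q * y $ k)"
      by (auto simp: Q_def matrix_vector_mult_def axis_def vec_eq_iff if_distrib[where f = "\<lambda>a. a * _"] cong: if_cong)
    then show ?thesis by (simp add: inner_axis power2_eq_square)
  qed
  have QA: "(\<Sum>i\<in>UNIV. \<Sum>j\<in>UNIV. B $ i $ j * Q $ i $ j) = B $ k $ k * q" for B :: "real^'n^'n"
  proof -
    have "(\<Sum>i\<in>UNIV. \<Sum>j\<in>UNIV. B $ i $ j * Q $ i $ j) = (\<Sum>i\<in>UNIV. \<Sum>j\<in>UNIV. if j = k then (if i = k then B $ k $ k * q else 0) else 0)"
      by (intro sum.cong refl) (auto simp: Q_def)
    then show ?thesis by simp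
  qed
  show False
  proof (rule no_contact[of "c / 2" R x0 \<Omega> u \<Lambda> A g Q "axis k b"])
    show "u x \<le> u x0 + axis k b \<bullet> (x - x0) + (x - x0) \<bullet> (Q *v (x - x0)) / 2" if "x \<in> cball x0 R" for x
      using touch[of x] that R unfolding Qv by (simp add: inner_axis')
    have ae1: "AE x in lborel. x \<in> \<Omega> \<longrightarrow> - (\<Sum>i\<in>UNIV. \<Sum>j\<in>UNIV. A x $ i $ j * H i j x) = lam * f (u x)"
    proof -
      have "\<Omega> \<in> sets lebesgue" using open_domain by simp
      then have "AE x in lebesgue. x \<in> \<Omega> \<longrightarrow> - (\<Sum>i\<in>UNIV. \<Sum>j\<in>UNIV. A x $ i $ j * H i j x) = lam * f (u x)"
        using H(2) by (simp add: AE_restrict_space_iff)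
      then show ?thesis by (simp add: AE_completion_iff)
    qed
    have "AE x in lborel. x \<in> cball x0 R \<longrightarrow> g i j x = H i j x" for i j
      by (rule weak_deriv_unique_locally[OF g(2) H(1) R'(2) R(1,2)])
    note aeij = this
    have ae2: "AE x in lborel. \<forall>i\<in>UNIV. \<forall>j\<in>UNIV. x \<in> cball x0 R \<longrightarrow> g i j x = H i j x"
      by (intro AE_finite_allI finite aeij)
    from ae1 ae2 show "AE x in lborel. x \<in> cball x0 R \<longrightarrow>
        (\<Sum>i\<in>UNIV. \<Sum>j\<in>UNIV. A x $ i $ j * Q $ i $ j) + c / 2 \<le> (\<Sum>i\<in>UNIV. \<Sum>j\<in>UNIV. A x $ i $ j * g i j x)"
    proof eventually_elim
      case (elim x)
      show ?case
      proof
        assume x: "x \<in> cball x0 R"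
        then have x\<Omega>: "x \<in> \<Omega>" using sub by auto
        have "(\<Sum>i\<in>UNIV. \<Sum>j\<in>UNIV. A x $ i $ j * g i j x) = (\<Sum>i\<in>UNIV. \<Sum>j\<in>UNIV. A x $ i $ j * H i j x)"
          using elim(2) x by simp
        also have "\<dots> = - (lam * f (u x))" using elim(1) x\<Omega> by simp
        finally have e: "(\<Sum>i\<in>UNIV. \<Sum>j\<in>UNIV. A x $ i $ j * g i j x) = - (lam * f (u x))" .
        have "dist (lam * f (u x)) (lam * f (u x0)) < c / 2"
          using x R by (intro d(2)) (auto simp: dist_commute)
        then have "lam * f (u x) < lam * f (u x0) + c / 2" unfolding dist_real_def by linarith
        then show "(\<Sum>i\<in>UNIV. \<Sum>j\<in>UNIV. A x $ i $ j * Q $ i $ j) + c / 2 \<le> (\<Sum>i\<in>UNIV. \<Sum>j\<in>UNIV. A x $ i $ j * g i j x)"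
          using gap[OF x\<Omega>] unfolding e QA by simp
      qed
    qed
    show "Q $ i $ j = Q $ j $ i" for i j by (simp add: Q_def)
  qed (use \<open>0 < c\<close> R sub cu elliptic \<Lambda>_pos g in auto)
qed

end

section \<open>Comparison with a one-dimensional profile\<close>

lemma ge_near_critical_point:
  fixes \<psi> \<psi>' :: "real \<Rightarrow> real"
  assumes "0 < d" and \<psi>: "\<And>t. \<bar>t\<bar> < d \<Longrightarrow> (\<psi> has_real_derivative \<psi>' t) (at t)"
    and c: "(\<psi>' has_real_derivative c) (at 0)" and "\<psi>' 0 = 0" "0 < c"
  shows "\<exists>e>0. \<forall>h. \<bar>h\<bar> < e \<longrightarrow> \<psi> 0 \<le> \<psi> h"
proof -
  obtain e1 where e1: "0 < e1" "\<And>h. 0 < h \<Longrightarrow> h < e1 \<Longrightarrow> 0 < \<psi>' h"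
    using DERIV_pos_inc_right[OF c \<open>0 < c\<close>] \<open>\<psi>' 0 = 0\<close> by auto
  obtain e2 where e2: "0 < e2" "\<And>h. 0 < h \<Longrightarrow> h < e2 \<Longrightarrow> \<psi>' (- h) < 0"
    using DERIV_pos_inc_left[OF c \<open>0 < c\<close>] \<open>\<psi>' 0 = 0\<close> by auto
  define e where "e = min d (min e1 e2)"
  have "\<psi> 0 \<le> \<psi> h" if h: "\<bar>h\<bar> < e" for h
  proof -
    consider "h = 0" | "0 < h" | "h < 0" by linarith
    then show ?thesis
    proof cases
      case 2
      obtain z where z: "0 < z" "z < h" "\<psi> h - \<psi> 0 = (h - 0) * \<psi>' z"
        using MVT2[of 0 h \<psi> \<psi>'] 2 h \<psi> by (force simp: e_def)
      have "0 < \<psi>' z" using z h by (intro e1(2)) (auto simp: e_def)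
      then have "0 < (h - 0) * \<psi>' z" using 2 by simp
      then show ?thesis using z(3) by linarith
    next
      case 3
      obtain z where z: "h < z" "z < 0" "\<psi> 0 - \<psi> h = (0 - h) * \<psi>' z"
        using MVT2[of h 0 \<psi> \<psi>'] 3 h \<psi> by (force simp: e_def)
      have "\<psi>' (- (- z)) < 0" using z h by (intro e2(2)) (auto simp: e_def)
      then have "(0 - h) * \<psi>' z < 0" using 3 by (simp add: mult_neg_neg)
      then show ?thesis using z(3) by linarith
    qed simp
  qed
  then show ?thesis using e1(1) e2(1) \<open>0 < d\<close> by (intro exI[of _ e]) (auto simp: e_def)
qed

text \<open>The number \<open>w\<close> bounds the width of the domain in direction \<open>k\<close>, and \<open>u x0\<close> is the maximum of \<open>u\<close>.\<close>

locale solution_with_maximum = dirichlet_solution \<Omega> A \<Lambda> f lam u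
  for \<Omega> :: "(real^'n) set" and A \<Lambda> f lam u +
  fixes k :: 'n and w :: real and x0 :: "real^'n"
  assumes bounded_domain: "bounded \<Omega>" and lam_pos: "0 < lam"
    and width: "\<And>x y. x \<in> closure \<Omega> \<Longrightarrow> y \<in> closure \<Omega> \<Longrightarrow> x $ k - y $ k \<le> w"
    and x0: "x0 \<in> closure \<Omega>" and max_pos: "0 < u x0"
    and max: "\<And>x. x \<in> closure \<Omega> \<Longrightarrow> u x \<le> u x0"
begin

text \<open>\<open>G s\<close> is the time at which the profile with energy \<open>E\<close> that starts at level \<open>a\<close> reaches the level \<open>s\<close>,
  so \<open>u \<le> \<psi> (x $ k + t)\<close> means \<open>G (u x) - x $ k \<le> t\<close>. Maximizing \<open>G (max (u x) a) - x $ k\<close> thus finds the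
  last translate of the profile lying above \<open>u\<close>, without solving the differential equation. If the claim
  failed, the maximum would be attained where \<open>u > a\<close>, hence inside the domain; there the second-order
  Taylor polynomial of the profile, with \<open>\<psi>''\<close> raised by \<open>\<eta>/2\<close>, touches \<open>u\<close> from above and is still a strict
  supersolution. The level \<open>M\<close> beyond the maximum of \<open>u\<close> leaves room for this polynomial.\<close>

lemma travel_time_le_width:
  assumes a: "0 \<le> a" "a \<le> u x0" and M: "u x0 < M" and "0 < \<eta>"
    and \<Phi>: "\<And>s. a < s \<Longrightarrow> s < M \<Longrightarrow> (\<Phi> has_real_derivative
          (\<Lambda> * lam * (max (f s) 0 - 1 / \<Lambda>\<^sup>2 * max (- f s) 0) + \<eta>)) (at s)"
    and c\<Phi>: "continuous_on {a..M} \<Phi>" and E: "\<And>s. s \<in> {a..M} \<Longrightarrow> \<Phi> s < E"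
  shows "integral {a..u x0} (\<lambda>s. 1 / sqrt (2 * (E - \<Phi> s))) \<le> w"
proof (rule ccontr)
  assume contra: "\<not> ?thesis"
  define b where "b s = 2 * (E - \<Phi> s)" for s
  define \<kappa> where "\<kappa> s = 1 / sqrt (b s)" for s
  have b0: "0 < b s" if "s \<in> {a..M}" for s using E[OF that] by (simp add: b_def)
  have cb: "continuous_on {a..M} b" unfolding b_def by (intro continuous_intros c\<Phi>)
  have c\<kappa>: "continuous_on {a..M} \<kappa>"
    unfolding \<kappa>_def using b0 by (intro continuous_intros cb) (metis less_irrefl real_sqrt_eq_zero_cancel_iff)
  have \<kappa>0: "0 < \<kappa> s" if "s \<in> {a..M}" for s using b0[OF that] by (simp add: \<kappa>_def)
  define G where "G s = integral {a..s} \<kappa>" for s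
  have Gd: "(G has_real_derivative \<kappa> s) (at s)" if "a < s" "s < M" for s
  proof -
    have "(G has_real_derivative \<kappa> s) (at s within {a..M})"
      unfolding G_def using that by (intro integral_has_real_derivative c\<kappa>) auto
    then show ?thesis using that by (simp add: at_within_Icc_at)
  qed
  have cG: "continuous_on {a..M} G"
    unfolding G_def by (intro indefinite_integral_continuous_1 integrable_continuous_real c\<kappa>)
  have Gmono: "G s < G t" if "a \<le> s" "s < t" "t \<le> M" for s t
  proof (rule DERIV_pos_imp_increasing_open[OF \<open>s < t\<close>])
    show "\<exists>y. (G has_real_derivative y) (at z) \<and> 0 < y" if "s < z" "z < t" for z
      using Gd[of z] \<kappa>0[of z] that \<open>a \<le> s\<close> \<open>t \<le> M\<close> by (intro exI[of _ "\<kappa> z"]) auto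
    show "continuous_on {s..t} G" using that by (intro continuous_on_subset[OF cG]) auto
  qed
  define U where "U x = max (u x) a" for x
  have cu: "continuous_on (closure \<Omega>) u" using solution by (simp add: strong_solution_def)
  have aM: "a < M" using a(2) M by linarith
  have uM: "u y < M" if "y \<in> closure \<Omega>" for y using max[OF that] M by linarith
  have U: "U y \<in> {a..M}" if "y \<in> closure \<Omega>" for y using uM[OF that] aM by (auto simp: U_def)
  have "continuous_on (closure \<Omega>) (\<lambda>y. G (U y) - y $ k)"
  proof -
    have "continuous_on (closure \<Omega>) U"
      unfolding U_def by (intro continuous_on_max cu continuous_on_const)
    moreover have "U ` closure \<Omega> \<subseteq> {a..M}" using U by blast
    ultimately have "continuous_on (closure \<Omega>) (\<lambda>y. G (U y))"
      by (rule continuous_on_compose2[OF cG])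
    moreover have "continuous_on (closure \<Omega>) (\<lambda>y. y $ k)" by (intro continuous_intros)
    ultimately show ?thesis by (rule continuous_on_diff)
  qed
  note cv = this
  have comp: "compact (closure \<Omega>)" using bounded_domain by simp
  have "closure \<Omega> \<noteq> {}" using x0 by (metis empty_iff)
  from continuous_attains_sup[OF comp this cv] obtain z0 where z0: "z0 \<in> closure \<Omega>"
      "\<And>y. y \<in> closure \<Omega> \<Longrightarrow> G (U y) - y $ k \<le> G (U z0) - z0 $ k"
    by blast
  have Ga: "G a = 0" by (simp add: G_def)
  have Gx: "w < G (U x0)" using contra a(2) by (simp add: G_def U_def max_def \<kappa>_def[abs_def] b_def)
  have s0: "a < u z0"
  proof (rule ccontr)
    assume "\<not> a < u z0"
    then have "G (U z0) = 0" by (simp add: U_def max_def Ga)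
    then show False using z0(2)[OF x0] Gx width[OF x0 z0(1)] by linarith
  qed
  have z0\<Omega>: "z0 \<in> \<Omega>"
  proof (rule ccontr)
    assume "z0 \<notin> \<Omega>"
    then have "z0 \<in> frontier \<Omega>" using z0(1) open_domain by (simp add: frontier_def interior_open)
    then have "u z0 = 0" using solution by (simp add: strong_solution_def)
    then show False using s0 a(1) by simp
  qed
  define s0 where "s0 = u z0"
  have s0: "a < s0" "s0 < M" using s0 uM[OF z0(1)] by (auto simp: s0_def)
  have U0: "U z0 = s0" using s0 by (simp add: U_def s0_def)
  define \<phi> where "\<phi> = \<Lambda> * lam * (max (f s0) 0 - 1 / \<Lambda>\<^sup>2 * max (- f s0) 0)"
  \<comment> \<open>\<open>\<psi>'' = - \<Phi>' = - \<phi> - \<eta>\<close> at the contact level, and \<open>q\<close> exceeds it by \<open>\<eta>/2\<close>\<close>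
  define q where "q = - \<phi> - \<eta> / 2"
  define \<beta> where "\<beta> = sqrt (b s0)"
  have bs0: "0 < b s0" using s0 by (intro b0) auto
  have \<beta>0: "0 < \<beta>" using bs0 by (simp add: \<beta>_def)
  have \<kappa>s0: "\<kappa> s0 = 1 / \<beta>" by (simp add: \<kappa>_def \<beta>_def)
  have b\<beta>: "b s0 = \<beta>\<^sup>2" using bs0 by (simp add: \<beta>_def)
  have \<kappa>d: "(\<kappa> has_real_derivative (\<phi> + \<eta>) / \<beta> ^ 3) (at s0)"
  proof -
    have "(b has_real_derivative - (2 * (\<phi> + \<eta>))) (at s0)"
      unfolding b_def using \<Phi>[OF s0] by (auto intro!: derivative_eq_intros simp: \<phi>_def)
    then have 1: "((\<lambda>s. sqrt (b s)) has_real_derivative (- (2 * (\<phi> + \<eta>)) * (inverse (sqrt (b s0)) / 2))) (at s0)"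
      using DERIV_chain2[where f = sqrt and g = b, OF DERIV_real_sqrt[OF bs0]] by (simp only: mult.commute)
    have "(\<kappa> has_real_derivative (0 * sqrt (b s0) - 1 * (- (2 * (\<phi> + \<eta>)) * (inverse (sqrt (b s0)) / 2))) / (sqrt (b s0) * sqrt (b s0))) (at s0)"
      unfolding \<kappa>_def using bs0 by (intro DERIV_divide DERIV_const 1) auto
    moreover have "(0 * sqrt (b s0) - 1 * (- (2 * (\<phi> + \<eta>)) * (inverse (sqrt (b s0)) / 2))) / (sqrt (b s0) * sqrt (b s0)) = (\<phi> + \<eta>) / \<beta> ^ 3"
      unfolding \<beta>_def[symmetric] using \<beta>0 by (simp add: field_simps power3_eq_cube)
    ultimately show ?thesis by simp
  qed
  define P where "P h = s0 + \<beta> * h + q * h\<^sup>2 / 2" for h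
  have P0: "P 0 = s0" by (simp add: P_def)
  have Pd: "(P has_real_derivative (\<beta> + q * h)) (at h)" for h
    unfolding P_def by (auto intro!: derivative_eq_intros)
  have "isCont P 0" using Pd DERIV_isCont by blast
  then obtain d where d: "0 < d" "\<And>h. \<bar>h\<bar> < d \<Longrightarrow> \<bar>P h - s0\<bar> < min (s0 - a) (M - s0)"
    using s0 unfolding continuous_at_eps_delta P0 dist_real_def
    by (metis diff_zero min_less_iff_conj diff_gt_0_iff_gt)
  have Pin: "a < P h" "P h < M" if "\<bar>h\<bar> < d" for h using d(2)[OF that] by linarith+
  \<comment> \<open>the polynomial lies above the profile: \<open>G (P h) - h\<close> has vanishing first and positive second derivative
    at \<open>0\<close>\<close>
  have "\<exists>e>0. \<forall>h. \<bar>h\<bar> < e \<longrightarrow> G (P 0) - 0 \<le> G (P h) - h"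
  proof (rule ge_near_critical_point[OF d(1)])
    show "((\<lambda>h. G (P h) - h) has_real_derivative (\<kappa> (P h) * (\<beta> + q * h) - 1)) (at h)" if "\<bar>h\<bar> < d" for h
      by (intro DERIV_diff DERIV_ident DERIV_chain2[OF Gd Pd] Pin that)
    have "((\<lambda>h. \<kappa> (P h) * (\<beta> + q * h) - 1) has_real_derivative
        ((\<phi> + \<eta>) / \<beta> ^ 3 * (\<beta> + q * 0) * (\<beta> + q * 0) + q * \<kappa> (P 0) - 0)) (at 0)"
    proof (intro DERIV_diff DERIV_const DERIV_mult)
      show "((\<lambda>h. \<kappa> (P h)) has_real_derivative (\<phi> + \<eta>) / \<beta> ^ 3 * (\<beta> + q * 0)) (at 0)"
        by (rule DERIV_chain2[OF _ Pd]) (simp add: P0 \<kappa>d)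
      show "((\<lambda>h. \<beta> + q * h) has_real_derivative q) (at 0)" by (auto intro!: derivative_eq_intros)
    qed
    moreover have "(\<phi> + \<eta>) / \<beta> ^ 3 * (\<beta> + q * 0) * (\<beta> + q * 0) + q * \<kappa> (P 0) - 0 = \<eta> / (2 * \<beta>)"
      using \<beta>0 by (simp add: P0 \<kappa>s0 q_def field_simps power3_eq_cube)
    ultimately show "((\<lambda>h. \<kappa> (P h) * (\<beta> + q * h) - 1) has_real_derivative \<eta> / (2 * \<beta>)) (at 0)" by simp
    show "0 < \<eta> / (2 * \<beta>)" using \<open>0 < \<eta>\<close> \<beta>0 by simp
    show "\<kappa> (P 0) * (\<beta> + q * 0) - 1 = 0" using \<beta>0 by (simp add: P0 \<kappa>s0)
  qed
  then obtain e where e: "0 < e" "\<And>h. \<bar>h\<bar> < e \<Longrightarrow> G s0 \<le> G (P h) - h" by (auto simp: P0)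
  obtain r where r: "0 < r" "ball z0 r \<subseteq> \<Omega>" using open_domain z0\<Omega> open_contains_ball by blast
  show False
  proof (rule not_touched_from_above[OF z0\<Omega>, of "min r (min d e)" "\<eta> / (2 * \<Lambda>)" \<beta> k q])
    fix y assume y: "y \<in> ball z0 (min r (min d e))"
    then have "y \<in> \<Omega>" using r(2) by auto
    then have yc: "y \<in> closure \<Omega>" by (rule subsetD[OF closure_subset])
    define h where "h = (y - z0) $ k"
    have "\<bar>h\<bar> \<le> norm (y - z0)" unfolding h_def by (rule component_le_norm_cart)
    then have h: "\<bar>h\<bar> < d" "\<bar>h\<bar> < e" using y by (auto simp: dist_norm norm_minus_commute)
    have "G (U y) \<le> G s0 + h" using z0(2)[OF yc] by (simp add: U0 h_def)
    also have "\<dots> \<le> G (P h)" using e(2)[OF h(2)] by linarith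
    finally have "U y \<le> P h"
      using Gmono[of "P h" "U y"] Pin[OF h(1)] U[OF yc] by (meson atLeastAtMost_iff less_imp_le not_le)
    then show "u y \<le> u z0 + \<beta> * (y - z0) $ k + q * ((y - z0) $ k)\<^sup>2 / 2"
      by (simp add: U_def P_def h_def s0_def)
  next
    fix y assume y: "y \<in> \<Omega>"
    define \<alpha> where "\<alpha> = A y $ k $ k"
    have \<alpha>: "1 \<le> \<alpha> * \<Lambda>" "\<alpha> / \<Lambda> \<le> 1"
      using elliptic_diagonal_bounds[OF elliptic y, of k] \<Lambda>_pos by (auto simp: \<alpha>_def field_simps)
    \<comment> \<open>the weight \<open>1/\<Lambda>\<^sup>2\<close> is exactly what makes both signs of \<open>f\<close> work: \<open>\<alpha> \<Lambda> \<ge> 1\<close> handles \<open>fp\<close> and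
      \<open>\<alpha> / \<Lambda> \<le> 1\<close> handles \<open>fm\<close>\<close>
    define fp fm where "fp = max (f s0) 0" and "fm = max (- f s0) 0"
    have fpm: "0 \<le> fp" "0 \<le> fm" "f s0 = fp - fm" by (auto simp: fp_def fm_def)
    define X Y Z where "X = (\<alpha> * \<Lambda>) * (lam * fp)" and "Y = (\<alpha> / \<Lambda>) * (lam * fm)"
      and "Z = (\<alpha> * \<Lambda>) * (\<eta> / (2 * \<Lambda>))"
    have "\<alpha> * q = - X + Y - Z"
      using \<Lambda>_pos by (simp add: X_def Y_def Z_def q_def \<phi>_def fp_def fm_def field_simps power2_eq_square)
    moreover have "1 * (lam * fp) \<le> X" "Y \<le> 1 * (lam * fm)" "1 * (\<eta> / (2 * \<Lambda>)) \<le> Z"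
      unfolding X_def Y_def Z_def
      using \<alpha> fpm lam_pos \<open>0 < \<eta>\<close> \<Lambda>_pos by (intro mult_right_mono; simp)+
    moreover have "lam * f (u z0) = lam * fp - lam * fm" unfolding s0_def[symmetric] fpm(3) by (simp add: algebra_simps)
    ultimately have "\<alpha> * q + \<eta> / (2 * \<Lambda>) \<le> - (lam * f (u z0))" by linarith
    then show "A y $ k $ k * q + \<eta> / (2 * \<Lambda>) \<le> - lam * f (u z0)" by (simp add: \<alpha>_def)
  qed (use r(1) d(1) e(1) \<open>0 < \<eta>\<close> \<Lambda>_pos in auto)
qed

end

section \<open>Two bounds on the travel time\<close>

lemma F_weighted_0 [simp]: "F_weighted \<Lambda> f 0 = 0"
  by (simp add: F_weighted_def)

lemma F_weighted_continuous:
  assumes f: "continuous_on UNIV f"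
  shows "continuous_on {0..b} (F_weighted \<Lambda> f)"
proof -
  have *: "continuous_on UNIV (\<lambda>t. max (f t) 0)" "continuous_on UNIV (\<lambda>t. max (- f t) 0)"
    by (intro continuous_intros f)+
  show ?thesis
    unfolding F_weighted_def
    by (intro continuous_intros indefinite_integral_continuous_1 integrable_continuous_real
        *[THEN continuous_on_subset]) auto
qed

lemma F_weighted_derivative:
  assumes f: "continuous_on UNIV f" and "0 < s"
  shows "(F_weighted \<Lambda> f has_real_derivative (max (f s) 0 - 1 / \<Lambda>\<^sup>2 * max (- f s) 0)) (at s)"
proof -
  have *: "continuous_on UNIV (\<lambda>t. max (f t) 0)" "continuous_on UNIV (\<lambda>t. max (- f t) 0)"
    by (intro continuous_intros f)+
  have 1: "((\<lambda>s. integral {0..s} g) has_real_derivative g s) (at s)" if "continuous_on UNIV g" for g :: "real \<Rightarrow> real"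
  proof -
    have "((\<lambda>s. integral {0..s} g) has_real_derivative g s) (at s within {0..s + 1})"
      using \<open>0 < s\<close> by (intro integral_has_real_derivative continuous_on_subset[OF that]) auto
    then show ?thesis using \<open>0 < s\<close> by (simp add: at_within_Icc_at)
  qed
  show ?thesis
    unfolding F_weighted_def by (intro DERIV_diff DERIV_cmult 1 *)
qed

context solution_with_maximum
begin

abbreviation "F \<equiv> F_weighted \<Lambda> f"

text \<open>The profile of \<open>travel_time_le_width\<close> for \<open>\<Phi> s = \<Lambda> \<lambda> F s + \<eta> s\<close>, on levels up to twice the maximum,
  with the time estimated from below by the integral of a simpler \<open>g\<close>.\<close>

lemma travel_time_bound:
  assumes a: "0 \<le> a" "a \<le> u x0" and "0 < \<eta>"
    and E: "\<And>s. s \<in> {a..2 * u x0} \<Longrightarrow> \<Lambda> * lam * F s + \<eta> * s < E"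
    and g: "continuous_on {a..u x0} g"
      "\<And>s. s \<in> {a..u x0} \<Longrightarrow> g s * sqrt (2 * (E - (\<Lambda> * lam * F s + \<eta> * s))) \<le> 1"
  shows "integral {a..u x0} g \<le> w"
proof -
  let ?\<Phi> = "\<lambda>s. \<Lambda> * lam * F s + \<eta> * s"
  have cF: "continuous_on {a..b} (F)" for b
    by (rule continuous_on_subset[OF F_weighted_continuous[OF continuous_f, of b]]) (use a in auto)
  have c\<Phi>: "continuous_on {a..2 * u x0} ?\<Phi>" by (intro continuous_intros cF)
  have "integral {a..u x0} g \<le> integral {a..u x0} (\<lambda>s. 1 / sqrt (2 * (E - ?\<Phi> s)))"
  proof (rule integral_le)
    show "g integrable_on {a..u x0}" by (rule integrable_continuous_real[OF g(1)])
    have "sqrt (2 * (E - ?\<Phi> s)) \<noteq> 0" if "s \<in> {a..u x0}" for s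
      using E[of s] that max_pos by auto
    moreover have "continuous_on {a..u x0} (\<lambda>s. sqrt (2 * (E - ?\<Phi> s)))"
      by (intro continuous_intros cF)
    ultimately show "(\<lambda>s. 1 / sqrt (2 * (E - ?\<Phi> s))) integrable_on {a..u x0}"
      by (intro integrable_continuous_real continuous_on_divide continuous_on_const) auto
    fix s assume s: "s \<in> {a..u x0}"
    then have "0 < sqrt (2 * (E - ?\<Phi> s))" using E[of s] max_pos by auto
    then show "g s \<le> 1 / sqrt (2 * (E - ?\<Phi> s))" using g(2)[OF s] by (simp add: pos_le_divide_eq)
  qed
  also have "\<dots> \<le> w"
  proof (rule travel_time_le_width[OF a _ \<open>0 < \<eta>\<close> _ c\<Phi> E])
    show "u x0 < 2 * u x0" using max_pos by linarith
    show "(?\<Phi> has_real_derivative \<Lambda> * lam * (max (f s) 0 - 1 / \<Lambda>\<^sup>2 * max (- f s) 0) + \<eta>) (at s)"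
      if "a < s" for s
    proof -
      have "((\<lambda>s. \<eta> * s) has_real_derivative \<eta>) (at s)" by (auto intro!: derivative_eq_intros)
      then show ?thesis using that a by (intro DERIV_add DERIV_cmult F_weighted_derivative[OF continuous_f]) auto
    qed
  qed auto
  finally show ?thesis .
qed

text \<open>With \<open>p = \<Lambda> \<lambda> K\<close> and \<open>\<eta> = p M\<close>, the potential \<open>\<Phi>\<close> stays between \<open>- p M\<^sup>2\<close> and \<open>3 p M\<^sup>2\<close>. The energy
  \<open>4 p M\<^sup>2\<close> is therefore admissible, and the speed of the profile is at most \<open>sqrt (10 p) M\<close>.\<close>

lemma lambda_lower_bound:
  assumes "0 < K" and bnd: "\<And>s. s \<in> {0..2 * u x0} \<Longrightarrow> \<bar>F s\<bar> \<le> K * (u x0)\<^sup>2"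
  shows "1 \<le> 10 * \<Lambda> * K * w\<^sup>2 * lam"
proof -
  define M where "M = u x0"
  have M: "0 < M" using max_pos by (simp add: M_def)
  define p where "p = \<Lambda> * lam * K"
  have p: "0 < p" using \<Lambda>_pos lam_pos \<open>0 < K\<close> by (simp add: p_def)
  define \<eta> where "\<eta> = p * M"
  have \<eta>: "0 < \<eta>" using p M by (simp add: \<eta>_def)
  have \<Phi>: "- (p * M\<^sup>2) \<le> \<Lambda> * lam * F s + \<eta> * s" "\<Lambda> * lam * F s + \<eta> * s \<le> 3 * (p * M\<^sup>2)"
    if s: "s \<in> {0..2 * M}" for s
  proof -
    have "\<bar>\<Lambda> * lam * F s\<bar> \<le> \<Lambda> * lam * (K * M\<^sup>2)"
      using bnd[of s] s \<Lambda>_pos lam_pos by (simp add: abs_mult M_def mult_left_mono)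
    then have "\<bar>\<Lambda> * lam * F s\<bar> \<le> p * M\<^sup>2" by (simp add: p_def)
    moreover have "0 \<le> \<eta> * s" using \<eta> s by simp
    moreover have "\<eta> * s \<le> 2 * (p * M\<^sup>2)"
      using mult_left_mono[of s "2 * M" \<eta>] s \<eta> by (simp add: \<eta>_def power2_eq_square)
    ultimately show "- (p * M\<^sup>2) \<le> \<Lambda> * lam * F s + \<eta> * s"
      "\<Lambda> * lam * F s + \<eta> * s \<le> 3 * (p * M\<^sup>2)" by linarith+
  qed
  have pM: "0 < p * M\<^sup>2" using p M by simp
  define c where "c = 1 / (sqrt (10 * p) * M)"
  have sp: "0 < sqrt (10 * p)" using p by simp
  have "integral {0..u x0} (\<lambda>_. c) \<le> w"
  proof (rule travel_time_bound[OF _ _ \<eta>, where E = "4 * (p * M\<^sup>2)"])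
    fix s assume s: "s \<in> {0..u x0}"
    then have sM: "s \<in> {0..2 * M}" using M by (auto simp: M_def)
    have *: "2 * (4 * X - Y) \<le> 10 * X" if "- X \<le> Y" for X Y :: real using that by argo
    have "sqrt (2 * (4 * (p * M\<^sup>2) - (\<Lambda> * lam * F s + \<eta> * s))) \<le> sqrt (10 * (p * M\<^sup>2))"
      by (intro real_sqrt_le_mono *[OF \<Phi>(1)[OF sM]])
    also have "\<dots> = sqrt (10 * p) * M" using M by (simp add: real_sqrt_mult mult.assoc)
    finally show "c * sqrt (2 * (4 * (p * M\<^sup>2) - (\<Lambda> * lam * F s + \<eta> * s))) \<le> 1"
      using sp M by (simp add: c_def divide_le_eq)
  next
    fix s assume "s \<in> {0..2 * u x0}"
    then show "\<Lambda> * lam * F s + \<eta> * s < 4 * (p * M\<^sup>2)"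
      using \<Phi>(2)[of s] pM by (simp add: M_def)
  qed (use M in \<open>auto simp: M_def\<close>)
  then have "M * c \<le> w" using M by (simp add: M_def[symmetric])
  then have "1 / sqrt (10 * p) \<le> w" using M by (simp add: c_def)
  then have "1 \<le> w * sqrt (10 * p)" using sp by (simp add: divide_le_eq)
  then have "1\<^sup>2 \<le> (w * sqrt (10 * p))\<^sup>2" by (intro power_mono) auto
  also have "\<dots> = w\<^sup>2 * (10 * p)" using p by (simp add: power_mult_distrib)
  finally show ?thesis by (simp add: p_def mult_ac)
qed

text \<open>For energies close to \<open>\<Lambda> \<lambda> F a\<close> the speed at level \<open>s\<close> is at most \<open>\<kappa> (s - a) + \<sigma>\<close> with \<open>\<sigma>\<close> as small
  as desired, so the climb from \<open>a\<close> to \<open>M\<close> takes at least \<open>ln (1 + \<kappa> (M - a) / \<sigma>) / \<kappa>\<close>.\<close>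

lemma no_solution_above_maximum_of_F:
  assumes a: "0 \<le> a" "a < u x0" and "0 < C"
    and F1: "\<And>s. s \<in> {a..2 * u x0} \<Longrightarrow> F s \<le> F a"
    and F2: "\<And>s. s \<in> {a..u x0} \<Longrightarrow> F a - F s \<le> C * (s - a)\<^sup>2"
  shows False
proof -
  define M where "M = u x0"
  have M: "0 < M" "a < M" using max_pos a by (auto simp: M_def)
  define \<kappa> where "\<kappa> = sqrt (2 * \<Lambda> * lam * C)"
  have \<kappa>: "0 < \<kappa>" "\<kappa>\<^sup>2 = 2 * \<Lambda> * lam * C" using \<Lambda>_pos lam_pos \<open>0 < C\<close> by (auto simp: \<kappa>_def)
  \<comment> \<open>so small that the logarithmic time exceeds the width \<open>w\<close>; \<open>\<eta>\<close> is the perturbation that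
    corresponds to this \<open>\<sigma>\<close>\<close>
  define \<sigma> where "\<sigma> = \<kappa> * (M - a) / (2 * exp (\<kappa> * w))"
  have \<sigma>: "0 < \<sigma>" using \<kappa>(1) M by (simp add: \<sigma>_def)
  define \<eta> where "\<eta> = \<sigma>\<^sup>2 / (2 * (2 * M + 1))"
  have \<eta>: "0 < \<eta>" "2 * (\<eta> * (2 * M + 1)) = \<sigma>\<^sup>2"
  proof -
    have *: "2 * (x / (2 * m) * m) = x" if "m \<noteq> 0" for x m :: real using that by simp
    show "0 < \<eta>" using \<sigma> M by (simp add: \<eta>_def)
    show "2 * (\<eta> * (2 * M + 1)) = \<sigma>\<^sup>2" unfolding \<eta>_def by (rule *) (use M in simp)
  qed
  define E where "E = \<Lambda> * lam * F a + \<eta> * (2 * M + 1)"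
  define g where "g s = 1 / (\<kappa> * (s - a) + \<sigma>)" for s
  have pos: "0 < \<kappa> * (s - a) + \<sigma>" if "a \<le> s" for s using \<kappa>(1) \<sigma> that by (simp add: add_nonneg_pos)
  have "integral {a..u x0} g \<le> w"
  proof (rule travel_time_bound[OF a(1) _ \<eta>(1), where E = E])
    show "continuous_on {a..u x0} g"
    proof -
      have "\<forall>s\<in>{a..u x0}. \<kappa> * (s - a) + \<sigma> \<noteq> 0" by (metis pos atLeastAtMost_iff less_irrefl)
      moreover have "continuous_on {a..u x0} (\<lambda>s. \<kappa> * (s - a) + \<sigma>)" by (intro continuous_intros)
      ultimately show ?thesis unfolding g_def by (intro continuous_on_divide continuous_on_const)
    qed
    fix s assume s: "s \<in> {a..u x0}"
    have "2 * (E - (\<Lambda> * lam * F s + \<eta> * s))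
       = 2 * (\<Lambda> * lam * (F a - F s)) + 2 * (\<eta> * (2 * M + 1)) - 2 * (\<eta> * s)"
      by (simp add: E_def algebra_simps)
    also have "\<dots> \<le> 2 * (\<Lambda> * lam * (C * (s - a)\<^sup>2)) + \<sigma>\<^sup>2 - 0"
      unfolding \<eta>(2) using F2[OF s] \<Lambda>_pos lam_pos \<eta>(1) s a
      by (intro diff_mono add_mono mult_left_mono order_refl) auto
    also have "\<dots> = (\<kappa> * (s - a))\<^sup>2 + \<sigma>\<^sup>2" by (simp add: power_mult_distrib \<kappa>(2))
    also have "\<dots> \<le> (\<kappa> * (s - a) + \<sigma>)\<^sup>2"
      using \<kappa>(1) \<sigma> s by (simp add: power2_sum)
    finally have "sqrt (2 * (E - (\<Lambda> * lam * F s + \<eta> * s))) \<le> \<kappa> * (s - a) + \<sigma>"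
      using pos[of s] s by (intro real_le_lsqrt) auto
    then show "g s * sqrt (2 * (E - (\<Lambda> * lam * F s + \<eta> * s))) \<le> 1"
      using pos[of s] s by (simp add: g_def divide_le_eq)
  next
    fix s assume s: "s \<in> {a..2 * u x0}"
    have "\<Lambda> * lam * F s \<le> \<Lambda> * lam * F a"
      using F1[OF s] \<Lambda>_pos lam_pos by (intro mult_left_mono) auto
    moreover have "\<eta> * s < \<eta> * (2 * M + 1)" using s \<eta>(1) by (intro mult_strict_left_mono) (auto simp: M_def)
    ultimately show "\<Lambda> * lam * F s + \<eta> * s < E" by (simp add: E_def)
  qed (use a in auto)
  moreover have "(g has_integral (ln (\<kappa> * (M - a) + \<sigma>) / \<kappa> - ln (\<kappa> * (a - a) + \<sigma>) / \<kappa>)) {a..M}"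
  proof (rule fundamental_theorem_of_calculus)
    fix s assume s: "s \<in> {a..M}"
    have "((\<lambda>s. ln (\<kappa> * (s - a) + \<sigma>) / \<kappa>) has_real_derivative g s) (at s within {a..M})"
    proof -
      have p: "0 < \<kappa> * (s - a) + \<sigma>" using pos s by simp
      have "((\<lambda>s. \<kappa> * (s - a) + \<sigma>) has_real_derivative \<kappa>) (at s within {a..M})"
        by (auto intro!: derivative_eq_intros)
      from DERIV_cdivide[OF DERIV_chain2[OF DERIV_ln[OF p] this], of \<kappa>]
      show ?thesis using \<kappa>(1) by (simp add: g_def inverse_eq_divide)
    qed
    then show "((\<lambda>s. ln (\<kappa> * (s - a) + \<sigma>) / \<kappa>) has_vector_derivative g s) (at s within {a..M})"
      by (simp add: has_real_derivative_iff_has_vector_derivative)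
  qed (use M in auto)
  ultimately have "ln (\<kappa> * (M - a) + \<sigma>) / \<kappa> - ln \<sigma> / \<kappa> \<le> w"
    by (auto simp: M_def dest!: integral_unique)
  then have "ln (\<kappa> * (M - a) + \<sigma>) - ln \<sigma> \<le> \<kappa> * w" using \<kappa>(1) by (simp add: diff_divide_distrib[symmetric] divide_le_eq mult.commute)
  then have "ln ((\<kappa> * (M - a) + \<sigma>) / \<sigma>) \<le> \<kappa> * w" using pos[of M] M \<sigma> by (simp add: ln_div)
  then have "exp (ln ((\<kappa> * (M - a) + \<sigma>) / \<sigma>)) \<le> exp (\<kappa> * w)" by simp
  then have "(\<kappa> * (M - a) + \<sigma>) / \<sigma> \<le> exp (\<kappa> * w)" using pos[of M] M \<sigma> by simp
  then have "\<kappa> * (M - a) + \<sigma> \<le> exp (\<kappa> * w) * \<sigma>" using \<sigma> by (simp add: divide_le_eq)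
  also have "exp (\<kappa> * w) * \<sigma> = \<kappa> * (M - a) / 2" by (simp add: \<sigma>_def)
  finally have "\<kappa> * (M - a) / 2 + \<sigma> \<le> 0" by linarith
  moreover have "0 < \<kappa> * (M - a)" using \<kappa>(1) M by simp
  ultimately show False using \<sigma> by linarith
qed

end

section \<open>Sequences of solutions\<close>

text \<open>The maximum is attained inside the domain, and by continuity \<open>u\<close> exceeds every smaller number on a
  nonempty open set.\<close>

lemma Linf_norm_eq_max:
  fixes u :: "real^'n \<Rightarrow> real"
  assumes op: "open \<Omega>" and bd: "bounded \<Omega>" and cu: "continuous_on (closure \<Omega>) u"
    and fr: "\<And>x. x \<in> frontier \<Omega> \<Longrightarrow> u x = 0" and nn: "\<And>x. x \<in> \<Omega> \<Longrightarrow> 0 \<le> u x" and nz: "\<exists>x\<in>\<Omega>. u x \<noteq> 0"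
    and um: "u \<in> borel_measurable (lebesgue_on \<Omega>)"
  shows "\<exists>x0\<in>closure \<Omega>. 0 < u x0 \<and> (\<forall>x\<in>closure \<Omega>. u x \<le> u x0) \<and> Linf_norm \<Omega> u = ereal (u x0)"
proof -
  obtain x1 where x1: "x1 \<in> \<Omega>" "0 < u x1" using nz nn by (metis order_le_less)
  have comp: "compact (closure \<Omega>)" using bd by simp
  have "closure \<Omega> \<noteq> {}" using x1(1) closure_subset by blast
  from continuous_attains_sup[OF comp this cu] obtain x0 where x0: "x0 \<in> closure \<Omega>"
      "\<And>x. x \<in> closure \<Omega> \<Longrightarrow> u x \<le> u x0" by blast
  have pos: "0 < u x0" using x0(2)[of x1] x1 closure_subset by force
  have x0\<Omega>: "x0 \<in> \<Omega>" using fr[of x0] x0(1) op pos by (auto simp: frontier_def interior_open)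
  have \<Omega>s: "\<Omega> \<in> sets lebesgue" using op by simp
  have m: "(\<lambda>x. ereal \<bar>u x\<bar>) \<in> borel_measurable (lebesgue_on \<Omega>)" using um by measurable
  have le: "Linf_norm \<Omega> u \<le> ereal (u x0)"
    unfolding Linf_norm_def
  proof (rule esssup_I[OF m], rule AE_I2)
    fix x assume "x \<in> space (lebesgue_on \<Omega>)"
    then have "x \<in> \<Omega>" by simp
    then show "ereal \<bar>u x\<bar> \<le> ereal (u x0)" using nn[of x] x0(2)[of x] closure_subset by auto
  qed
  moreover have "ereal (u x0) \<le> Linf_norm \<Omega> u"
  proof (rule ccontr)
    assume "\<not> ?thesis"
    then have "Linf_norm \<Omega> u < ereal (u x0)" by simp
    from ereal_dense2[OF this] obtain t where t: "Linf_norm \<Omega> u < ereal t" "ereal t < ereal (u x0)"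
      by blast
    have "AE x in lebesgue_on \<Omega>. ereal \<bar>u x\<bar> \<le> Linf_norm \<Omega> u"
      unfolding Linf_norm_def by (rule esssup_AE)
    then have "AE x in lebesgue_on \<Omega>. u x < t"
      by eventually_elim (use t(1) in \<open>auto dest: order.strict_trans1\<close>)
    then have "AE x in lebesgue. x \<in> \<Omega> \<longrightarrow> u x < t" using \<Omega>s by (simp add: AE_restrict_space_iff)
    then have ae: "AE x in lborel. x \<notin> {x \<in> \<Omega>. t < u x}"
      by (auto simp: AE_completion_iff elim: eventually_mono)
    have "continuous_on \<Omega> u" using cu closure_subset by (rule continuous_on_subset)
    then have "open (\<Omega> \<inter> u -` {t<..})" using op by (rule continuous_open_preimage) simp
    moreover have "\<Omega> \<inter> u -` {t<..} = {x \<in> \<Omega>. t < u x}" by auto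
    ultimately have o: "open {x \<in> \<Omega>. t < u x}" by simp
    then have "{x \<in> \<Omega>. t < u x} \<in> null_sets lborel"
      using ae by (subst AE_iff_null_sets) auto
    then have "negligible {x \<in> \<Omega>. t < u x}"
      by (simp add: negligible_iff_null_sets null_sets_completionI)
    then show False using open_not_negligible[OF o] x0\<Omega> t(2) by auto
  qed
  ultimately have "Linf_norm \<Omega> u = ereal (u x0)" by simp
  then show ?thesis using x0 pos by blast
qed

lemma filterlim_towards:
  assumes "l = 0 \<or> l = \<infinity>" and "\<And>n. 0 < M n" and lim: "(\<lambda>n. ereal (M n)) \<longlonglongrightarrow> l"
  shows "filterlim M (towards l) sequentially"
proof (cases "l = \<infinity>")
  case True
  with lim show ?thesis by (simp add: towards_def tendsto_PInfty_eq_at_top)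
next
  case False
  with assms have "M \<longlonglongrightarrow> 0" by (simp add: zero_ereal_def)
  then show ?thesis
    using False assms(2) by (auto simp: towards_def intro!: tendsto_imp_filterlim_at_right)
qed

lemma eventually_towards_pos:
  assumes "l = 0 \<or> l = \<infinity>"
  shows "eventually (\<lambda>s. 0 < s) (towards l)"
  using assms by (auto simp: towards_def eventually_at_top_dense eventually_at_right_less intro: exI[of _ 0])

text \<open>For \<open>l = \<infinity>\<close> the bound on \<open>F\<close> holds for large arguments only; on the remaining compact interval \<open>F\<close> is
  bounded, hence small compared with \<open>M\<^sup>2\<close> for large \<open>M\<close>.\<close>

lemma eventually_bounded_by_square_of_max:
  assumes l: "l = 0 \<or> l = \<infinity>" and "0 < b" and F0: "F 0 = (0::real)" and cF: "\<And>c. continuous_on {0..c} F"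
    and ev: "eventually (\<lambda>s. \<bar>F s\<bar> \<le> b * s\<^sup>2) (towards l)"
  shows "eventually (\<lambda>M. \<forall>s\<in>{0..2 * M}. \<bar>F s\<bar> \<le> 4 * b * M\<^sup>2) (towards l)"
proof (cases "l = \<infinity>")
  case True
  then obtain S where S: "\<And>s. S \<le> s \<Longrightarrow> \<bar>F s\<bar> \<le> b * s\<^sup>2"
    using ev by (auto simp: towards_def eventually_at_top_linorder)
  have "bounded (F ` {0..S})" by (intro compact_imp_bounded compact_continuous_image cF) auto
  then have "\<exists>B. \<forall>s\<in>{0..S}. \<bar>F s\<bar> \<le> B" by (simp add: bounded_iff)
  then obtain B where B: "\<And>s. s \<in> {0..S} \<Longrightarrow> \<bar>F s\<bar> \<le> B" by blast
  have "\<bar>F s\<bar> \<le> 4 * b * M\<^sup>2" if M: "max 1 (B / b) \<le> M" and s: "s \<in> {0..2 * M}" for M s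
  proof (cases "S \<le> s")
    case True
    have "\<bar>F s\<bar> \<le> b * s\<^sup>2" by (rule S[OF True])
    also have "\<dots> \<le> b * (2 * M)\<^sup>2" using s \<open>0 < b\<close> by (intro mult_left_mono power_mono) auto
    finally show ?thesis by (simp add: power_mult_distrib)
  next
    case False
    then have "\<bar>F s\<bar> \<le> B" using s by (intro B) auto
    also have "B \<le> b * M" using M \<open>0 < b\<close> by (simp add: divide_le_eq mult.commute)
    also have "\<dots> \<le> b * (4 * M\<^sup>2)"
    proof (intro mult_left_mono)
      have "M * 1 \<le> M * M" using M by (intro mult_left_mono) auto
      then show "M \<le> 4 * M\<^sup>2" using M by (simp add: power2_eq_square)
    qed (use \<open>0 < b\<close> in simp)
    finally show ?thesis by (simp add: mult_ac)
  qed
  then have "\<forall>M\<ge>max 1 (B / b). \<forall>s\<in>{0..2 * M}. \<bar>F s\<bar> \<le> 4 * b * M\<^sup>2" by blast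
  then show ?thesis
    unfolding towards_def True if_P[OF refl] eventually_at_top_linorder by (rule exI)
next
  case False
  then obtain d where d: "0 < d" "\<And>s. 0 < s \<Longrightarrow> s < d \<Longrightarrow> \<bar>F s\<bar> \<le> b * s\<^sup>2"
    using ev by (auto simp: towards_def eventually_at_right_field)
  have "\<bar>F s\<bar> \<le> 4 * b * M\<^sup>2" if M: "0 < M" "M < d / 2" and s: "s \<in> {0..2 * M}" for M s
  proof (cases "s = 0")
    case True
    then show ?thesis using F0 \<open>0 < b\<close> by simp
  next
    case False
    then have "\<bar>F s\<bar> \<le> b * s\<^sup>2" using s M by (intro d(2)) auto
    also have "\<dots> \<le> b * (2 * M)\<^sup>2" using s \<open>0 < b\<close> by (intro mult_left_mono power_mono) auto
    finally show ?thesis by (simp add: power_mult_distrib)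
  qed
  then show ?thesis
    using False d(1) by (auto simp: towards_def eventually_at_right_field intro!: exI[of _ "d / 2"])
qed

lemma bifurcation_sequence:
  fixes \<Omega> :: "(real^'n) set" and k :: 'n
  assumes op: "open \<Omega>" and bd: "bounded \<Omega>" and ell: "elliptic_coeffs \<Lambda> \<Omega> A" and "0 < \<Lambda>"
    and f: "continuous_on UNIV f" and l: "l = 0 \<or> l = \<infinity>"
    and width: "\<And>x y. x \<in> closure \<Omega> \<Longrightarrow> y \<in> closure \<Omega> \<Longrightarrow> x $ k - y $ k \<le> w"
    and bif: "bifurcation_point \<Omega> A f l mu"
  obtains lam u x0 where "\<And>n. solution_with_maximum \<Omega> A \<Lambda> f (lam n) (u n) k w (x0 n)"
    "lam \<longlonglongrightarrow> mu" "filterlim (\<lambda>n::nat. u n (x0 n)) (towards l) sequentially"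
proof -
  obtain lam u where s: "\<And>n. 0 < lam n" "\<And>n. u n \<in> borel_measurable (lebesgue_on \<Omega>)"
      "\<And>n x. x \<in> \<Omega> \<Longrightarrow> 0 \<le> u n x" "\<And>n. \<exists>x\<in>\<Omega>. u n x \<noteq> 0" "\<And>n. strong_solution \<Omega> A f (lam n) (u n)"
      and lim: "lam \<longlonglongrightarrow> mu" "(\<lambda>n. Linf_norm \<Omega> (u n)) \<longlonglongrightarrow> l"
    using bif unfolding bifurcation_point_def by blast
  have "\<exists>x0\<in>closure \<Omega>. 0 < u n x0 \<and> (\<forall>x\<in>closure \<Omega>. u n x \<le> u n x0) \<and> Linf_norm \<Omega> (u n) = ereal (u n x0)" for n
    using s(5)[of n] by (intro Linf_norm_eq_max op bd s) (auto simp: strong_solution_def)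
  then obtain x0 where x0: "\<And>n. x0 n \<in> closure \<Omega>" "\<And>n. 0 < u n (x0 n)"
      "\<And>n x. x \<in> closure \<Omega> \<Longrightarrow> u n x \<le> u n (x0 n)" "\<And>n. Linf_norm \<Omega> (u n) = ereal (u n (x0 n))"
    by metis
  have "filterlim (\<lambda>n. u n (x0 n)) (towards l) sequentially"
    using lim(2) x0(2) by (intro filterlim_towards[OF l]) (simp_all add: x0(4))
  moreover have "solution_with_maximum \<Omega> A \<Lambda> f (lam n) (u n) k w (x0 n)" for n
    by unfold_locales (fact op ell f s x0 bd \<open>0 < \<Lambda>\<close> | erule (1) width | erule x0)+
  ultimately show ?thesis using lim(1) by (intro that)
qed

lemma attains_maximum_beyond:
  assumes cF: "\<And>c. continuous_on {0..c} F" and "0 \<le> (a0::real)" and "0 < c"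
    and ev: "eventually (\<lambda>s. F s \<le> - c * s\<^sup>2) at_top"
  shows "\<exists>a\<ge>a0. \<forall>s\<ge>a0. F s \<le> (F a :: real)"
proof -
  obtain S where S: "\<And>s. S \<le> s \<Longrightarrow> F s \<le> - c * s\<^sup>2" using ev by (auto simp: eventually_at_top_linorder)
  define T where "T = max (max S a0) (max 1 (\<bar>F a0\<bar> / c))"
  have "\<exists>a\<in>{a0..T}. \<forall>s\<in>{a0..T}. F s \<le> F a"
    using \<open>0 \<le> a0\<close> by (intro continuous_attains_sup continuous_on_subset[OF cF[of T]]) (auto simp: T_def)
  then obtain a where a: "a \<in> {a0..T}" "\<And>s. s \<in> {a0..T} \<Longrightarrow> F s \<le> F a" by blast
  have "F s \<le> F a" if s: "a0 \<le> s" for s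
  proof (cases "s \<le> T")
    case False
    have T: "S \<le> T" "1 \<le> T" "\<bar>F a0\<bar> / c \<le> T" "a0 \<le> T" by (auto simp: T_def)
    have "F s \<le> - c * s\<^sup>2" using False T by (intro S) linarith
    also have "\<dots> \<le> - c * s"
    proof -
      have "s * 1 \<le> s * s" using False T by (intro mult_left_mono) auto
      then have "c * s \<le> c * s\<^sup>2" using \<open>0 < c\<close> by (intro mult_left_mono) (auto simp: power2_eq_square)
      then show ?thesis by simp
    qed
    also have "\<dots> \<le> - \<bar>F a0\<bar>"
    proof -
      have "\<bar>F a0\<bar> / c \<le> s" using False T by linarith
      then show ?thesis using \<open>0 < c\<close> by (simp add: divide_le_eq mult.commute)
    qed
    also have "\<dots> \<le> F a0" by linarith
    also have "\<dots> \<le> F a" using T by (intro a(2)) auto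
    finally show ?thesis .
  qed (use a(2) s in simp)
  then show ?thesis using a(1) by auto
qed

text \<open>In the interior of the half-line the derivative of \<open>F\<close> vanishes, which for this weighted derivative means
  \<open>f a = 0\<close>; at the endpoint this is the hypothesis on \<open>a0\<close>.\<close>

lemma critical_point_of_F_weighted:
  assumes f: "continuous_on UNIV f" and "0 < a0" "f a0 = 0" "a0 \<le> a" and "1 \<le> \<Lambda>"
    and max: "\<And>s. a0 \<le> s \<Longrightarrow> F_weighted \<Lambda> f s \<le> F_weighted \<Lambda> f a"
  shows "f a = 0"
proof (cases "a = a0")
  case False
  have a: "0 < a" using assms by linarith
  have "max (f a) 0 - 1 / \<Lambda>\<^sup>2 * max (- f a) 0 = 0"
  proof (rule DERIV_local_max[OF F_weighted_derivative[OF f a]])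
    show "0 < a - a0" using False \<open>a0 \<le> a\<close> by simp
    show "\<forall>y. \<bar>a - y\<bar> < a - a0 \<longrightarrow> F_weighted \<Lambda> f y \<le> F_weighted \<Lambda> f a" using max by auto
  qed
  then show ?thesis using \<open>1 \<le> \<Lambda>\<close> by (auto simp: max_def split: if_splits)
qed (use assms in simp)

text \<open>At a zero of \<open>f\<close> the derivative of \<open>F\<close> is at most linear in \<open>s - a\<close> by the Lipschitz condition.\<close>

lemma F_weighted_drop_le:
  assumes f: "local_lipschitz (UNIV :: real set) UNIV (\<lambda>_. f)" and "0 \<le> a" "f a = 0" "1 \<le> \<Lambda>"
  shows "\<exists>C>0. \<forall>s\<in>{a..b}. F_weighted \<Lambda> f a - F_weighted \<Lambda> f s \<le> C * (s - a)\<^sup>2"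
proof -
  let ?F = "F_weighted \<Lambda> f"
  have cf: "continuous_on UNIV f" using local_lipschitz_continuous_on[OF f] by simp
  obtain L where L: "L-lipschitz_on {a..b} f"
  proof (rule local_lipschitz_compact_implies_lipschitz[of "{0::real}" "{a..b}" "\<lambda>_. f"])
    show "local_lipschitz {0::real} {a..b} (\<lambda>_. f)"
      by (rule local_lipschitz_subset[OF f]) auto
  qed auto
  have L0: "0 \<le> L" by (rule lipschitz_on_nonneg[OF L])
  have "?F a - ?F s \<le> (L + 1) * (s - a)\<^sup>2" if s: "s \<in> {a..b}" for s
  proof (cases "s = a")
    case False
    with s have as: "a < s" by simp
    let ?\<phi> = "\<lambda>s. max (f s) 0 - 1 / \<Lambda>\<^sup>2 * max (- f s) 0"
    have "\<exists>l z. a < z \<and> z < s \<and> DERIV (?F) z :> l \<and> ?F s - ?F a = (s - a) * l"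
    proof (rule MVT[OF as])
      show "continuous_on {a..s} (?F)"
        by (rule continuous_on_subset[OF F_weighted_continuous[OF cf, where b = s]]) (use \<open>0 \<le> a\<close> in auto)
      show "?F differentiable (at z)" if "a < z" for z
        using F_weighted_derivative[OF cf, of z \<Lambda>] that \<open>0 \<le> a\<close> by (auto simp: real_differentiable_def)
    qed
    then obtain z y where z: "a < z" "z < s" "DERIV (?F) z :> y"
      "?F s - ?F a = (s - a) * y" by blast
    have y: "y = ?\<phi> z" using DERIV_unique[OF z(3) F_weighted_derivative[OF cf]] z(1) \<open>0 \<le> a\<close> by simp
    have "1 / \<Lambda>\<^sup>2 \<le> 1" using \<open>1 \<le> \<Lambda>\<close> by (simp add: divide_le_eq)
    then have "1 / \<Lambda>\<^sup>2 * max (- f z) 0 \<le> 1 * max (- f z) 0" by (intro mult_right_mono) auto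
    then have "- y \<le> \<bar>f z\<bar>" unfolding y by linarith
    also have "\<bar>f z\<bar> = dist (f z) (f a)" using \<open>f a = 0\<close> by simp
    also have "\<dots> \<le> L * dist z a" using z s by (intro lipschitz_onD[OF L]) auto
    also have "\<dots> \<le> (L + 1) * (s - a)" using z L0 by (intro mult_mono) (auto simp: dist_real_def)
    finally have "(s - a) * (- y) \<le> (s - a) * ((L + 1) * (s - a))" using as by (intro mult_left_mono) auto
    then show ?thesis using z(4) by (simp add: power2_eq_square mult_ac)
  qed simp
  then show ?thesis using L0 by (intro exI[of _ "L + 1"]) auto
qed

theorem theorem4p2:
  fixes \<Omega> :: "(real^'n) set"
    and A :: "real^'n \<Rightarrow> real^'n^'n"
    and \<Lambda> :: real
    and l L_minus L_plus :: ereal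
    and f :: "real \<Rightarrow> real"
    and \<alpha> :: "nat \<Rightarrow> real"
  assumes "open \<Omega>" and "connected \<Omega>" and "\<Omega> \<noteq> {}" and "bounded \<Omega>"
    and "1 \<le> \<Lambda>"
    and "elliptic_coeffs \<Lambda> \<Omega> A"
    and "l = 0 \<or> l = \<infinity>"
    and "local_lipschitz (UNIV :: real set) UNIV (\<lambda>_. f)"
    and "\<And>n. 0 < \<alpha> n" and "(\<lambda>n. ereal (\<alpha> n)) \<longlonglongrightarrow> l" and "\<And>n. f (\<alpha> n) = 0"
    and "L_minus = Liminf (towards l) (\<lambda>s. ereal (F_weighted \<Lambda> f s / s\<^sup>2))"
    and "L_plus = Limsup (towards l) (\<lambda>s. ereal (F_weighted \<Lambda> f s / s\<^sup>2))"
    and "- \<infinity> < L_minus" and "L_minus \<le> L_plus" and "L_plus < \<infinity>"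
  shows "(\<exists>lam_low :: ereal. 0 < lam_low \<and>
            (\<forall>lam :: real. 0 \<le> lam \<and> ereal lam < lam_low \<longrightarrow> \<not> bifurcation_point \<Omega> A f l lam)) \<and>
         (L_plus < 0 \<or> (L_minus = 0 \<and> L_plus = 0) \<longrightarrow>
            (\<forall>lam :: real. 0 \<le> lam \<and> ereal lam < \<infinity> \<longrightarrow> \<not> bifurcation_point \<Omega> A f l lam))"
proof -
  note op = assms(1) and bd = assms(4) and \<Lambda>1 = assms(5) and ell = assms(6) and l = assms(7) and lip = assms(8)
  let ?F = "F_weighted \<Lambda> f"
  have \<Lambda>: "0 < \<Lambda>" using \<Lambda>1 by simp
  have cf: "continuous_on UNIV f" using local_lipschitz_continuous_on[OF lip] by simp
  obtain B where B: "\<And>x. x \<in> closure \<Omega> \<Longrightarrow> norm x \<le> B"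
    using bounded_closure[OF bd] by (auto simp: bounded_iff)
  define w where "w = 2 * \<bar>B\<bar> + 1"
  have w: "0 < w" by (simp add: w_def)
  obtain k :: 'n where True by simp
  have width: "x $ k - y $ k \<le> w" if "x \<in> closure \<Omega>" "y \<in> closure \<Omega>" for x y
    using component_le_norm_cart[of x k] component_le_norm_cart[of y k] B[OF that(1)] B[OF that(2)]
    unfolding w_def by linarith
  have evb: "eventually (\<lambda>s. \<bar>?F s\<bar> \<le> b * s\<^sup>2) (towards l)" if b: "ereal (- b) < L_minus" "L_plus < ereal b" for b
  proof -
    have "eventually (\<lambda>s. ereal (- b) < ereal (?F s / s\<^sup>2)) (towards l)"
      using b(1) unfolding assms(12) by (rule less_LiminfD)
    moreover have "eventually (\<lambda>s. ereal (?F s / s\<^sup>2) < ereal b) (towards l)"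
      using b(2) unfolding assms(13) by (rule Limsup_lessD)
    moreover have "eventually (\<lambda>s. 0 < s) (towards l)" by (rule eventually_towards_pos[OF l])
    ultimately show ?thesis
    proof eventually_elim
      case (elim s)
      then have "- b * s\<^sup>2 < ?F s" "?F s < b * s\<^sup>2" by (auto simp: field_simps)
      then show ?case by (simp add: abs_le_iff)
    qed
  qed
  \<comment> \<open>\<open>40\<close> is the constant \<open>10\<close> of \<open>lambda_lower_bound\<close> with \<open>K = 4 b\<close>; passing to the limit in the
    sequence moves the bound from \<open>lam n\<close> to \<open>mu\<close>\<close>
  have low: "1 \<le> 40 * \<Lambda> * b * w\<^sup>2 * mu"
    if b: "0 < b" "ereal (- b) < L_minus" "L_plus < ereal b" and bif: "bifurcation_point \<Omega> A f l mu" for b mu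
  proof -
    obtain lam u x0 where s: "\<And>n. solution_with_maximum \<Omega> A \<Lambda> f (lam n) (u n) k w (x0 n)"
      "lam \<longlonglongrightarrow> mu" "filterlim (\<lambda>n::nat. u n (x0 n)) (towards l) sequentially"
      using bifurcation_sequence[OF op bd ell \<Lambda> cf l width bif] by blast
    have "eventually (\<lambda>M. \<forall>s\<in>{0..2 * M}. \<bar>?F s\<bar> \<le> 4 * b * M\<^sup>2) (towards l)"
      by (rule eventually_bounded_by_square_of_max[OF l b(1) F_weighted_0 F_weighted_continuous[OF cf] evb[OF b(2,3)]])
    from s(3)[unfolded filterlim_iff, rule_format, OF this]
    have "eventually (\<lambda>n. \<forall>s\<in>{0..2 * u n (x0 n)}. \<bar>?F s\<bar> \<le> 4 * b * (u n (x0 n))\<^sup>2) sequentially" .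
    then have "eventually (\<lambda>n. 1 \<le> 10 * \<Lambda> * (4 * b) * w\<^sup>2 * lam n) sequentially"
    proof eventually_elim
      case (elim n)
      show ?case
        by (rule solution_with_maximum.lambda_lower_bound[OF s(1)]) (use elim b(1) in auto)
    qed
    moreover have "(\<lambda>n. 10 * \<Lambda> * (4 * b) * w\<^sup>2 * lam n) \<longlonglongrightarrow> 10 * \<Lambda> * (4 * b) * w\<^sup>2 * mu"
      by (intro tendsto_intros s(2))
    ultimately have "1 \<le> 10 * \<Lambda> * (4 * b) * w\<^sup>2 * mu"
      by (intro tendsto_lowerbound) auto
    then show ?thesis by (simp add: mult_ac)
  qed
  obtain m p where mp: "L_minus = ereal m" "L_plus = ereal p"
    using assms(14-16) by (cases L_minus; cases L_plus) auto
  define b where "b = \<bar>m\<bar> + \<bar>p\<bar> + 1"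
  have b: "0 < b" "ereal (- b) < L_minus" "L_plus < ereal b" by (auto simp: b_def mp)
  have P: "0 < 40 * \<Lambda> * b * w\<^sup>2" if "0 < b" for b :: real using \<Lambda> w that by simp
  have part1: "\<exists>lam_low :: ereal. 0 < lam_low \<and>
            (\<forall>lam :: real. 0 \<le> lam \<and> ereal lam < lam_low \<longrightarrow> \<not> bifurcation_point \<Omega> A f l lam)"
  proof (intro exI[of _ "ereal (1 / (40 * \<Lambda> * b * w\<^sup>2))"] conjI allI impI notI)
    show "0 < ereal (1 / (40 * \<Lambda> * b * w\<^sup>2))" using P[OF b(1)] by simp
    fix lam assume "0 \<le> lam \<and> ereal lam < ereal (1 / (40 * \<Lambda> * b * w\<^sup>2))" and bif: "bifurcation_point \<Omega> A f l lam"
    then have "40 * \<Lambda> * b * w\<^sup>2 * lam < 1" using P[OF b(1)] by (simp add: less_divide_eq mult.commute)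
    with low[OF b bif] show False by simp
  qed
  have part2: False if "L_plus < 0 \<or> (L_minus = 0 \<and> L_plus = 0)" and bif: "bifurcation_point \<Omega> A f l mu" for mu
  proof (cases "L_plus < 0")
    case False
    then have L0: "L_minus = 0" "L_plus = 0" using that(1) by auto
    have mu: "0 \<le> mu" using bif by (simp add: bifurcation_point_def)
    \<comment> \<open>any positive bound \<open>b'\<close> on \<open>|F s| / s\<^sup>2\<close> is eventually available, and this one contradicts \<open>low\<close>\<close>
    define c where "c = 40 * \<Lambda> * w\<^sup>2 * (mu + 1)"
    have c: "0 < c" using \<Lambda> w mu by (simp add: c_def)
    define b' where "b' = 1 / (2 * c)"
    have "1 \<le> 40 * \<Lambda> * b' * w\<^sup>2 * mu"
      by (rule low[OF _ _ _ bif]) (use c L0 in \<open>auto simp: b'_def\<close>)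
    also have "\<dots> \<le> 40 * \<Lambda> * b' * w\<^sup>2 * (mu + 1)"
      using \<Lambda> c by (intro mult_left_mono) (auto simp: b'_def)
    also have "\<dots> = c * b'" by (simp add: c_def mult_ac)
    also have "\<dots> = 1 / 2" using c by (simp add: b'_def)
    finally show False by simp
  next
    case True
    obtain lam u x0 where s: "\<And>n. solution_with_maximum \<Omega> A \<Lambda> f (lam n) (u n) k w (x0 n)"
      "lam \<longlonglongrightarrow> mu" "filterlim (\<lambda>n::nat. u n (x0 n)) (towards l) sequentially"
      using bifurcation_sequence[OF op bd ell \<Lambda> cf l width bif] by blast
    define c where "c = - p / 2"
    have c: "0 < c" "L_plus < ereal (- c)" using True by (auto simp: mp c_def zero_ereal_def)
    have "eventually (\<lambda>s. ereal (?F s / s\<^sup>2) < ereal (- c)) (towards l)"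
      using c(2) unfolding assms(13) by (rule Limsup_lessD)
    then have evc: "eventually (\<lambda>s. ?F s \<le> - c * s\<^sup>2) (towards l)"
      using eventually_towards_pos[OF l]
    proof eventually_elim
      case (elim s)
      then show ?case by (simp add: divide_less_eq)
    qed
    show False
    proof (cases "l = \<infinity>")
      case True
      have "\<exists>a\<ge>\<alpha> 0. \<forall>s\<ge>\<alpha> 0. ?F s \<le> ?F a"
      proof (rule attains_maximum_beyond[OF F_weighted_continuous[OF cf] _ c(1)])
        show "0 \<le> \<alpha> 0" using assms(9)[of 0] by simp
        show "eventually (\<lambda>s. ?F s \<le> - c * s\<^sup>2) at_top" using evc True by (simp add: towards_def)
      qed
      then obtain a where a: "\<alpha> 0 \<le> a" "\<And>s. \<alpha> 0 \<le> s \<Longrightarrow> ?F s \<le> ?F a" by blast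
      have a0: "0 \<le> a" using assms(9)[of 0] a(1) by linarith
      have fa: "f a = 0"
        by (rule critical_point_of_F_weighted[OF cf assms(9) assms(11) a(1) \<Lambda>1 a(2)])
      have "eventually (\<lambda>n. a < u n (x0 n)) sequentially"
        using s(3) True by (simp add: towards_def filterlim_at_top_dense)
      then obtain n where n: "a < u n (x0 n)" by (auto simp: eventually_sequentially)
      obtain C where C: "0 < C" "\<forall>s\<in>{a..u n (x0 n)}. ?F a - ?F s \<le> C * (s - a)\<^sup>2"
        using F_weighted_drop_le[OF lip a0 fa \<Lambda>1] by blast
      show False
        by (rule solution_with_maximum.no_solution_above_maximum_of_F[OF s(1) a0 n C(1)])
          (use C(2) a in auto)
    next
      case False
      have "eventually (\<lambda>s. \<bar>?F s\<bar> \<le> b * s\<^sup>2 \<and> ?F s \<le> - c * s\<^sup>2) (towards l)"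
        using evb[OF b(2,3)] evc by (rule eventually_conj)
      then obtain d where d: "0 < d" "\<And>s. 0 < s \<Longrightarrow> s < d \<Longrightarrow> \<bar>?F s\<bar> \<le> b * s\<^sup>2 \<and> ?F s \<le> - c * s\<^sup>2"
        using False by (auto simp: towards_def eventually_at_right_field)
      have "eventually (\<lambda>M. M < d / 2) (towards l)"
        using False d(1) by (auto simp: towards_def eventually_at_right_field intro!: exI[of _ "d / 2"])
      from s(3)[unfolded filterlim_iff, rule_format, OF this]
      have "eventually (\<lambda>n. u n (x0 n) < d / 2) sequentially" .
      then obtain n where n: "u n (x0 n) < d / 2" by (auto simp: eventually_sequentially)
      show False
      proof (rule solution_with_maximum.no_solution_above_maximum_of_F[OF s(1) order_refl solution_with_maximum.max_pos[OF s(1)] b(1)])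
        fix t assume t: "t \<in> {0..2 * u n (x0 n)}"
        show "?F t \<le> ?F 0"
        proof (cases "t = 0")
          case False
          then have "?F t \<le> - c * t\<^sup>2" using t n d(2)[of t] by simp
          also have "\<dots> \<le> 0" using c(1) by simp
          finally show ?thesis by simp
        qed simp
      next
        fix t assume t: "t \<in> {0..u n (x0 n)}"
        show "?F 0 - ?F t \<le> b * (t - 0)\<^sup>2"
        proof (cases "t = 0")
          case False
          then have "\<bar>?F t\<bar> \<le> b * t\<^sup>2" using t n d by auto
          then show ?thesis by (simp add: abs_le_iff)
        qed simp
      qed
    qed
  qed
  show ?thesis using part1 part2 by blast
qed

end
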